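(* There exists a boundedly acyclic group $\Gamma$ with a normal subgroup $H$ such that $\Gamma/H$ is boundedly acyclic, but $\operatorname{H}^n_b(H;\mathbb{R})$ has dimension equal to the cardinality of the continuum for every $n \geq 2$.
   Context: $\operatorname{H}^*_b(\cdot;\mathbb{R})$ denotes bounded cohomology of groups with trivial real coefficients. A group $G$ is boundedly acyclic if $\operatorname{H}^n_b(G;\mathbb{R}) \cong 0$ for all $n\geq 1$. *)

theory Defs
  imports "HOL-Algebra.Algebra" "HOL-Library.Equipollence"
begin

text \<open>Bounded cohomology of a group G with trivial real coefficients, via the
inhomogeneous bounded cochain complex. An n-cochain is a bounded real function on
n-tuples (lists of length n) of group elements, extended by 0 elsewhere.\<close>

definition bcochain :: "('a, 'b) monoid_scheme \<Rightarrow> nat \<Rightarrow> ('a list \<Rightarrow> real) set" where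
  "bcochain G n = {f. (\<forall>xs. f xs \<noteq> 0 \<longrightarrow> length xs = n \<and> set xs \<subseteq> carrier G)
                      \<and> (\<exists>C. \<forall>xs. \<bar>f xs\<bar> \<le> C)}"

definition bcobound :: "('a, 'b) monoid_scheme \<Rightarrow> nat \<Rightarrow> ('a list \<Rightarrow> real) \<Rightarrow> ('a list \<Rightarrow> real)" where
  "bcobound G n f = (\<lambda>xs. if length xs = Suc n \<and> set xs \<subseteq> carrier G then
      f (tl xs)
      + (\<Sum>i=1..n. (-1)^i * f (take (i - 1) xs @ [xs ! (i - 1) \<otimes>\<^bsub>G\<^esub> xs ! i] @ drop (i + 1) xs))
      + (-1)^(Suc n) * f (butlast xs)
    else 0)"

definition bcocycles :: "('a, 'b) monoid_scheme \<Rightarrow> nat \<Rightarrow> ('a list \<Rightarrow> real) set" where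
  "bcocycles G n = {f \<in> bcochain G n. bcobound G n f = (\<lambda>_. 0)}"

definition bcoboundaries :: "('a, 'b) monoid_scheme \<Rightarrow> nat \<Rightarrow> ('a list \<Rightarrow> real) set" where
  "bcoboundaries G n = (case n of 0 \<Rightarrow> {\<lambda>_. 0} | Suc m \<Rightarrow> bcobound G m ` bcochain G m)"

definition bcoh_vanishes :: "('a, 'b) monoid_scheme \<Rightarrow> nat \<Rightarrow> bool" where
  "bcoh_vanishes G n \<longleftrightarrow> bcocycles G n \<subseteq> bcoboundaries G n"

definition boundedly_acyclic :: "('a, 'b) monoid_scheme \<Rightarrow> bool" where
  "boundedly_acyclic G \<longleftrightarrow> group G \<and> (\<forall>n\<ge>1. bcoh_vanishes G n)"

definition lincomb :: "(('a list \<Rightarrow> real) \<Rightarrow> real) \<Rightarrow> ('a list \<Rightarrow> real) set \<Rightarrow> ('a list \<Rightarrow> real)" where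
  "lincomb c T = (\<lambda>xs. \<Sum>t\<in>T. c t * t xs)"

text \<open>The real vector space H^n_b(G;R) = Z^n/B^n has a basis (the classes of a set
S of cocycles) equipollent to A, i.e. its dimension is the cardinality of A.\<close>
definition bcoh_dim_eqpoll :: "('a, 'b) monoid_scheme \<Rightarrow> nat \<Rightarrow> 'c set \<Rightarrow> bool" where
  "bcoh_dim_eqpoll G n A \<longleftrightarrow> (\<exists>S \<subseteq> bcocycles G n. S \<approx> A
     \<and> (\<forall>T c. finite T \<and> T \<subseteq> S \<and> lincomb c T \<in> bcoboundaries G n \<longrightarrow> (\<forall>t\<in>T. c t = 0))
     \<and> (\<forall>z \<in> bcocycles G n. \<exists>T c b. finite T \<and> T \<subseteq> S \<and> b \<in> bcoboundaries G n
            \<and> z = (\<lambda>xs. lincomb c T xs + b xs)))"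

end

theory Submission
  imports Defs "HOL-Analysis.Analysis"
begin

text \<open>
  \<open>\<Gamma>\<close> is the restricted wreath product of a countable group \<open>G\<close> with the group of finitary permutations
  of the natural numbers, and \<open>H\<close> is its base group, the direct sum of countably many copies of \<open>G\<close>.

  Bounded acyclicity of \<open>\<Gamma>\<close> (for every countable \<open>G\<close>): a homogeneous cocycle \<open>F(g\<^sub>0, \<dots>, g\<^sub>n)\<close> is cohomologous
  to the average of \<open>F(g\<^sub>0X\<^sub>0, \<dots>, g\<^sub>nX\<^sub>n)\<close> over independent random elements \<open>X\<^sub>i\<close>. Take \<open>X\<^sub>i\<close> to consist of
  independent random words on many lamps and a uniform permutation of these lamps. Translating one lamp
  by an element of \<open>G\<close> amounts to inserting a bounded density at that lamp; by invariance under permutations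
  the density can be moved to any other lamp, hence be replaced by its average over all lamps, which is close to
  1 by the law of large numbers. So the averaged cocycle is constant.

  Nontrivial classes of \<open>H\<close>: choose \<open>G = GL\<^sub>2\<^sup>+(Q) \<times> GL\<^sub>2(Q(i))\<close>. On the projective line these groups have
  amenable point stabilisers, so a bounded primitive of an invariant cocycle may be averaged to an invariant
  function on tuples of points. The orientation cocycle of \<open>P\<^sup>1(Q)\<close> and the volume cocycle (Bloch-Wigner
  dilogarithm of the cross ratio) of \<open>P\<^sup>1(Q(i))\<close> are then nontrivial because the actions are 2- and 3-transitive,
  respectively. Cup products with the orientation class give all degrees at least 2, and the sums
  \<open>\<Sum>\<^sub>i t\<^sup>i r\<^sub>i\<^sup>*c\<close> over countably many retractions \<open>r\<^sub>i\<close> of \<open>H\<close> onto itself, for \<open>0 < t < 1\<close>, give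
  continuum many independent classes.
\<close>

section \<open>Homogeneous cochains\<close>

text \<open>A cup product with the orientation class raises the degree by 2, so classes in both
  degrees 2 and 3 are needed to start from; this is why \<open>G\<close> has two factors. The
  induction over degrees uses that the direct sum is isomorphic to its product with one further
  lamp. A product is shown to be nonzero by a bounded functional on cochains that kills coboundaries
  and sees the orientation cocycle; applying it in one variable is a slant product. Matrices over Q
  and Q(i) replace real and complex ones because countability enters three times: random words need
  an enumeration of \<open>G\<close>, invariant means are built from countably many maps, and the
  dimension is bounded above by the cardinality of the space of all cochains. For the
  \<open>G\<close> chosen, the wreath product is not amenable and carries no invariant mean; only
  the iterated average of an invariant cochain, in independent variables, becomes asymptotically
  constant. The density at one lamp is bounded only by the word length l, and its product over n
  entries can have second moment near l^n; the number of lamps, l^l, outgrows this for every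
  n.\<close>

fun cobd :: "('g list \<Rightarrow> real) \<Rightarrow> 'g list \<Rightarrow> real" where
  "cobd F [] = 0"
| "cobd F (p # l) = F l - cobd (\<lambda>l. F (p # l)) l"

definition bddf :: "('x \<Rightarrow> real) \<Rightarrow> bool" where
  "bddf F \<longleftrightarrow> (\<exists>C. \<forall>x. \<bar>F x\<bar> \<le> C)"

definition translation_inv :: "('g::group_add list \<Rightarrow> real) \<Rightarrow> bool" where
  "translation_inv F \<longleftrightarrow> (\<forall>g xs. F (map ((+) g) xs) = F xs)"

text \<open>Homogeneous cochains are total functions on lists of every length, so that
  \<open>cobd\<close> needs no degree. Degree \<open>n\<close> is read off at lists of length
  \<open>n + 1\<close>, the cocycle condition at length \<open>n + 2\<close>; invariance and
  boundedness are imposed at all lengths at once.\<close>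

definition cocycle :: "nat \<Rightarrow> ('g::group_add list \<Rightarrow> real) \<Rightarrow> bool" where
  "cocycle n F \<longleftrightarrow> translation_inv F \<and> bddf F \<and> (\<forall>xs. length xs = n + 2 \<longrightarrow> cobd F xs = 0)"

definition coboundary :: "nat \<Rightarrow> ('g::group_add list \<Rightarrow> real) \<Rightarrow> bool" where
  "coboundary n F \<longleftrightarrow> (\<exists>B. translation_inv B \<and> bddf B \<and> (\<forall>xs. length xs = n + 1 \<longrightarrow> F xs = cobd B xs))"

lemma bddf_I: "(\<And>x. \<bar>F x\<bar> \<le> C) \<Longrightarrow> bddf F"
  by (auto simp: bddf_def)

lemma bddfE:
  assumes "bddf F"
  obtains C where "C \<ge> 0" "\<And>x. \<bar>F x\<bar> \<le> C"
proof -
  obtain C where C: "\<And>x. \<bar>F x\<bar> \<le> C" using assms by (auto simp: bddf_def)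
  have "\<And>x. \<bar>F x\<bar> \<le> \<bar>C\<bar>" using C by (meson abs_ge_self order_trans)
  then show ?thesis using that[of "\<bar>C\<bar>"] by simp
qed

lemma bddf_const [simp]: "bddf (\<lambda>_. c)"
  by (rule bddf_I[of _ "\<bar>c\<bar>"]) simp

lemma bddf_comp: "bddf F \<Longrightarrow> bddf (\<lambda>x. F (h x))"
  by (auto simp: bddf_def)

lemma bddf_add: assumes "bddf F" "bddf G" shows "bddf (\<lambda>x. F x + G x)"
proof -
  obtain C D where "\<And>x. \<bar>F x\<bar> \<le> C" "\<And>x. \<bar>G x\<bar> \<le> D" using assms by (auto simp: bddf_def)
  then show ?thesis by (intro bddf_I[of _ "C + D"]) (metis abs_triangle_ineq add_mono order_trans)
qed

lemma bddf_mult: assumes "bddf F" "bddf G" shows "bddf (\<lambda>x. F x * G x)"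
proof -
  obtain C D where C: "C \<ge> 0" "\<And>x. \<bar>F x\<bar> \<le> C" and D: "D \<ge> 0" "\<And>x. \<bar>G x\<bar> \<le> D"
    using assms by (meson bddfE)
  then show ?thesis by (intro bddf_I[of _ "C * D"]) (simp add: abs_mult mult_mono)
qed

lemma bddf_cmult: "bddf F \<Longrightarrow> bddf (\<lambda>x. c * F x)"
  using bddf_mult[of "\<lambda>_. c"] by simp

lemma bddf_minus: "bddf F \<Longrightarrow> bddf (\<lambda>x. - F x)"
  using bddf_cmult[of F "-1"] by simp

lemma cobd_add: "cobd (\<lambda>l. F l + G l) xs = cobd F xs + cobd G xs"
  by (induction xs arbitrary: F G) auto

lemma cobd_cmult: "cobd (\<lambda>l. c * F l) xs = c * cobd F xs"
  by (induction xs arbitrary: F) (auto simp: algebra_simps)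

lemma cobd_minus: "cobd (\<lambda>l. - F l) xs = - cobd F xs"
  using cobd_cmult[of "-1" F xs] by simp

lemma cobd_diff: "cobd (\<lambda>l. F l - G l) xs = cobd F xs - cobd G xs"
  using cobd_add[of F "\<lambda>l. - G l" xs] cobd_minus[of G xs] by simp

lemma cobd_cong:
  "(\<And>l. Suc (length l) = length xs \<Longrightarrow> F l = G l) \<Longrightarrow> cobd F xs = cobd G xs"
proof (induction xs arbitrary: F G)
  case (Cons p l)
  have "cobd (\<lambda>l. F (p # l)) l = cobd (\<lambda>l. G (p # l)) l"
    by (rule Cons.IH) (use Cons.prems in auto)
  then show ?case using Cons.prems[of l] by simp
qed simp

lemma cobd_map: "cobd F (map h xs) = cobd (\<lambda>l. F (map h l)) xs"
  by (induction xs arbitrary: F) auto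

lemma cobd_const: "cobd (\<lambda>_. c) xs = (if even (length xs) then 0 else c)"
  by (induction xs) auto

lemma cobd_abs_le:
  assumes "\<And>l. \<bar>F l\<bar> \<le> C" shows "\<bar>cobd F xs\<bar> \<le> C * length xs"
  using assms
proof (induction xs arbitrary: F)
  case (Cons p l)
  have "\<bar>cobd (\<lambda>l. F (p # l)) l\<bar> \<le> C * length l" by (rule Cons.IH) (use Cons.prems in auto)
  then show ?case using Cons.prems[of l] by (simp add: algebra_simps)
qed simp

definition del :: "nat \<Rightarrow> 'g list \<Rightarrow> 'g list" where "del i xs = take i xs @ drop (Suc i) xs"

lemma del_0 [simp]: "del 0 (x # xs) = xs" by (simp add: del_def)
lemma del_Suc [simp]: "del (Suc i) (x # xs) = x # del i xs" by (simp add: del_def)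

lemma cobd_sum: "cobd F xs = (\<Sum>i<length xs. (-1)^i * F (del i xs))"
proof (induction xs arbitrary: F)
  case (Cons p l)
  show ?case by (simp add: Cons.IH sum.lessThan_Suc_shift sum_negf del: sum.lessThan_Suc)
qed simp

lemma coboundary_cmult:
  assumes "coboundary n F" shows "coboundary n (\<lambda>xs. c * F xs)"
proof -
  obtain B where B: "translation_inv B" "bddf B" "\<And>xs. length xs = n + 1 \<Longrightarrow> F xs = cobd B xs"
    using assms by (auto simp: coboundary_def)
  then show ?thesis unfolding coboundary_def
    by (intro exI[of _ "\<lambda>xs. c * B xs"]) (auto simp: translation_inv_def bddf_cmult cobd_cmult)
qed

lemma coboundary_add:
  assumes "coboundary n F" "coboundary n G" shows "coboundary n (\<lambda>xs. F xs + G xs)"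
proof -
  obtain B where B: "translation_inv B" "bddf B" "\<And>xs. length xs = n + 1 \<Longrightarrow> F xs = cobd B xs"
    using assms by (auto simp: coboundary_def)
  obtain B' where B': "translation_inv B'" "bddf B'" "\<And>xs. length xs = n + 1 \<Longrightarrow> G xs = cobd B' xs"
    using assms by (auto simp: coboundary_def)
  from B B' show ?thesis unfolding coboundary_def
    by (intro exI[of _ "\<lambda>xs. B xs + B' xs"]) (auto simp: translation_inv_def bddf_add cobd_add)
qed

lemma coboundary_cong:
  "(\<And>xs. length xs = n + 1 \<Longrightarrow> F xs = G xs) \<Longrightarrow> coboundary n F \<longleftrightarrow> coboundary n G"
  by (auto simp: coboundary_def)

text \<open>The \<open>n + 1\<close> alternating signs add up to 1 for even \<open>n\<close>, so
  that a constant of even degree is its own coboundary. This absorbs the limits of averaged cocycles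
  and, later, the contributions of trivial tuples.\<close>

lemma const_cocycle_coboundary:
  assumes "n \<ge> 1" "odd n \<Longrightarrow> c = 0" shows "coboundary n (\<lambda>_::'g::group_add list. c)"
proof (cases "odd n")
  case True
  then show ?thesis using assms unfolding coboundary_def
    by (intro exI[of _ "\<lambda>_. 0"]) (auto simp: translation_inv_def cobd_const)
next
  case False
  then show ?thesis unfolding coboundary_def
    by (intro exI[of _ "\<lambda>_. c"]) (auto simp: translation_inv_def cobd_const)
qed

section \<open>Comparison with the inhomogeneous complex\<close>

text \<open>Passage to bar coordinates: a tuple g_0, ..., g_n is encoded by the elements -g_i +
  g_(i+1). Groups are written additively without being commutative, so the order of summands
  matters. \<open>psums\<close> rebuilds the tuple from its initial entry.\<close>

fun increments :: "'g::group_add list \<Rightarrow> 'g list" where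
  "increments (x # y # l) = (- x + y) # increments (y # l)"
| "increments _ = []"

fun psums :: "'g::group_add \<Rightarrow> 'g list \<Rightarrow> 'g list" where
  "psums s [] = [s]"
| "psums s (y # l) = s # psums (s + y) l"

lemma length_increments [simp]: "length (increments xs) = length xs - 1"
  by (induction xs rule: increments.induct) auto

lemma length_psums [simp]: "length (psums s ys) = Suc (length ys)"
  by (induction ys arbitrary: s) auto

lemma increments_psums [simp]: "increments (psums s ys) = ys"
proof (induction ys arbitrary: s)
  case (Cons y l)
  obtain z zs where z: "psums (s + y) l = z # zs" "z = s + y" by (cases l) auto
  show ?case using Cons.IH[of "s + y"] z by (simp add: add.assoc[symmetric])
qed simp

lemma psums_increments: "xs \<noteq> [] \<Longrightarrow> psums (hd xs) (increments xs) = xs"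
  by (induction xs rule: increments.induct) (auto simp: add.assoc[symmetric])

lemma psums_translate: "psums (g + s) ys = map ((+) g) (psums s ys)"
  by (induction ys arbitrary: s) (auto simp: add.assoc)

lemma increments_translate: "increments (map ((+) g) xs) = increments xs"
proof (induction xs rule: increments.induct)
  case (1 x y l)
  have "- (g + x) + (g + y) = - x + y"
    by (simp only: minus_add add.assoc minus_add_cancel)
  then show ?case using 1 by simp
qed auto

lemma inv_psums:
  assumes "translation_inv B" "xs \<noteq> []" shows "B (psums 0 (increments xs)) = B xs"
proof -
  have "psums (hd xs + 0) (increments xs) = map ((+) (hd xs)) (psums 0 (increments xs))" by (rule psums_translate)
  then show ?thesis using psums_increments[OF assms(2)] assms(1) unfolding translation_inv_def by (metis add_0_right)
qed

lemma increments_del_last: "xs \<noteq> [] \<Longrightarrow> increments (del (length xs - 1) xs) = butlast (increments xs)"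
proof (induction xs rule: increments.induct)
  case (1 x y l)
  show ?case
  proof (cases l)
    case Nil then show ?thesis by (simp add: del_def)
  next
    case (Cons z zs)
    have "increments (y # del (length zs) (z # zs)) = butlast (increments (y # l))" using 1 Cons by simp
    then show ?thesis using Cons by simp
  qed
qed (auto simp: del_def)

text \<open>Deleting an inner entry y merges two neighbouring increments, (-x + y) + (-y + z) = -x +
  z. This is the multiplication in the middle faces of the bar differential.\<close>

lemma increments_del_mid:
  assumes "1 \<le> i" "Suc i < length xs"
  shows "increments (del i xs) = take (i - 1) (increments xs) @ [increments xs ! (i - 1) + increments xs ! i] @ drop (i + 1) (increments xs)"
  using assms
proof (induction xs arbitrary: i rule: increments.induct)
  case (1 x y l)
  show ?case
  proof (cases "i = 1")
    case True
    then obtain z zs where l: "l = z # zs" using 1 by (cases l) auto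
    have "- x + z = - x + y + (- y + z)" by (metis add.assoc add.right_inverse add_0)
    then show ?thesis using True l by simp
  next
    case False
    then obtain j where j: "i = Suc j" "1 \<le> j" using 1 by (cases i) auto
    then obtain k where k: "j = Suc k" by (cases j) auto
    have IH: "increments (del j (y # l)) = take (j - 1) (increments (y # l)) @ [increments (y # l) ! (j - 1) + increments (y # l) ! j] @ drop (j + 1) (increments (y # l))"
      using 1 j by auto
    have "increments (del i (x # y # l)) = (- x + y) # increments (del j (y # l))" using j k by simp
    then show ?thesis using IH j k by simp
  qed
qed auto

text \<open>The link between a group given as a type of class \<open>group_add\<close> and a group
  with a carrier: cochains are handled on the type, and only the final statements are carried
  over.\<close>

definition tgroup_iso :: "('g::group_add \<Rightarrow> 'a) \<Rightarrow> ('a, 'b) monoid_scheme \<Rightarrow> bool" where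
  "tgroup_iso \<theta> G \<longleftrightarrow> bij_betw \<theta> UNIV (carrier G) \<and> (\<forall>x y. \<theta> (x + y) = \<theta> x \<otimes>\<^bsub>G\<^esub> \<theta> y)"

lemma bcobound_increments:
  assumes \<theta>: "tgroup_iso \<theta> G" and len: "length xs = n + 2"
  shows "bcobound G n f (map \<theta> (increments xs)) = cobd (\<lambda>l. f (map \<theta> (increments l))) xs"
proof -
  let ?ys = "map \<theta> (increments xs)" let ?F = "\<lambda>l. f (map \<theta> (increments l))"
  have c: "set ?ys \<subseteq> carrier G" using \<theta> by (auto simp: tgroup_iso_def bij_betw_def)
  obtain x l where xl: "xs = x # l" "length l = n + 1" using len by (cases xs) auto
  then obtain y l' where l': "l = y # l'" by (cases l) auto
  have 0: "f (tl ?ys) = ?F (del 0 xs)" using xl l' by simp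
  have last: "f (butlast ?ys) = ?F (del (Suc n) xs)"
  proof -
    have "increments (del (length xs - 1) xs) = butlast (increments xs)" by (rule increments_del_last) (use xl in auto)
    then show ?thesis using len by (simp add: map_butlast)
  qed
  have mid: "f (take (i - 1) ?ys @ [?ys ! (i - 1) \<otimes>\<^bsub>G\<^esub> ?ys ! i] @ drop (i + 1) ?ys) = ?F (del i xs)"
    if "i \<in> {1..n}" for i
  proof -
    have i: "1 \<le> i" "Suc i < length xs" "i - 1 < length (increments xs)" "i < length (increments xs)" using that len by auto
    have "map \<theta> (increments (del i xs)) = take (i - 1) ?ys @ [?ys ! (i - 1) \<otimes>\<^bsub>G\<^esub> ?ys ! i] @ drop (i + 1) ?ys"
      unfolding increments_del_mid[OF i(1,2)] using \<theta> i by (simp add: take_map drop_map tgroup_iso_def)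
    then show ?thesis by simp
  qed
  have "bcobound G n f ?ys = ?F (del 0 xs) + (\<Sum>i=1..n. (-1)^i * ?F (del i xs)) + (-1)^(Suc n) * ?F (del (Suc n) xs)"
    unfolding bcobound_def using c len 0 last mid by (auto intro!: sum.cong)
  also have "\<dots> = (\<Sum>i<n + 2. (-1)^i * ?F (del i xs))"
  proof -
    have "{..<n+2} = insert 0 (insert (Suc n) {1..n})" by auto
    then show ?thesis by simp
  qed
  finally show ?thesis using len by (simp add: cobd_sum)
qed

lemma bcochain_to_homogeneous:
  assumes "tgroup_iso \<theta> G" "f \<in> bcochain G n"
  shows "translation_inv (\<lambda>l. f (map \<theta> (increments l)))" "bddf (\<lambda>l. f (map \<theta> (increments l)))"
  using assms by (auto simp: translation_inv_def increments_translate bcochain_def bddf_def)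

text \<open>\<open>psums 0\<close> picks the tuple that starts at the identity from its translation
  orbit. The value 0 elsewhere is the convention that \<open>bcochain\<close> demands.\<close>

definition to_inhom :: "('g::group_add \<Rightarrow> 'a) \<Rightarrow> ('a, 'b) monoid_scheme \<Rightarrow> nat \<Rightarrow> ('g list \<Rightarrow> real) \<Rightarrow> ('a list \<Rightarrow> real)" where
  "to_inhom \<theta> G n B ys = (if length ys = n \<and> set ys \<subseteq> carrier G
     then B (psums 0 (map (the_inv_into UNIV \<theta>) ys)) else 0)"

lemma to_inhom_bcochain: assumes "bddf B" shows "to_inhom \<theta> G n B \<in> bcochain G n"
proof -
  obtain C where "C \<ge> 0" "\<And>x. \<bar>B x\<bar> \<le> C" using assms by (rule bddfE) blast
  then show ?thesis by (auto simp: bcochain_def to_inhom_def intro!: exI[of _ C])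
qed

lemma to_inhom_increments:
  assumes "tgroup_iso \<theta> G" "translation_inv B" "length xs = n + 1"
  shows "to_inhom \<theta> G n B (map \<theta> (increments xs)) = B xs"
proof -
  have i: "inj \<theta>" "range \<theta> = carrier G" using assms(1) by (auto simp: tgroup_iso_def bij_betw_def)
  have "map (the_inv_into UNIV \<theta>) (map \<theta> (increments xs)) = increments xs"
    using i by (simp add: o_def the_inv_into_f_f)
  moreover have "set (map \<theta> (increments xs)) \<subseteq> carrier G" using i by auto
  moreover have "xs \<noteq> []" using assms(3) by auto
  ultimately show ?thesis using inv_psums[OF assms(2)] assms(3) by (simp add: to_inhom_def)
qed

lemma carrier_list_as_increments:
  assumes "tgroup_iso \<theta> G" "set ys \<subseteq> carrier G"
  obtains xs where "ys = map \<theta> (increments xs)" "length xs = length ys + 1"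
proof -
  have i: "inj \<theta>" "range \<theta> = carrier G" using assms(1) by (auto simp: tgroup_iso_def bij_betw_def)
  have "map \<theta> (map (the_inv_into UNIV \<theta>) ys) = ys"
    using i assms(2) by (auto simp: f_the_inv_into_f intro!: map_idI)
  then show ?thesis using that[of "psums 0 (map (the_inv_into UNIV \<theta>) ys)"] by simp
qed

lemma bcocycle_to_homogeneous:
  assumes "tgroup_iso \<theta> G" "f \<in> bcocycles G n"
  shows "cocycle n (\<lambda>l. f (map \<theta> (increments l)))"
proof -
  have "f \<in> bcochain G n" "bcobound G n f = (\<lambda>_. 0)" using assms(2) by (auto simp: bcocycles_def)
  then show ?thesis using bcochain_to_homogeneous[OF assms(1)] bcobound_increments[OF assms(1), of _ n f]
    by (auto simp: cocycle_def)
qed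

lemma to_inhom_bcocycle:
  assumes \<theta>: "tgroup_iso \<theta> G" and F: "cocycle n F"
  shows "to_inhom \<theta> G n F \<in> bcocycles G n"
proof -
  have inv: "translation_inv F" and b: "bddf F" using F by (auto simp: cocycle_def)
  have "bcobound G n (to_inhom \<theta> G n F) ys = 0" for ys
  proof (cases "length ys = Suc n \<and> set ys \<subseteq> carrier G")
    case True
    then obtain xs where xs: "ys = map \<theta> (increments xs)" "length xs = n + 2"
      using carrier_list_as_increments[OF \<theta>, of ys] by (metis Suc_eq_plus1 add_2_eq_Suc')
    have "bcobound G n (to_inhom \<theta> G n F) ys = cobd (\<lambda>l. to_inhom \<theta> G n F (map \<theta> (increments l))) xs"
      using bcobound_increments[OF \<theta>] xs by simp
    also have "\<dots> = cobd F xs" by (rule cobd_cong) (use xs to_inhom_increments[OF \<theta> inv] in auto)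
    also have "\<dots> = 0" using F xs by (simp add: cocycle_def)
    finally show ?thesis .
  qed (auto simp: bcobound_def)
  then show ?thesis using to_inhom_bcochain[OF b] by (auto simp: bcocycles_def)
qed

lemma bcoboundary_iff:
  assumes \<theta>: "tgroup_iso \<theta> G" and f: "f \<in> bcochain G (Suc m)"
  shows "f \<in> bcoboundaries G (Suc m) \<longleftrightarrow> coboundary (Suc m) (\<lambda>l. f (map \<theta> (increments l)))"
proof
  assume "f \<in> bcoboundaries G (Suc m)"
  then obtain b where b: "b \<in> bcochain G m" "f = bcobound G m b" by (auto simp: bcoboundaries_def)
  show "coboundary (Suc m) (\<lambda>l. f (map \<theta> (increments l)))" unfolding coboundary_def
    using bcochain_to_homogeneous[OF \<theta> b(1)] bcobound_increments[OF \<theta>, of _ m b] b(2)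
    by (intro exI[of _ "\<lambda>l. b (map \<theta> (increments l))"]) auto
next
  assume "coboundary (Suc m) (\<lambda>l. f (map \<theta> (increments l)))"
  then obtain B where B: "translation_inv B" "bddf B"
    "\<And>xs. length xs = Suc m + 1 \<Longrightarrow> f (map \<theta> (increments xs)) = cobd B xs" by (auto simp: coboundary_def)
  let ?b = "to_inhom \<theta> G m B"
  have "f ys = bcobound G m ?b ys" for ys
  proof (cases "length ys = Suc m \<and> set ys \<subseteq> carrier G")
    case True
    then obtain xs where xs: "ys = map \<theta> (increments xs)" "length xs = m + 2"
      using carrier_list_as_increments[OF \<theta>, of ys] by (metis Suc_eq_plus1 add_2_eq_Suc')
    have "bcobound G m ?b ys = cobd (\<lambda>l. ?b (map \<theta> (increments l))) xs" using bcobound_increments[OF \<theta>] xs by simp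
    also have "\<dots> = cobd B xs" by (rule cobd_cong) (use xs to_inhom_increments[OF \<theta> B(1)] in auto)
    finally show ?thesis using B(3) xs by simp
  next
    case False
    then have "f ys = 0" using f by (auto simp: bcochain_def)
    then show ?thesis using False by (auto simp: bcobound_def)
  qed
  then have "f = bcobound G m ?b" by auto
  then show "f \<in> bcoboundaries G (Suc m)" using to_inhom_bcochain[OF B(2), of \<theta> G m]
    by (auto simp: bcoboundaries_def)
qed

lemma boundedly_acyclicI:
  assumes \<theta>: "tgroup_iso (\<theta> :: 'g::group_add \<Rightarrow> 'a) G" and "group G"
    and ac: "\<And>n (F :: 'g list \<Rightarrow> real). n \<ge> 1 \<Longrightarrow> cocycle n F \<Longrightarrow> coboundary n F"
  shows "boundedly_acyclic G"
  unfolding boundedly_acyclic_def bcoh_vanishes_def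
proof (intro conjI allI impI subsetI)
  fix n f assume n: "1 \<le> n" and f: "f \<in> bcocycles G n"
  obtain m where m: "n = Suc m" using n by (cases n) auto
  have "f \<in> bcochain G (Suc m)" using f m by (auto simp: bcocycles_def)
  then show "f \<in> bcoboundaries G n"
    using bcoboundary_iff[OF \<theta>] ac[OF n bcocycle_to_homogeneous[OF \<theta> f]] m by blast
qed fact

section \<open>Ultralimits of bounded sequences\<close>

text \<open>A minimal proper filter below \<open>sequentially\<close>, found by Zorn. The infimum of
  a chain stays proper because what holds eventually in it already holds eventually in some member.
  Minimality decides each \<open>P\<close>: restricting the filter to \<open>P\<close> either
  trivialises it or changes nothing.\<close>

lemma ex_ultrafilter:
  "\<exists>U::nat filter. U \<noteq> bot \<and> U \<le> sequentially \<and> (\<forall>P. eventually P U \<or> eventually (\<lambda>x. \<not> P x) U)"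
proof -
  let ?A = "{F::nat filter. F \<noteq> bot \<and> F \<le> sequentially}"
  have "\<exists>u\<in>?A. \<forall>a\<in>?A. a \<le> u \<longrightarrow> a = u"
  proof (rule predicate_Zorn[of ?A "\<lambda>a b. b \<le> a"])
    show "partial_order_on ?A (relation_of (\<lambda>a b. b \<le> a) ?A)"
      by (rule partial_order_on_relation_ofI) auto
  next
    fix C assume C: "C \<in> Chains (relation_of (\<lambda>a b. b \<le> a) ?A)"
    show "\<exists>u\<in>?A. \<forall>a\<in>C. u \<le> a"
    proof (cases "C = {}")
      case True
      have "sequentially \<in> ?A" by simp
      then show ?thesis using True by blast
    next
      case False
      have sub: "C \<subseteq> ?A" using C by (auto simp: Chains_def relation_of_def)
      have ch: "a \<le> b \<or> b \<le> a" if "a \<in> C" "b \<in> C" for a b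
        using C that by (auto simp: Chains_def relation_of_def)
      have ev: "eventually P (Inf C) \<longleftrightarrow> (\<exists>b\<in>C. eventually P b)" for P
      proof (rule eventually_Inf_base[OF False])
        fix F G assume "F \<in> C" "G \<in> C"
        then show "\<exists>x\<in>C. x \<le> inf F G" using ch[of F G] by (meson le_inf_iff order_refl)
      qed
      have "Inf C \<noteq> bot"
      proof
        assume "Inf C = bot"
        then have "eventually (\<lambda>_. False) (Inf C)" by simp
        then obtain b where "b \<in> C" "eventually (\<lambda>_. False) b" using ev by auto
        then show False using sub by (auto simp: eventually_False)
      qed
      moreover obtain b where b: "b \<in> C" using False by blast
      have "Inf C \<le> sequentially" using order_trans[OF Inf_lower[OF b], of sequentially] sub b by blast
      ultimately have "Inf C \<in> ?A" by blast
      then show ?thesis using Inf_lower by blast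
    qed
  qed
  then obtain U where U: "U \<noteq> bot" "U \<le> sequentially" "\<And>V. V \<noteq> bot \<Longrightarrow> V \<le> sequentially \<Longrightarrow> V \<le> U \<Longrightarrow> V = U"
    by auto
  have "eventually P U \<or> eventually (\<lambda>x. \<not> P x) U" for P
  proof (cases "inf U (principal {x. P x}) = bot")
    case True
    then have "eventually (\<lambda>_. False) (inf U (principal {x. P x}))" by simp
    then have "eventually (\<lambda>x. \<not> P x) U" by (simp add: eventually_inf_principal)
    then show ?thesis by simp
  next
    case False
    then have "inf U (principal {x. P x}) = U" using U by (meson inf_le1 order_trans)
    then have "U \<le> principal {x. P x}" by (metis inf_le2)
    then show ?thesis by (simp add: le_principal)
  qed
  then show ?thesis using U by blast
qed

definition ultra :: "nat filter" where
  "ultra = (SOME U. U \<noteq> bot \<and> U \<le> sequentially \<and> (\<forall>P. eventually P U \<or> eventually (\<lambda>x. \<not> P x) U))"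

lemma ultra: "ultra \<noteq> bot" "ultra \<le> sequentially" "eventually P ultra \<or> eventually (\<lambda>x. \<not> P x) ultra"
  using someI_ex[OF ex_ultrafilter] unfolding ultra_def by blast+

definition ulim :: "(nat \<Rightarrow> real) \<Rightarrow> real" where "ulim s = Lim ultra s"

lemma tendsto_ulim:
  assumes "bddf s" shows "(s \<longlongrightarrow> ulim s) ultra"
proof -
  obtain C where C: "\<And>x. \<bar>s x\<bar> \<le> C" using assms by (auto simp: bddf_def)
  have "compact {-C..C}" by simp
  moreover have "filtermap s ultra \<noteq> bot" using ultra(1) by (simp add: filtermap_bot_iff)
  moreover have "eventually (\<lambda>x. x \<in> {-C..C}) (filtermap s ultra)"
    using C by (auto simp: eventually_filtermap abs_le_iff minus_le_iff intro!: always_eventually)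
  ultimately obtain x where x: "inf (nhds x) (filtermap s ultra) \<noteq> bot"
    unfolding compact_filter by blast
  have "(s \<longlongrightarrow> x) ultra"
  proof (rule topological_tendstoI)
    fix S assume S: "open S" "x \<in> S"
    show "eventually (\<lambda>n. s n \<in> S) ultra"
    proof (rule ccontr)
      assume "\<not> ?thesis"
      then have "eventually (\<lambda>n. s n \<notin> S) ultra" using ultra(3) by blast
      then have "eventually (\<lambda>y. y \<notin> S) (filtermap s ultra)" by (simp add: eventually_filtermap)
      moreover have "eventually (\<lambda>y. y \<in> S) (nhds x)" using S by (rule eventually_nhds_in_open)
      ultimately have "eventually (\<lambda>_. False) (inf (nhds x) (filtermap s ultra))"
        unfolding eventually_inf by (metis (mono_tags, lifting))
      then show False using x by (simp add: eventually_False)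
    qed
  qed
  then show ?thesis using tendsto_Lim[OF ultra(1)] unfolding ulim_def by metis
qed

lemma ulim_eqI: "(s \<longlongrightarrow> x) ultra \<Longrightarrow> ulim s = x"
  using tendsto_Lim[OF ultra(1)] by (simp add: ulim_def)

lemma ulim_const [simp]: "ulim (\<lambda>_. c) = c" by (rule ulim_eqI) simp

lemma ulim_add: "bddf s \<Longrightarrow> bddf t \<Longrightarrow> ulim (\<lambda>n. s n + t n) = ulim s + ulim t"
  by (intro ulim_eqI tendsto_add tendsto_ulim)

lemma ulim_diff: "bddf s \<Longrightarrow> bddf t \<Longrightarrow> ulim (\<lambda>n. s n - t n) = ulim s - ulim t"
  by (intro ulim_eqI tendsto_diff tendsto_ulim)

lemma ulim_cmult: "bddf s \<Longrightarrow> ulim (\<lambda>n. c * s n) = c * ulim s"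
  by (intro ulim_eqI tendsto_mult tendsto_const tendsto_ulim)

lemma ulim_le:
  assumes "\<And>n. \<bar>s n\<bar> \<le> C" shows "\<bar>ulim s\<bar> \<le> C"
proof -
  have "((\<lambda>n. \<bar>s n\<bar>) \<longlongrightarrow> \<bar>ulim s\<bar>) ultra" using assms by (intro tendsto_rabs tendsto_ulim bddf_I)
  then show ?thesis by (rule tendsto_upperbound) (use assms ultra in auto)
qed

lemma ulim_null: "s \<longlonglongrightarrow> 0 \<Longrightarrow> ulim s = 0"
  using ultra(2) by (intro ulim_eqI) (rule tendsto_mono)

section \<open>Means and iterated means\<close>

text \<open>A finitely additive probability in the form of a functional. It is total, but linearity
  is asked for on bounded functions only; the norm bound together with the value on constants takes
  the place of positivity.\<close>

definition is_mean :: "(('x \<Rightarrow> real) \<Rightarrow> real) \<Rightarrow> bool" where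
  "is_mean m \<longleftrightarrow> (\<forall>f g. bddf f \<longrightarrow> bddf g \<longrightarrow> m (\<lambda>x. f x + g x) = m f + m g)
     \<and> (\<forall>f c. bddf f \<longrightarrow> m (\<lambda>x. c * f x) = c * m f)
     \<and> (\<forall>f C. (\<forall>x. \<bar>f x\<bar> \<le> C) \<longrightarrow> \<bar>m f\<bar> \<le> C) \<and> (\<forall>c. m (\<lambda>_. c) = c)"

lemma is_meanD:
  assumes "is_mean m"
  shows "bddf f \<Longrightarrow> bddf g \<Longrightarrow> m (\<lambda>x. f x + g x) = m f + m g"
    "bddf f \<Longrightarrow> m (\<lambda>x. c * f x) = c * m f"
    "(\<And>x. \<bar>f x\<bar> \<le> C) \<Longrightarrow> \<bar>m f\<bar> \<le> C" "m (\<lambda>_. c) = c"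
  using assms by (auto simp: is_mean_def)

lemma is_mean_diff:
  assumes "is_mean m" "bddf f" "bddf g" shows "m (\<lambda>x. f x - g x) = m f - m g"
  using is_meanD(1)[OF assms(1,2), of "\<lambda>x. - g x"] is_meanD(2)[OF assms(1,3), of "-1"] bddf_minus[OF assms(3)]
  by simp

text \<open>The expectation of F(g_0 X_0, ..., g_n X_n) for independent X_i of law \<open>m\<close>.
  Finitely additive means do not obey Fubini, so the order of nesting is part of the definition: the
  mean for the head of the list is outermost.\<close>

primrec imean :: "(('g::group_add \<Rightarrow> real) \<Rightarrow> real) \<Rightarrow> 'g list \<Rightarrow> ('g list \<Rightarrow> real) \<Rightarrow> real" where
  "imean m [] F = F []"
| "imean m (g # gs) F = m (\<lambda>x. imean m gs (\<lambda>l. F ((g + x) # l)))"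

lemma imean_le:
  assumes "is_mean m" "\<And>l. \<bar>F l\<bar> \<le> C" shows "\<bar>imean m gs F\<bar> \<le> C"
  using assms(2)
proof (induction gs arbitrary: F)
  case (Cons g gs) show ?case using Cons by (auto intro!: is_meanD(3)[OF assms(1)])
qed simp

lemma bddf_imean':
  assumes "is_mean m" "bddf (\<lambda>(x, l). F x l)" shows "bddf (\<lambda>x. imean m (gs x) (F x))"
proof -
  obtain C where "\<And>x l. \<bar>F x l\<bar> \<le> C" using assms(2) by (auto simp: bddf_def)
  then show ?thesis using imean_le[OF assms(1)] by (intro bddf_I) blast
qed

lemma imean_add:
  assumes m: "is_mean m" and "bddf F" "bddf G"
  shows "imean m gs (\<lambda>l. F l + G l) = imean m gs F + imean m gs G"
  using assms(2,3)
proof (induction gs arbitrary: F G)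
  case (Cons g gs)
  have b: "bddf (\<lambda>x. imean m gs (\<lambda>l. F ((g + x) # l)))" if "bddf F" for F
    by (rule bddf_imean'[OF m]) (use that in \<open>auto simp: bddf_def\<close>)
  have "imean m (g # gs) (\<lambda>l. F l + G l) = m (\<lambda>x. imean m gs (\<lambda>l. F ((g + x) # l)) + imean m gs (\<lambda>l. G ((g + x) # l)))"
    using Cons by (simp add: bddf_comp)
  then show ?case using is_meanD(1)[OF m b b] Cons.prems by simp
qed simp

lemma imean_cmult:
  assumes m: "is_mean m" and "bddf F"
  shows "imean m gs (\<lambda>l. c * F l) = c * imean m gs F"
  using assms(2)
proof (induction gs arbitrary: F)
  case (Cons g gs)
  have b: "bddf (\<lambda>x. imean m gs (\<lambda>l. F ((g + x) # l)))"
    by (rule bddf_imean'[OF m]) (use Cons.prems in \<open>auto simp: bddf_def\<close>)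
  show ?case using Cons is_meanD(2)[OF m b] by (simp add: bddf_comp)
qed simp

lemma imean_diff:
  assumes m: "is_mean m" and "bddf F" "bddf G"
  shows "imean m gs (\<lambda>l. F l - G l) = imean m gs F - imean m gs G"
  using imean_add[OF m assms(2), of "\<lambda>l. - G l"] imean_cmult[OF m assms(3), of gs "-1"] bddf_minus[OF assms(3)]
  by simp

lemma imean_const: "is_mean m \<Longrightarrow> imean m gs (\<lambda>_. c) = c"
  by (induction gs) (auto simp: is_meanD)

lemma imean_translate: "imean m (map ((+) g) gs) F = imean m gs (\<lambda>l. F (map ((+) g) l))"
  by (induction gs arbitrary: F) (auto simp: add.assoc)

lemma imean_inv: "translation_inv F \<Longrightarrow> imean m (map ((+) g) gs) F = imean m gs F"
  by (simp add: imean_translate translation_inv_def)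

lemma imean_cong: "(\<And>l. length l = length gs \<Longrightarrow> F l = G l) \<Longrightarrow> imean m gs F = imean m gs G"
proof (induction gs arbitrary: F G)
  case (Cons g gs)
  have "imean m gs (\<lambda>l. F ((g + x) # l)) = imean m gs (\<lambda>l. G ((g + x) # l))" for x
    by (rule Cons.IH) (use Cons.prems in auto)
  then show ?case by simp
qed simp

lemma cobd_imean_swap:
  assumes m: "is_mean m" and b: "bddf (\<lambda>(x, l). F x l)"
  shows "cobd (\<lambda>l. m (\<lambda>x. F x l)) gs = m (\<lambda>x. cobd (F x) gs)"
  using b
proof (induction gs arbitrary: F)
  case Nil show ?case using is_meanD(4)[OF m, of 0] by simp
next
  case (Cons p gs)
  obtain C where C: "\<And>x l. \<bar>F x l\<bar> \<le> C" using Cons.prems by (auto simp: bddf_def)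
  have "bddf (\<lambda>x. F x gs)" using C by (intro bddf_I)
  moreover have "bddf (\<lambda>x. cobd (\<lambda>l. F x (p # l)) gs)" using cobd_abs_le[of "\<lambda>l. F _ (p # l)"] C by (intro bddf_I) blast
  moreover have "cobd (\<lambda>l. m (\<lambda>x. F x (p # l))) gs = m (\<lambda>x. cobd (\<lambda>l. F x (p # l)) gs)"
    by (rule Cons.IH) (use C in \<open>auto intro!: bddf_I\<close>)
  ultimately show ?case using is_mean_diff[OF m] by simp
qed

text \<open>Each face omits one variable, and the mean over an omitted variable has no effect.
  Averaging is therefore a chain map.\<close>

lemma imean_cobd:
  assumes m: "is_mean m" and "bddf F"
  shows "imean m gs (cobd F) = cobd (\<lambda>l. imean m l F) gs"
  using assms(2)
proof (induction gs arbitrary: F)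
  case (Cons g gs)
  obtain C where C: "\<And>l. \<bar>F l\<bar> \<le> C" using Cons.prems by (auto simp: bddf_def)
  have bc: "bddf (\<lambda>l. if length l = length gs then cobd G l else 0)" if G: "\<And>l. \<bar>G l\<bar> \<le> C" for G
  proof (rule bddf_I[of _ "C * length gs"])
    fix l
    have "0 \<le> C" using G[of "[]"] by linarith
    then show "\<bar>if length l = length gs then cobd G l else 0\<bar> \<le> C * length gs"
      using cobd_abs_le[of G C l, OF G] by auto
  qed
  have 1: "imean m gs (\<lambda>l. F l - cobd (\<lambda>l. F ((g + x) # l)) l)
      = imean m gs F - imean m gs (cobd (\<lambda>l. F ((g + x) # l)))" for x
  proof -
    let ?G = "\<lambda>l. if length l = length gs then cobd (\<lambda>l. F ((g + x) # l)) l else 0"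
    have "imean m gs (\<lambda>l. F l - cobd (\<lambda>l. F ((g + x) # l)) l) = imean m gs (\<lambda>l. F l - ?G l)"
      by (rule imean_cong) auto
    also have "\<dots> = imean m gs F - imean m gs ?G" by (rule imean_diff[OF m Cons.prems bc]) (rule C)
    also have "imean m gs ?G = imean m gs (cobd (\<lambda>l. F ((g + x) # l)))" by (rule imean_cong) auto
    finally show ?thesis .
  qed
  have 2: "imean m gs (cobd (\<lambda>l. F ((g + x) # l))) = cobd (\<lambda>l. imean m l (\<lambda>l. F ((g + x) # l))) gs" for x
    by (rule Cons.IH) (rule bddf_comp[OF Cons.prems])
  have Cb: "\<bar>imean m l (\<lambda>l. F ((g + x) # l))\<bar> \<le> C" for x l by (rule imean_le[OF m C])
  have b3: "bddf (\<lambda>x. cobd (\<lambda>l. imean m l (\<lambda>l. F ((g + x) # l))) gs)"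
    by (rule bddf_I[of _ "C * length gs"]) (rule cobd_abs_le[OF Cb])
  have "imean m (g # gs) (cobd F) = m (\<lambda>x. imean m gs F - cobd (\<lambda>l. imean m l (\<lambda>l. F ((g + x) # l))) gs)"
    by (simp add: 1 2)
  also have "\<dots> = imean m gs F - m (\<lambda>x. cobd (\<lambda>l. imean m l (\<lambda>l. F ((g + x) # l))) gs)"
    using is_mean_diff[OF m bddf_const b3] is_meanD(4)[OF m] by simp
  also have "m (\<lambda>x. cobd (\<lambda>l. imean m l (\<lambda>l. F ((g + x) # l))) gs)
     = cobd (\<lambda>l. m (\<lambda>x. imean m l (\<lambda>l. F ((g + x) # l)))) gs"
    by (rule cobd_imean_swap[symmetric, OF m]) (use Cb in \<open>auto intro!: bddf_I\<close>)
  finally show ?case by simp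
qed simp

section \<open>Asymptotically invariant means kill bounded cohomology\<close>

text \<open>The prism operator between the identity and averaging: the sum over i, with sign (-1)^i,
  of the averages of F(g_0, ..., g_i, g_i X_i, ..., g_n X_n). The homotopy formula is
  \<open>prism_homotopy\<close>.\<close>

fun prism :: "(('g::group_add \<Rightarrow> real) \<Rightarrow> real) \<Rightarrow> ('g list \<Rightarrow> real) \<Rightarrow> 'g list \<Rightarrow> real" where
  "prism m F [] = 0"
| "prism m F (g # gs) = imean m (g # gs) (\<lambda>l. F (g # l)) - prism m (\<lambda>l. F (g # l)) gs"

lemma prism_le:
  assumes "is_mean m" "\<And>l. \<bar>F l\<bar> \<le> C" shows "\<bar>prism m F gs\<bar> \<le> C * length gs"
  using assms(2)
proof (induction gs arbitrary: F)
  case (Cons g gs)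
  have "\<bar>prism m (\<lambda>l. F (g # l)) gs\<bar> \<le> C * length gs" by (rule Cons.IH) (rule Cons.prems)
  moreover have "\<bar>imean m (g # gs) (\<lambda>l. F (g # l))\<bar> \<le> C" by (rule imean_le[OF assms(1) Cons.prems])
  ultimately show ?case by (simp add: algebra_simps)
qed simp

lemma prism_cong:
  "(\<And>l. length l = Suc (length gs) \<Longrightarrow> F l = G l) \<Longrightarrow> prism m F gs = prism m G gs"
proof (induction gs arbitrary: F G)
  case (Cons g gs)
  have "imean m (g # gs) (\<lambda>l. F (g # l)) = imean m (g # gs) (\<lambda>l. G (g # l))"
    by (rule imean_cong) (use Cons.prems in auto)
  moreover have "prism m (\<lambda>l. F (g # l)) gs = prism m (\<lambda>l. G (g # l)) gs"
    by (rule Cons.IH) (use Cons.prems in auto)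
  ultimately show ?case by simp
qed simp

lemma prism_translate: "prism m F (map ((+) g) gs) = prism m (\<lambda>l. F (map ((+) g) l)) gs"
proof (induction gs arbitrary: F)
  case (Cons h gs)
  have "imean m (map ((+) g) (h # gs)) (\<lambda>l. F ((g + h) # l)) = imean m (h # gs) (\<lambda>l. F ((g + h) # map ((+) g) l))"
    by (rule imean_translate)
  then show ?case using Cons.IH by simp
qed simp

lemma prism_diff:
  assumes m: "is_mean m" and "bddf F" "bddf G"
  shows "prism m (\<lambda>l. F l - G l) gs = prism m F gs - prism m G gs"
  using assms(2,3)
proof (induction gs arbitrary: F G)
  case (Cons g gs)
  have "imean m (g # gs) (\<lambda>l. F (g # l) - G (g # l)) = imean m (g # gs) (\<lambda>l. F (g # l)) - imean m (g # gs) (\<lambda>l. G (g # l))"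
    by (rule imean_diff[OF m]) (use Cons.prems in \<open>auto intro: bddf_comp\<close>)
  moreover have "prism m (\<lambda>l. F (g # l) - G (g # l)) gs = prism m (\<lambda>l. F (g # l)) gs - prism m (\<lambda>l. G (g # l)) gs"
    by (rule Cons.IH) (use Cons.prems in \<open>auto intro: bddf_comp\<close>)
  ultimately show ?case by simp
qed simp

text \<open>The bound on \<open>cobd F\<close> grows with the length of the list, whereas means are
  linear only on functions bounded over all lists. Cutting off at the one relevant length reconciles
  the two.\<close>

definition trunc :: "nat \<Rightarrow> ('g list \<Rightarrow> real) \<Rightarrow> 'g list \<Rightarrow> real" where
  "trunc n F l = (if length l = n then F l else 0)"

lemma bddf_trunc_cobd: assumes "bddf F" shows "bddf (trunc n (cobd F))"
proof -
  obtain C where C: "C \<ge> 0" "\<And>l. \<bar>F l\<bar> \<le> C" using assms by (rule bddfE) blast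
  then show ?thesis using cobd_abs_le[of F C] by (intro bddf_I[of _ "C * n"]) (auto simp: trunc_def)
qed

lemma prism_homotopy:
  assumes m: "is_mean m" and "bddf F"
  shows "prism m (cobd F) gs + cobd (prism m F) gs = imean m gs F - F gs"
  using assms(2)
proof (induction gs arbitrary: F)
  case (Cons g gs)
  let ?F = "\<lambda>l. F (g # l)"
  have bF: "bddf ?F" using Cons.prems by (rule bddf_comp)
  have e1: "imean m (g # gs) (\<lambda>l. cobd F (g # l)) = imean m (g # gs) F - imean m (g # gs) (cobd ?F)"
  proof -
    have "imean m (g # gs) (\<lambda>l. cobd F (g # l)) = imean m (g # gs) (\<lambda>l. F l - trunc (Suc (length gs)) (cobd ?F) l)"
      by (rule imean_cong) (auto simp: trunc_def)
    also have "\<dots> = imean m (g # gs) F - imean m (g # gs) (trunc (Suc (length gs)) (cobd ?F))"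
      by (rule imean_diff[OF m Cons.prems bddf_trunc_cobd[OF bF]])
    also have "imean m (g # gs) (trunc (Suc (length gs)) (cobd ?F)) = imean m (g # gs) (cobd ?F)"
      by (rule imean_cong) (auto simp: trunc_def)
    finally show ?thesis .
  qed
  have e2: "prism m (\<lambda>l. cobd F (g # l)) gs = prism m F gs - prism m (cobd ?F) gs"
  proof -
    have "prism m (\<lambda>l. cobd F (g # l)) gs = prism m (\<lambda>l. F l - trunc (Suc (length gs)) (cobd ?F) l) gs"
      by (rule prism_cong) (auto simp: trunc_def)
    also have "\<dots> = prism m F gs - prism m (trunc (Suc (length gs)) (cobd ?F)) gs"
      by (rule prism_diff[OF m Cons.prems bddf_trunc_cobd[OF bF]])
    also have "prism m (trunc (Suc (length gs)) (cobd ?F)) gs = prism m (cobd ?F) gs"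
      by (rule prism_cong) (auto simp: trunc_def)
    finally show ?thesis .
  qed
  have e3: "cobd (prism m F) (g # gs) = prism m F gs - cobd (\<lambda>l. imean m (g # l) ?F) gs + cobd (prism m ?F) gs"
    by (simp add: cobd_diff)
  have e4: "imean m (g # gs) (cobd ?F) = imean m gs ?F - cobd (\<lambda>l. imean m (g # l) ?F) gs"
    using imean_cobd[OF m bF, of "g # gs"] by simp
  have IH: "prism m (cobd ?F) gs + cobd (prism m ?F) gs = imean m gs ?F - F (g # gs)"
    using Cons.IH[OF bF] by simp
  have "prism m (cobd F) (g # gs) = imean m (g # gs) (\<lambda>l. cobd F (g # l)) - prism m (\<lambda>l. cobd F (g # l)) gs"
    by (rule prism.simps)
  then show ?case using e1 e2 e3 e4 IH by linarith
qed simp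

lemma cobd_ulim_swap:
  assumes b: "bddf (\<lambda>(k, l). F k l)"
  shows "cobd (\<lambda>l. ulim (\<lambda>k. F k l)) gs = ulim (\<lambda>k. cobd (F k) gs)"
proof (rule cobd_imean_swap[of ulim])
  show "is_mean ulim" by (auto simp: is_mean_def ulim_add ulim_cmult ulim_le)
qed fact

text \<open>By the prism homotopy \<open>F\<close> is cohomologous to each of its averages; their
  ultralimit depends on the length of the tuple alone, and constants are harmless. The hypothesis
  concerns only iterated averages of invariant functions; asymptotic invariance of
  \<open>E k\<close> itself would force amenability.\<close>

theorem coboundary_of_asymptotic_invariance:
  fixes E :: "nat \<Rightarrow> ('g::group_add \<Rightarrow> real) \<Rightarrow> real"
  assumes mE: "\<And>k. is_mean (E k)"
    and as: "\<And>F (gs :: 'g list). translation_inv F \<Longrightarrow> bddf F \<Longrightarrow>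
      (\<lambda>k. imean (E k) gs F - imean (E k) (map (\<lambda>_. 0) gs) F) \<longlonglongrightarrow> 0"
    and F: "cocycle n F" and n: "n \<ge> 1"
  shows "coboundary n (F :: 'g list \<Rightarrow> real)"
proof -
  have inv: "translation_inv F" and bF: "bddf F" and cF: "\<And>xs. length xs = n + 2 \<Longrightarrow> cobd F xs = 0"
    using F by (auto simp: cocycle_def)
  obtain C where C: "C \<ge> 0" "\<And>l. \<bar>F l\<bar> \<le> C" using bF by (rule bddfE) blast
  define z where "z = (\<lambda>j::nat. map (\<lambda>_. 0::'g) [0..<j])"
  define \<kappa> where "\<kappa> = (\<lambda>j. ulim (\<lambda>k. imean (E k) (z j) F))"
  have bI: "bddf (\<lambda>k. imean (E k) gs F)" for gs
    by (rule bddf_I[of _ C]) (rule imean_le[OF mE C(2)])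
  have K: "ulim (\<lambda>k. imean (E k) gs F) = \<kappa> (length gs)" for gs
  proof -
    have zg: "map (\<lambda>_. 0) gs = z (length gs)" by (auto simp: z_def map_replicate_const)
    have "ulim (\<lambda>k. imean (E k) gs F - imean (E k) (z (length gs)) F) = 0"
      using as[OF inv bF, of gs] unfolding zg by (rule ulim_null)
    then show ?thesis using ulim_diff[OF bI bI, of gs "z (length gs)"] by (simp add: \<kappa>_def)
  qed
  define h where "h = (\<lambda>gs. ulim (\<lambda>k. trunc n (prism (E k) F) gs))"
  have hb: "\<bar>trunc n (prism (E k) F) gs\<bar> \<le> C * n" for k gs
    using prism_le[of "E k" F C gs, OF mE C(2)] C(1) by (auto simp: trunc_def)
  have h_bdd: "bddf h" unfolding h_def by (rule bddf_I[of _ "C * n"]) (rule ulim_le, rule hb)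
  have h_inv: "translation_inv h"
    using inv by (simp add: translation_inv_def h_def trunc_def prism_translate cong: if_cong)
  have dh: "cobd h xs = \<kappa> (n + 1) - F xs" if len: "length xs = n + 1" for xs
  proof -
    have "cobd h xs = ulim (\<lambda>k. cobd (trunc n (prism (E k) F)) xs)" unfolding h_def
      by (rule cobd_ulim_swap) (use hb in \<open>auto intro!: bddf_I\<close>)
    also have "(\<lambda>k. cobd (trunc n (prism (E k) F)) xs) = (\<lambda>k. imean (E k) xs F - F xs)"
    proof
      fix k
      have "cobd (trunc n (prism (E k) F)) xs = cobd (prism (E k) F) xs"
        by (rule cobd_cong) (use len in \<open>auto simp: trunc_def\<close>)
      moreover have "prism (E k) (cobd F) xs = prism (E k) (\<lambda>_. 0) xs"
        by (rule prism_cong) (use len cF in auto)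
      moreover have "prism (E k) (\<lambda>_. 0) xs = 0" using prism_le[OF mE[of k], of "\<lambda>_. 0" 0 xs] by simp
      ultimately show "cobd (trunc n (prism (E k) F)) xs = imean (E k) xs F - F xs"
        using prism_homotopy[OF mE[of k] bF, of xs] by simp
    qed
    also have "ulim \<dots> = \<kappa> (n + 1) - F xs" using ulim_diff[OF bI[of xs] bddf_const[of "F xs"]] K[of xs] len by simp
    finally show ?thesis .
  qed
  \<comment> \<open>The averaged cocycle is again a cocycle. For odd \<open>n\<close> its coboundary
    on the \<open>n + 2\<close> identities has an odd number of equal terms, hence equals the
    constant itself.\<close>
  have k0: "\<kappa> (n + 1) = 0" if "odd n"
  proof -
    have "cobd (\<lambda>l. ulim (\<lambda>k. imean (E k) l F)) (z (n + 2)) = ulim (\<lambda>k. cobd (\<lambda>l. imean (E k) l F) (z (n + 2)))"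
      by (rule cobd_ulim_swap) (use imean_le[OF mE C(2)] in \<open>auto intro!: bddf_I\<close>)
    also have "\<dots> = ulim (\<lambda>k. imean (E k) (z (n + 2)) (\<lambda>_. 0))"
    proof -
      have "imean (E k) (z (n + 2)) (cobd F) = imean (E k) (z (n + 2)) (\<lambda>_. 0)" for k
        by (rule imean_cong) (use cF in \<open>auto simp: z_def\<close>)
      then show ?thesis using imean_cobd[OF mE bF] by simp
    qed
    finally have "cobd (\<lambda>l. \<kappa> (length l)) (z (n + 2)) = 0" by (simp add: K imean_const[OF mE])
    moreover have "cobd (\<lambda>l. \<kappa> (length l)) (z (n + 2)) = cobd (\<lambda>l. \<kappa> (n + 1)) (z (n + 2))"
      by (rule cobd_cong) (auto simp: z_def)
    ultimately show ?thesis using that by (simp add: cobd_const z_def)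
  qed
  have "coboundary n (\<lambda>xs. \<kappa> (n + 1) + (-1) * cobd h xs)"
  proof (intro coboundary_add coboundary_cmult)
    show "coboundary n (\<lambda>_. \<kappa> (n + 1))" by (rule const_cocycle_coboundary[OF n k0])
    show "coboundary n (cobd h)" using h_inv h_bdd by (auto simp: coboundary_def)
  qed
  then show ?thesis by (rule coboundary_cong[THEN iffD1, rotated]) (simp add: dh)
qed

section \<open>Finitary permutations, finitely supported functions and their wreath product\<close>

typedef fsym = "{f::nat \<Rightarrow> nat. bij f \<and> finite {a. f a \<noteq> a}}" morphisms papp Abs_fsym
  by (rule exI[of _ id]) auto

setup_lifting type_definition_fsym

instantiation fsym :: group_add
begin

lift_definition zero_fsym :: fsym is "\<lambda>x. x" by (simp add: bij_id[unfolded id_def])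

lift_definition plus_fsym :: "fsym \<Rightarrow> fsym \<Rightarrow> fsym" is "\<lambda>f g x. f (g x)"
proof -
  fix f g :: "nat \<Rightarrow> nat"
  assume f: "bij f \<and> finite {a. f a \<noteq> a}" and g: "bij g \<and> finite {a. g a \<noteq> a}"
  have "{a. f (g a) \<noteq> a} \<subseteq> {a. f a \<noteq> a} \<union> {a. g a \<noteq> a}" by auto
  then show "bij (\<lambda>x. f (g x)) \<and> finite {a. f (g a) \<noteq> a}"
    using f g bij_comp[of g f] by (auto simp: comp_def intro: finite_subset)
qed

lift_definition uminus_fsym :: "fsym \<Rightarrow> fsym" is "\<lambda>f. inv_into UNIV f"
proof -
  fix f :: "nat \<Rightarrow> nat" assume f: "bij f \<and> finite {a. f a \<noteq> a}"
  have "{a. inv_into UNIV f a \<noteq> a} = {a. f a \<noteq> a}"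
    using f by (metis bij_inv_eq_iff)
  then show "bij (inv_into UNIV f) \<and> finite {a. inv_into UNIV f a \<noteq> a}"
    using f by (simp add: bij_imp_bij_inv)
qed

definition minus_fsym :: "fsym \<Rightarrow> fsym \<Rightarrow> fsym" where "minus_fsym a b = a + (- b)"

instance
proof
  fix a b c :: fsym
  show "a + b + c = a + (b + c)" by transfer simp
  show "0 + a = a" by transfer simp
  show "a + 0 = a" by transfer simp
  show "- a + a = 0" by transfer (simp add: bij_is_inj inv_f_f)
  show "a + - b = a - b" by (simp add: minus_fsym_def)
qed

end

lemma papp_0 [simp]: "papp 0 x = x" by transfer simp
lemma papp_plus [simp]: "papp (a + b) x = papp a (papp b x)" by transfer simp
lemma papp_minus1 [simp]: "papp (- a) (papp a x) = x" by (metis left_minus papp_0 papp_plus)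
lemma papp_minus2 [simp]: "papp a (papp (- a) x) = x" by (metis right_minus papp_0 papp_plus)
lemma papp_inj [simp]: "papp a x = papp a y \<longleftrightarrow> x = y" by (metis papp_minus1)
lemma papp_minus_plus: "papp (- (a + b)) x = papp (- b) (papp (- a) x)" by (metis minus_add papp_plus)
lemma fsym_eqI: "(\<And>x. papp a x = papp b x) \<Longrightarrow> a = b" by (metis ext papp_inject)
lemma finite_papp: "finite {a. papp s a \<noteq> a}" using papp[of s] by simp

lift_definition fswap :: "nat \<Rightarrow> nat \<Rightarrow> fsym" is "\<lambda>i j x. if x = i then j else if x = j then i else x"
proof -
  fix i j :: nat
  let ?f = "\<lambda>x. if x = i then j else if x = j then i else x"
  have "bij ?f" by (rule o_bij[of ?f]) auto
  moreover have "{a. ?f a \<noteq> a} \<subseteq> {i, j}" by auto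
  ultimately show "bij ?f \<and> finite {a. ?f a \<noteq> a}" by (meson finite.emptyI finite.insertI finite_subset)
qed

lemma papp_fswap: "papp (fswap i j) x = (if x = i then j else if x = j then i else x)" by transfer simp

lemma papp_minus_fswap: "papp (- fswap i j) x = (if x = i then j else if x = j then i else x)"
  by (metis papp_fswap papp_minus1)

typedef (overloaded) 'g fs = "{x::nat \<Rightarrow> 'g::group_add. finite {j. x j \<noteq> 0}}" morphisms lamp Abs_fs
  by (rule exI[of _ "\<lambda>_. 0"]) auto

setup_lifting type_definition_fs

instantiation fs :: (group_add) group_add
begin

lift_definition zero_fs :: "'a fs" is "\<lambda>_. 0" by simp

lift_definition plus_fs :: "'a fs \<Rightarrow> 'a fs \<Rightarrow> 'a fs" is "\<lambda>x y j. x j + y j"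
proof -
  fix x y :: "nat \<Rightarrow> 'a" assume a: "finite {j. x j \<noteq> 0}" "finite {j. y j \<noteq> 0}"
  have "{j. x j + y j \<noteq> 0} \<subseteq> {j. x j \<noteq> 0} \<union> {j. y j \<noteq> 0}" by auto
  then show "finite {j. x j + y j \<noteq> 0}" using a by (meson finite_UnI finite_subset)
qed

lift_definition uminus_fs :: "'a fs \<Rightarrow> 'a fs" is "\<lambda>x j. - x j" by simp

definition minus_fs :: "'a fs \<Rightarrow> 'a fs \<Rightarrow> 'a fs" where "minus_fs a b = a + (- b)"

instance
proof
  fix a b c :: "'a fs"
  show "a + b + c = a + (b + c)" by transfer (simp add: add.assoc)
  show "0 + a = a" by transfer simp
  show "a + 0 = a" by transfer simp
  show "- a + a = 0" by transfer simp
  show "a + - b = a - b" by (simp add: minus_fs_def)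
qed

end

lemma lamp_0 [simp]: "lamp 0 j = 0" by transfer simp
lemma lamp_plus [simp]: "lamp (x + y) j = lamp x j + lamp y j" by transfer simp
lemma lamp_uminus [simp]: "lamp (- x) j = - lamp x j" by transfer simp
lemma fs_eqI: "(\<And>j. lamp x j = lamp y j) \<Longrightarrow> x = y" by (metis ext lamp_inject)
lemma finite_lamp: "finite {j. lamp x j \<noteq> 0}" using lamp[of x] by simp
lemma lamp_Abs_fs: "finite {j. x j \<noteq> 0} \<Longrightarrow> lamp (Abs_fs x) = x" by (simp add: Abs_fs_inverse)

lift_definition single :: "nat \<Rightarrow> 'g::group_add \<Rightarrow> 'g fs" is "\<lambda>i h j. if j = i then h else 0"
  by simp

lemma lamp_single: "lamp (single i h) j = (if j = i then h else 0)" by transfer simp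

lift_definition act :: "fsym \<Rightarrow> 'g::group_add fs \<Rightarrow> 'g fs" is "\<lambda>s x j. x (papp (- s) j)"
proof -
  fix s and x :: "nat \<Rightarrow> 'g" assume a: "finite {j. x j \<noteq> 0}"
  have "{j. x (papp (- s) j) \<noteq> 0} \<subseteq> papp s ` {j. x j \<noteq> 0}"
    by (smt (verit, ccfv_SIG) image_iff mem_Collect_eq papp_minus2 subsetI)
  then show "finite {j. x (papp (- s) j) \<noteq> 0}" using a by (meson finite_imageI finite_subset)
qed

lemma lamp_act [simp]: "lamp (act s x) j = lamp x (papp (- s) j)" by transfer simp

text \<open>A fresh copy of the product type: pairs already carry the componentwise addition, and
  the semidirect product needs an instance of its own.\<close>

typedef (overloaded) 'g wr = "UNIV :: ('g::group_add fs \<times> fsym) set" morphisms unwr Abs_wr by simp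

definition Wr :: "'g::group_add fs \<Rightarrow> fsym \<Rightarrow> 'g wr" where "Wr x s = Abs_wr (x, s)"
definition wlamp :: "'g::group_add wr \<Rightarrow> 'g fs" where "wlamp w = fst (unwr w)"
definition wperm :: "'g::group_add wr \<Rightarrow> fsym" where "wperm w = snd (unwr w)"

lemma wr_simps [simp]: "wlamp (Wr x s) = x" "wperm (Wr x s) = s" "Wr (wlamp w) (wperm w) = w"
  by (simp_all add: Wr_def wlamp_def wperm_def Abs_wr_inverse unwr_inverse)

lemma Wr_inject [simp]: "Wr x s = Wr y t \<longleftrightarrow> x = y \<and> s = t" by (metis wr_simps(1,2))

instantiation wr :: (group_add) group_add
begin
definition zero_wr :: "'a wr" where "zero_wr = Wr 0 0"
definition plus_wr :: "'a wr \<Rightarrow> 'a wr \<Rightarrow> 'a wr" where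
  "plus_wr a b = Wr (wlamp a + act (wperm a) (wlamp b)) (wperm a + wperm b)"
definition uminus_wr :: "'a wr \<Rightarrow> 'a wr" where
  "uminus_wr a = Wr (act (- wperm a) (- wlamp a)) (- wperm a)"
definition minus_wr :: "'a wr \<Rightarrow> 'a wr \<Rightarrow> 'a wr" where "minus_wr a b = a + (- b)"
instance
proof
  fix a b c :: "'a wr"
  have "act (s + t) x = act s (act t x)" for s t and x :: "'a fs"
    by (rule fs_eqI) (simp add: papp_minus_plus)
  moreover have "act s (x + y) = act s x + act s y" for s and x y :: "'a fs" by (rule fs_eqI) simp
  ultimately show "a + b + c = a + (b + c)" by (simp add: plus_wr_def add.assoc)
  have z: "act 0 x = x" "act s (0 :: 'a fs) = 0" for s and x :: "'a fs" by (auto intro: fs_eqI)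
  then show "0 + a = a" "a + 0 = a" by (simp_all add: plus_wr_def zero_wr_def)
  have "act (- wperm a) (- wlamp a) + act (- wperm a) (wlamp a) = 0" by (rule fs_eqI) simp
  then show "- a + a = 0" by (simp add: plus_wr_def zero_wr_def uminus_wr_def)
  show "a + - b = a - b" by (simp add: minus_wr_def)
qed
end

lemma Wr_plus: "Wr x s + Wr y t = Wr (x + act s y) (s + t)" by (simp add: plus_wr_def)

lemma act_0 [simp]: "act 0 x = x" "act s 0 = 0" by (auto intro: fs_eqI)

lemma wr_split: "w = Wr (wlamp w) 0 + Wr 0 (wperm w)" by (simp add: Wr_plus)

section \<open>Averages over finite sets\<close>

definition avg :: "'s set \<Rightarrow> ('s \<Rightarrow> real) \<Rightarrow> real" where "avg S f = (\<Sum>s\<in>S. f s) / card S"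

lemma avg_add: "avg S (\<lambda>s. f s + g s) = avg S f + avg S g"
  by (simp add: avg_def sum.distrib add_divide_distrib)
lemma avg_diff: "avg S (\<lambda>s. f s - g s) = avg S f - avg S g"
  by (simp add: avg_def sum_subtractf diff_divide_distrib)
lemma avg_cmult: "avg S (\<lambda>s. c * f s) = c * avg S f"
  by (simp add: avg_def sum_distrib_left)
lemma avg_cmult_right: "avg S (\<lambda>s. f s * c) = avg S f * c"
  by (simp add: avg_def sum_distrib_right)
lemma avg_cong: "(\<And>s. s \<in> S \<Longrightarrow> f s = g s) \<Longrightarrow> avg S f = avg S g"
  by (simp add: avg_def)
lemma avg_const: "finite S \<Longrightarrow> S \<noteq> {} \<Longrightarrow> avg S (\<lambda>_. c) = c"
  by (simp add: avg_def)
lemma avg_mono: "(\<And>s. s \<in> S \<Longrightarrow> f s \<le> g s) \<Longrightarrow> avg S f \<le> avg S g"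
  by (simp add: avg_def divide_right_mono sum_mono)
lemma avg_abs: "\<bar>avg S f\<bar> \<le> avg S (\<lambda>s. \<bar>f s\<bar>)"
  by (simp add: avg_def divide_right_mono)
lemma avg_sum: "avg S (\<lambda>s. \<Sum>j\<in>J. f j s) = (\<Sum>j\<in>J. avg S (f j))"
  by (simp add: avg_def sum.swap[of _ S] sum_divide_distrib)
lemma avg_bij: "bij_betw h S S \<Longrightarrow> avg S (\<lambda>s. f (h s)) = avg S f"
  by (simp add: avg_def sum.reindex_bij_betw)

lemma avg_le: "finite S \<Longrightarrow> S \<noteq> {} \<Longrightarrow> (\<And>s. s \<in> S \<Longrightarrow> \<bar>f s\<bar> \<le> C) \<Longrightarrow> \<bar>avg S f\<bar> \<le> C"
  using order_trans[OF avg_abs[of S f] avg_mono[of S "\<lambda>s. \<bar>f s\<bar>" "\<lambda>_. C"]] by (simp add: avg_const)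

lemma is_mean_avg:
  assumes "finite S" "S \<noteq> {}" shows "is_mean (\<lambda>f. avg S (\<lambda>s. f (h s)))"
  unfolding is_mean_def using assms
  by (auto simp: avg_add avg_cmult avg_const intro!: avg_le)

lemma avg_Times:
  "avg (A \<times> B) f = avg A (\<lambda>a. avg B (\<lambda>b. f (a, b)))"
  by (simp add: avg_def sum.cartesian_product card_cartesian_product sum_divide_distrib[symmetric] mult.commute)

text \<open>Exchanging \<open>x j\<close> with an independent \<open>w\<close> is an involution of
  the pairs (x, w), so one coordinate of a uniform random function may be drawn anew without
  changing the average.\<close>

lemma avg_resample:
  assumes "finite A" "j \<in> A" "finite B" "B \<noteq> {}"
  shows "avg (A \<rightarrow>\<^sub>E B) \<Psi> = avg (A \<rightarrow>\<^sub>E B) (\<lambda>x. avg B (\<lambda>w. \<Psi> (x(j := w))))"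
proof -
  let ?P = "A \<rightarrow>\<^sub>E B"
  have "(\<Sum>x\<in>?P. \<Sum>w\<in>B. \<Psi> (x(j := w))) = (\<Sum>(x, w)\<in>?P \<times> B. \<Psi> (x(j := w)))"
    by (rule sum.cartesian_product)
  also have "\<dots> = (\<Sum>(x, w)\<in>?P \<times> B. \<Psi> x)"
    by (rule sum.reindex_bij_witness[of _ "\<lambda>(x, w). (x(j := w), x j)" "\<lambda>(x, w). (x(j := w), x j)"])
       (use assms in \<open>auto simp: PiE_iff extensional_def\<close>)
  also have "\<dots> = card B * (\<Sum>x\<in>?P. \<Psi> x)"
    by (simp add: sum.cartesian_product[symmetric] sum_distrib_left)
  finally have e: "(\<Sum>x\<in>?P. \<Sum>w\<in>B. \<Psi> (x(j := w))) = card B * (\<Sum>x\<in>?P. \<Psi> x)" .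
  have "card B \<noteq> 0" using assms by simp
  then show ?thesis unfolding avg_def using e by (simp add: sum_divide_distrib[symmetric])
qed

section \<open>Random elements of the wreath product\<close>

text \<open>The leading letter of a word of length \<open>Suc r\<close> sits at index
  \<open>r\<close>, the final one at 0. Prepending a letter thus writes at index \<open>r\<close>
  and leaves the shorter word in place, with no shift of indices.\<close>

primrec word :: "(nat \<Rightarrow> 'g::group_add) \<Rightarrow> nat \<Rightarrow> (nat \<Rightarrow> nat) \<Rightarrow> 'g" where
  "word \<nu> 0 f = 0"
| "word \<nu> (Suc r) f = \<nu> (f r) + word \<nu> r f"

lemma word_upd: "r \<le> i \<Longrightarrow> word \<nu> r (f(i := c)) = word \<nu> r f"
  by (induction r) auto

definition letters :: "nat \<Rightarrow> (nat \<Rightarrow> nat) set" where "letters l = {..<l} \<rightarrow>\<^sub>E {..<l}"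
text \<open>A length below \<open>l\<close> together with \<open>l\<close> letters, each among
  \<open>l\<close> symbols. Letters beyond the length are ignored by \<open>word\<close>; keeping
  them makes length and letters independent.\<close>

definition words :: "nat \<Rightarrow> (nat \<times> (nat \<Rightarrow> nat)) set" where "words l = {..<l} \<times> letters l"

definition ev :: "(nat \<Rightarrow> 'g::group_add) \<Rightarrow> nat \<times> (nat \<Rightarrow> nat) \<Rightarrow> 'g" where
  "ev \<nu> w = word \<nu> (fst w) (snd w)"

text \<open>Prepending the letter \<open>i\<close> to a uniformly random word of length less than \<open>l\<close> amounts, up to an
  error \<open>1/l\<close>, to weighting the random word with the density \<open>dens l i\<close>.\<close>

definition dens :: "nat \<Rightarrow> nat \<Rightarrow> nat \<times> (nat \<Rightarrow> nat) \<Rightarrow> real" where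
  "dens l i w = (if fst w \<ge> 1 \<and> snd w (fst w - 1) = i then real l else 0)"

lemma finite_words [simp]: "finite (letters l)" "finite (words l)"
  by (auto simp: words_def letters_def intro: finite_PiE)

lemma words_nonempty: assumes "l \<ge> 1" shows "letters l \<noteq> {}" "words l \<noteq> {}"
proof -
  have "0 \<in> {..<l}" using assms by auto
  then show "letters l \<noteq> {}" "words l \<noteq> {}" by (auto simp: letters_def words_def PiE_eq_empty_iff)
qed

lemma dens_nonneg: "0 \<le> dens l i w" by (simp add: dens_def)

text \<open>At each positive length the leading letter is \<open>i\<close> with probability 1/l,
  which the factor \<open>l\<close> in \<open>dens\<close> cancels. Length 0 has density 0, hence
  only \<open>l - 1\<close> summands remain.\<close>

lemma avg_dens:
  assumes "i < l"
  shows "avg (words l) (\<lambda>w. dens l i w * f w)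
    = (\<Sum>r<l - 1. avg (letters l) (\<lambda>c. f (Suc r, c(r := i)))) / l"
proof -
  have l: "l \<ge> 1" using assms by simp
  have "avg (letters l) (\<lambda>c. dens l i (Suc r, c) * f (Suc r, c)) = avg (letters l) (\<lambda>c. f (Suc r, c(r := i)))"
    if "r < l - 1" for r
  proof -
    have "avg (letters l) (\<lambda>c. dens l i (Suc r, c) * f (Suc r, c))
        = avg (letters l) (\<lambda>c. avg {..<l} (\<lambda>w. dens l i (Suc r, c(r := w)) * f (Suc r, c(r := w))))"
      unfolding letters_def by (rule avg_resample) (use that in \<open>auto simp: lessThan_empty_iff\<close>)
    also have "(\<lambda>c. avg {..<l} (\<lambda>w. dens l i (Suc r, c(r := w)) * f (Suc r, c(r := w)))) = (\<lambda>c. f (Suc r, c(r := i)))"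
    proof
      fix c
      have "(\<Sum>w<l. dens l i (Suc r, c(r := w)) * f (Suc r, c(r := w))) = (\<Sum>w<l. if w = i then l * f (Suc r, c(r := i)) else 0)"
        by (rule sum.cong) (auto simp: dens_def)
      also have "\<dots> = l * f (Suc r, c(r := i))" using assms by simp
      finally show "avg {..<l} (\<lambda>w. dens l i (Suc r, c(r := w)) * f (Suc r, c(r := w))) = f (Suc r, c(r := i))"
        using l by (simp add: avg_def)
    qed
    finally show ?thesis .
  qed
  moreover have "(\<Sum>r<l. avg (letters l) (\<lambda>c. dens l i (r, c) * f (r, c)))
      = (\<Sum>r<l - 1. avg (letters l) (\<lambda>c. dens l i (Suc r, c) * f (Suc r, c)))"
  proof -
    obtain l' where "l = Suc l'" using l by (cases l) auto
    then have "{..<l} = insert 0 (Suc ` {..<l - 1})" by (simp add: lessThan_Suc_eq_insert_0)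
    moreover have "avg (letters l) (\<lambda>c. dens l i (0, c) * f (0, c)) = 0" by (simp add: dens_def avg_def)
    ultimately show ?thesis by (simp add: sum.reindex)
  qed
  ultimately show ?thesis by (simp add: words_def avg_Times avg_def[of "{..<l}"])
qed

lemma avg_dens_1:
  assumes "i < l" shows "avg (words l) (dens l i) = 1 - 1 / l"
proof -
  have "letters l \<noteq> {}" using words_nonempty[of l] assms by simp
  then have "avg (words l) (\<lambda>w. dens l i w * 1) = real (l - 1) / l"
    unfolding avg_dens[OF assms] by (simp add: avg_const)
  then show ?thesis using assms by (simp add: field_simps of_nat_diff)
qed

lemma avg_dens_sq:
  assumes "i < l" shows "avg (words l) (\<lambda>w. dens l i w * dens l i w) \<le> l"
proof -
  have "avg (words l) (\<lambda>w. dens l i w * dens l i w) = avg (words l) (\<lambda>w. dens l i w * l)"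
    by (rule avg_cong) (simp add: dens_def)
  also have "\<dots> = (1 - 1 / l) * l" by (simp add: avg_cmult_right avg_dens_1[OF assms])
  also have "\<dots> \<le> l" using assms by (simp add: field_simps)
  finally show ?thesis .
qed

text \<open>Prepending a letter turns length r into r + 1. The weighted average sees all lengths
  from 1 to l - 1, that is, every lengthened word except those that started at the maximal length l
  - 1; these have probability 1/l.\<close>

lemma avg_shift:
  assumes i: "i < l" and C: "\<And>u. \<bar>f u\<bar> \<le> C"
  shows "\<bar>avg (words l) (\<lambda>w. f (\<nu> i + ev \<nu> w)) - avg (words l) (\<lambda>w. dens l i w * f (ev \<nu> w))\<bar> \<le> C / l"
proof -
  have l: "l \<ge> 1" using i by simp
  let ?A = "\<lambda>r. avg (letters l) (\<lambda>c. f (\<nu> i + word \<nu> r c))"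
  have "avg (words l) (\<lambda>w. dens l i w * f (ev \<nu> w)) = (\<Sum>r<l - 1. ?A r) / l"
    unfolding avg_dens[OF i] by (simp add: ev_def word_upd)
  moreover have "avg (words l) (\<lambda>w. f (\<nu> i + ev \<nu> w)) = (\<Sum>r<l. ?A r) / l"
    by (simp add: words_def avg_Times avg_def[of "{..<l}"] ev_def)
  moreover have "(\<Sum>r<l. ?A r) = (\<Sum>r<l - 1. ?A r) + ?A (l - 1)"
    using l by (cases l) auto
  moreover have "\<bar>?A (l - 1)\<bar> \<le> C" by (rule avg_le) (use l words_nonempty C in auto)
  ultimately have "\<bar>avg (words l) (\<lambda>w. f (\<nu> i + ev \<nu> w)) - avg (words l) (\<lambda>w. dens l i w * f (ev \<nu> w))\<bar> = \<bar>?A (l - 1)\<bar> / l"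
    by (simp add: add_divide_distrib)
  then show ?thesis using \<open>\<bar>?A (l - 1)\<bar> \<le> C\<close> by (simp add: divide_right_mono)
qed

section \<open>Finite symmetric groups and the sample space of random group elements\<close>

definition symk :: "nat \<Rightarrow> fsym set" where "symk k = {s. \<forall>j\<ge>k. papp s j = j}"

lemma symk_less: assumes "s \<in> symk k" shows "papp s j < k \<longleftrightarrow> j < k"
proof -
  have "papp s j = j" if "papp s j \<ge> k"
    using assms that papp_inj[of s "papp s j" j] by (auto simp: symk_def)
  then show ?thesis using assms by (metis (mono_tags, lifting) leI linorder_not_le mem_Collect_eq symk_def)
qed

lemma symk_uminus: assumes "s \<in> symk k" shows "- s \<in> symk k"
  using assms by (auto simp: symk_def) (metis papp_minus1)

lemma symk_plus: "s \<in> symk k \<Longrightarrow> t \<in> symk k \<Longrightarrow> s + t \<in> symk k"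
  by (auto simp: symk_def)

lemma symk_0: "0 \<in> symk k" by (simp add: symk_def)

lemma finite_symk: "finite (symk k)"
proof (rule finite_imageD)
  let ?h = "\<lambda>s. restrict (papp s) {..<k}"
  have "?h s \<in> {..<k} \<rightarrow>\<^sub>E {..<k}" if "s \<in> symk k" for s
    using symk_less[OF that] by (simp add: restrict_PiE_iff del: restrict_apply)
  then have "?h ` symk k \<subseteq> {..<k} \<rightarrow>\<^sub>E {..<k}" by blast
  then show "finite (?h ` symk k)" by (rule finite_subset) (auto intro: finite_PiE)
  show "inj_on ?h (symk k)"
  proof (rule inj_onI, rule fsym_eqI)
    fix s t x assume a: "s \<in> symk k" "t \<in> symk k" "?h s = ?h t"
    show "papp s x = papp t x"
      using a(1,2) fun_cong[OF a(3), of x] by (cases "x < k") (auto simp: symk_def)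
  qed
qed

lemma ex_symk: "\<exists>k. \<forall>k'\<ge>k. s \<in> symk k'"
proof -
  obtain k where k: "{j. papp s j \<noteq> j} \<subseteq> {..<k}" using finite_nat_bounded[OF finite_papp[of s]] by blast
  have "s \<in> symk k'" if "k' \<ge> k" for k'
  proof -
    have "papp s j = j" if "j \<ge> k'" for j
      using k that \<open>k' \<ge> k\<close> by (metis (mono_tags, lifting) lessThan_iff linorder_not_le mem_Collect_eq order_trans subsetD)
    then show ?thesis by (simp add: symk_def)
  qed
  then show ?thesis by blast
qed

text \<open>It must outgrow l^n for every n: the weights of n entries at one lamp have second moment
  at most l^n, and the law of large numbers divides this by the number of free lamps.\<close>

definition nlamps :: "nat \<Rightarrow> nat" where "nlamps l = l ^ l"

definition samples :: "nat \<Rightarrow> ((nat \<Rightarrow> nat \<times> (nat \<Rightarrow> nat)) \<times> fsym) set" where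
  "samples l = ({..<nlamps l} \<rightarrow>\<^sub>E words l) \<times> symk (nlamps l)"

lemma samples: assumes "l \<ge> 1" shows "finite (samples l)" "samples l \<noteq> {}"
proof -
  show "finite (samples l)" by (auto simp: samples_def finite_symk intro!: finite_PiE)
  show "samples l \<noteq> {}" using words_nonempty[OF assms] symk_0[of "nlamps l"]
    by (auto simp: samples_def PiE_eq_empty_iff)
qed

definition rlamp :: "(nat \<Rightarrow> 'g::group_add) \<Rightarrow> nat \<Rightarrow> (nat \<Rightarrow> nat \<times> (nat \<Rightarrow> nat)) \<Rightarrow> 'g fs" where
  "rlamp \<nu> l x = Abs_fs (\<lambda>j. if j < nlamps l then ev \<nu> (x j) else 0)"

lemma lamp_rlamp: "lamp (rlamp \<nu> l x) j = (if j < nlamps l then ev \<nu> (x j) else 0)"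
proof -
  have "{j. (if j < nlamps l then ev \<nu> (x j) else 0) \<noteq> 0} \<subseteq> {..<nlamps l}" by auto
  then have "finite {j. (if j < nlamps l then ev \<nu> (x j) else 0) \<noteq> 0}" by (rule finite_subset) simp
  then show ?thesis by (simp add: rlamp_def lamp_Abs_fs)
qed

definition relem :: "(nat \<Rightarrow> 'g::group_add) \<Rightarrow> nat \<Rightarrow> (nat \<Rightarrow> nat \<times> (nat \<Rightarrow> nat)) \<times> fsym \<Rightarrow> 'g wr" where
  "relem \<nu> l s = Wr (rlamp \<nu> l (fst s)) (snd s)"

lemma samples_resample:
  assumes "l \<ge> 1" "j < nlamps l"
  shows "avg (samples l) \<Psi> = avg (samples l) (\<lambda>s. avg (words l) (\<lambda>w. \<Psi> ((fst s)(j := w), snd s)))"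
proof -
  have "avg ({..<nlamps l} \<rightarrow>\<^sub>E words l) (\<lambda>x. avg (symk (nlamps l)) (\<lambda>t. \<Psi> (x, t)))
     = avg ({..<nlamps l} \<rightarrow>\<^sub>E words l) (\<lambda>x. avg (words l) (\<lambda>w. avg (symk (nlamps l)) (\<lambda>t. \<Psi> (x(j := w), t))))"
    by (rule avg_resample) (use assms words_nonempty in auto)
  moreover have "avg (words l) (\<lambda>w. avg (symk (nlamps l)) (\<lambda>t. \<Psi> (x(j := w), t)))
     = avg (symk (nlamps l)) (\<lambda>t. avg (words l) (\<lambda>w. \<Psi> (x(j := w), t)))" for x
    by (simp add: avg_def sum.swap[of _ "words l"] sum_divide_distrib[symmetric] mult.commute)
  ultimately show ?thesis by (simp add: samples_def avg_Times)
qed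

lemma samples_weight:
  assumes "l \<ge> 1" "j < nlamps l"
  shows "avg (samples l) (\<lambda>s. f (fst s j)) = avg (words l) f"
  using samples_resample[OF assms, of "\<lambda>s. f (fst s j)"] samples[OF assms(1)] by (simp add: avg_const)

lemma samples_weight2:
  assumes "l \<ge> 1" "j < nlamps l" "j' < nlamps l" "j \<noteq> j'"
  shows "avg (samples l) (\<lambda>s. f (fst s j) * g (fst s j')) = avg (words l) f * avg (words l) g"
  using samples_resample[OF assms(1,2), of "\<lambda>s. f (fst s j) * g (fst s j')"] assms
  by (simp add: avg_cmult_right avg_cmult samples_weight)

lemma samples_shift:
  assumes l: "l \<ge> 1" "j < nlamps l" "i < l" and y: "lamp y j = 0" and C: "\<And>u. \<bar>f u\<bar> \<le> C"
  shows "\<bar>avg (samples l) (\<lambda>s. f (Wr (single j (\<nu> i) + y) 0 + relem \<nu> l s))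
    - avg (samples l) (\<lambda>s. dens l i (fst s j) * f (Wr y 0 + relem \<nu> l s))\<bar> \<le> C / l"
proof -
  \<comment> \<open>The sample with the content of lamp \<open>j\<close> removed and
    \<open>u\<close> put in its place. After lamp \<open>j\<close> has been resampled, both averages
    are averages of a function of \<open>u\<close> alone; \<open>y\<close> does not interfere since
    it vanishes at \<open>j\<close>.\<close>
  define Q where "Q = (\<lambda>x t u. Wr (y + single j u + (- single j (lamp (rlamp \<nu> l x) j) + rlamp \<nu> l x)) t)"
  have Q1: "Wr (single j (\<nu> i) + y) 0 + relem \<nu> l (x(j := w), t) = Q x t (\<nu> i + ev \<nu> w)"
    and Q2: "Wr y 0 + relem \<nu> l (x(j := w), t) = Q x t (ev \<nu> w)" for x w t
    using l y by (auto simp: Q_def relem_def Wr_plus lamp_single lamp_rlamp intro!: fs_eqI)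
  have "avg (samples l) (\<lambda>s. f (Wr (single j (\<nu> i) + y) 0 + relem \<nu> l s))
      - avg (samples l) (\<lambda>s. dens l i (fst s j) * f (Wr y 0 + relem \<nu> l s))
    = avg (samples l) (\<lambda>s. avg (words l) (\<lambda>w. f (Q (fst s) (snd s) (\<nu> i + ev \<nu> w)))
        - avg (words l) (\<lambda>w. dens l i w * f (Q (fst s) (snd s) (ev \<nu> w))))"
    unfolding samples_resample[OF l(1,2), of "\<lambda>s. f (Wr (single j (\<nu> i) + y) 0 + relem \<nu> l s)"]
      samples_resample[OF l(1,2), of "\<lambda>s. dens l i (fst s j) * f (Wr y 0 + relem \<nu> l s)"] avg_diff Q1 Q2 by simp
  moreover have "\<bar>\<dots>\<bar> \<le> C / l"
    by (rule avg_le[OF samples[OF l(1)]], rule avg_shift[OF l(3)]) (rule C)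
  ultimately show ?thesis by simp
qed

text \<open>Translation by \<open>t\<close> merely permutes the sample space: it renames the lamps
  and shifts the uniform permutation. What stood at lamp \<open>j\<close> reappears at
  \<open>papp t j\<close>, so a function that looks at one lamp separately has to follow it.\<close>

lemma samples_perm:
  assumes t: "t \<in> symk (nlamps l)"
  shows "avg (samples l) (\<lambda>s. f (fst s j) (Wr 0 t + relem \<nu> l s)) = avg (samples l) (\<lambda>s. f (fst s (papp t j)) (relem \<nu> l s))"
proof -
  define h where "h = (\<lambda>t (s :: (nat \<Rightarrow> nat \<times> (nat \<Rightarrow> nat)) \<times> fsym). ((\<lambda>i. fst s (papp (- t) i)), t + snd s))"
  have hS: "h t s \<in> samples l" if tk: "t \<in> symk (nlamps l)" and sl: "s \<in> samples l" for t s
  proof -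
    obtain x u where s: "s = (x, u)" "x \<in> {..<nlamps l} \<rightarrow>\<^sub>E words l" "u \<in> symk (nlamps l)"
      using sl by (auto simp: samples_def)
    have "(\<lambda>i. x (papp (- t) i)) \<in> {..<nlamps l} \<rightarrow>\<^sub>E words l"
    proof (rule PiE_I)
      fix i assume "i \<in> {..<nlamps l}"
      then have "papp (- t) i \<in> {..<nlamps l}" using symk_less[OF symk_uminus[OF tk], of i] by simp
      then show "x (papp (- t) i) \<in> words l" using s(2) by (rule PiE_mem[rotated])
    next
      fix i assume "i \<notin> {..<nlamps l}"
      then have "papp (- t) i \<notin> {..<nlamps l}" using symk_less[OF symk_uminus[OF tk], of i] by simp
      then show "x (papp (- t) i) = undefined" by (rule PiE_arb[OF s(2)])
    qed
    then show ?thesis using symk_plus[OF tk s(3)] s(1) by (simp add: h_def samples_def)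
  qed
  have inv: "h (- t) (h t s) = s" "h t (h (- t) s) = s" for t s
    by (simp_all add: h_def)
  have bij: "bij_betw (h t) (samples l) (samples l)"
    by (rule bij_betw_byWitness[of _ "h (- t)"]) (use inv hS[OF t] hS[OF symk_uminus[OF t]] in auto)
  have 1: "Wr 0 t + relem \<nu> l s = relem \<nu> l (h t s)" for s
  proof -
    have "act t (rlamp \<nu> l (fst s)) = rlamp \<nu> l (fst (h t s))"
      by (rule fs_eqI) (simp add: lamp_rlamp h_def symk_less[OF symk_uminus[OF t]])
    then show ?thesis by (simp add: relem_def Wr_plus) (simp add: h_def)
  qed
  have 2: "fst (h t s) (papp t j) = fst s j" for s by (simp add: h_def)
  have "avg (samples l) (\<lambda>s. f (fst s j) (Wr 0 t + relem \<nu> l s))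
     = avg (samples l) (\<lambda>s. f (fst (h t s) (papp t j)) (relem \<nu> l (h t s)))"
    unfolding 1 2 ..
  also have "\<dots> = avg (samples l) (\<lambda>s. f (fst s (papp t j)) (relem \<nu> l s))" by (rule avg_bij[OF bij])
  finally show ?thesis .
qed

section \<open>Bounded acyclicity of restricted wreath products with the finitary symmetric group\<close>

primrec smean :: "nat \<Rightarrow> nat \<Rightarrow> (((nat \<Rightarrow> nat \<times> (nat \<Rightarrow> nat)) \<times> fsym) list \<Rightarrow> real) \<Rightarrow> real" where
  "smean l 0 f = f []"
| "smean l (Suc n) f = avg (samples l) (\<lambda>s. smean l n (\<lambda>ss. f (s # ss)))"

lemma smean_add: "smean l n (\<lambda>s. f s + g s) = smean l n f + smean l n g"
  by (induction n arbitrary: f g) (auto simp: avg_add)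
lemma smean_cmult: "smean l n (\<lambda>s. c * f s) = c * smean l n f"
  by (induction n arbitrary: f) (auto simp: avg_cmult)
lemma smean_diff: "smean l n (\<lambda>s. f s - g s) = smean l n f - smean l n g"
  using smean_add[of l n f "\<lambda>s. (-1) * g s"] unfolding smean_cmult by simp
lemma smean_sum: "smean l n (\<lambda>s. \<Sum>j\<in>J. f j s) = (\<Sum>j\<in>J. smean l n (f j))"
  by (induction n arbitrary: f) (auto simp: avg_sum)
lemma smean_const: "l \<ge> 1 \<Longrightarrow> smean l n (\<lambda>_. c) = c"
  by (induction n) (auto simp: avg_const samples)
lemma smean_mono: "(\<And>s. f s \<le> g s) \<Longrightarrow> smean l n f \<le> smean l n g"
  by (induction n arbitrary: f g) (auto intro!: avg_mono)
lemma smean_cong: "(\<And>s. length s = n \<Longrightarrow> f s = g s) \<Longrightarrow> smean l n f = smean l n g"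
proof (induction n arbitrary: f g)
  case (Suc n)
  have "smean l n (\<lambda>ss. f (s # ss)) = smean l n (\<lambda>ss. g (s # ss))" for s by (rule Suc.IH) (use Suc.prems in auto)
  then show ?case by simp
qed simp
lemma smean_abs: "\<bar>smean l n f\<bar> \<le> smean l n (\<lambda>s. \<bar>f s\<bar>)"
proof -
  have "smean l n (\<lambda>s. (-1) * \<bar>f s\<bar>) \<le> smean l n f" by (rule smean_mono) auto
  moreover have "smean l n f \<le> smean l n (\<lambda>s. \<bar>f s\<bar>)" by (rule smean_mono) auto
  ultimately show ?thesis unfolding smean_cmult by linarith
qed

lemma smean_square:
  assumes "l \<ge> 1" shows "(smean l n f)\<^sup>2 \<le> smean l n (\<lambda>s. (f s)\<^sup>2)"
proof -
  let ?a = "smean l n f"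
  have "0 \<le> smean l n (\<lambda>s. (f s - ?a)\<^sup>2)"
    using smean_mono[of "\<lambda>_. 0" "\<lambda>s. (f s - ?a)\<^sup>2" l n] smean_const[OF assms, of n 0] by simp
  also have "(\<lambda>s. (f s - ?a)\<^sup>2) = (\<lambda>s. ((f s)\<^sup>2 + (- 2 * ?a) * f s) + ?a\<^sup>2)"
    by (auto simp: power2_eq_square algebra_simps)
  also have "smean l n \<dots> = smean l n (\<lambda>s. (f s)\<^sup>2) + (- 2 * ?a) * ?a + ?a\<^sup>2"
    unfolding smean_add smean_cmult smean_const[OF assms] by simp
  finally show ?thesis by (simp add: power2_eq_square algebra_simps)
qed

definition wmean :: "(nat \<Rightarrow> 'g::group_add) \<Rightarrow> nat \<Rightarrow> ('g wr \<Rightarrow> real) \<Rightarrow> real" where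
  "wmean \<nu> l f = avg (samples l) (\<lambda>s. f (relem \<nu> l s))"

definition addl :: "(nat \<Rightarrow> 'g::group_add) \<Rightarrow> nat \<Rightarrow> 'g fs list \<Rightarrow> ((nat \<Rightarrow> nat \<times> (nat \<Rightarrow> nat)) \<times> fsym) list \<Rightarrow> 'g wr list" where
  "addl \<nu> l ys ss = map2 (\<lambda>y s. Wr y 0 + relem \<nu> l s) ys ss"

text \<open>The joint density of a tuple of samples at lamp \<open>j\<close>: the factor of an entry
  stands for its translation, at lamp \<open>j\<close>, by the group element with the listed
  index.\<close>

definition wt :: "nat \<Rightarrow> nat list \<Rightarrow> nat \<Rightarrow> ((nat \<Rightarrow> nat \<times> (nat \<Rightarrow> nat)) \<times> fsym) list \<Rightarrow> real" where
  "wt l is j ss = prod_list (map2 (\<lambda>i s. dens l i (fst s j)) is ss)"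

lemma addl_Cons [simp]: "addl \<nu> l (y # ys) (s # ss) = (Wr y 0 + relem \<nu> l s) # addl \<nu> l ys ss"
  and addl_Nil [simp]: "addl \<nu> l [] ss = []" by (simp_all add: addl_def)
lemma wt_Cons [simp]: "wt l (i # is) j (s # ss) = dens l i (fst s j) * wt l is j ss"
  and wt_Nil [simp]: "wt l [] j ss = 1" by (simp_all add: wt_def)

lemma is_mean_wmean: "l \<ge> 1 \<Longrightarrow> is_mean (wmean \<nu> l)"
  using is_mean_avg[OF samples] by (simp add: wmean_def[abs_def])

lemma imean_wmean: "imean (wmean \<nu> l) (map (\<lambda>y. Wr y 0) ys) F = smean l (length ys) (\<lambda>ss. F (addl \<nu> l ys ss))"
  by (induction ys arbitrary: F) (auto simp: wmean_def)

text \<open>The entries are treated one at a time, each at cost C/l by \<open>samples_shift\<close>.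
  The error of the later entries is multiplied by a density of mean at most 1, so errors only add
  up.\<close>

lemma imean_shift:
  fixes C :: real
  assumes "length is = length ys" and l: "l \<ge> 1" "j < nlamps l" "\<forall>i\<in>set is. i < l"
    and y: "\<forall>y\<in>set ys. lamp y j = 0" and C: "\<And>u. \<bar>F u\<bar> \<le> C"
  shows "\<bar>imean (wmean \<nu> l) (map2 (\<lambda>i y. Wr (single j (\<nu> i) + y) 0) is ys) F
    - smean l (length ys) (\<lambda>ss. wt l is j ss * F (addl \<nu> l ys ss))\<bar> \<le> length ys * C / l"
  using assms
proof (induction "is" ys arbitrary: F rule: list_induct2)
  case (Cons i "is" y ys)
  let ?I = "\<lambda>z. imean (wmean \<nu> l) (map2 (\<lambda>i y. Wr (single j (\<nu> i) + y) 0) is ys) (\<lambda>l. F (z # l))"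
  let ?S = "\<lambda>z. smean l (length ys) (\<lambda>ss. wt l is j ss * F (z # addl \<nu> l ys ss))"
  have i: "i < l" using Cons.prems by simp
  have IH: "\<bar>?I z - ?S z\<bar> \<le> length ys * C / l" for z
    by (rule Cons.IH) (use Cons.prems in auto)
  have I: "\<bar>?I z\<bar> \<le> C" for z by (rule imean_le[OF is_mean_wmean[OF l(1)]]) (use Cons.prems in auto)
  have a: "\<bar>avg (samples l) (\<lambda>s. ?I (Wr (single j (\<nu> i) + y) 0 + relem \<nu> l s))
      - avg (samples l) (\<lambda>s. dens l i (fst s j) * ?I (Wr y 0 + relem \<nu> l s))\<bar> \<le> C / l"
    by (rule samples_shift) (use Cons.prems I in auto)
  have "\<bar>avg (samples l) (\<lambda>s. dens l i (fst s j) * ?I (Wr y 0 + relem \<nu> l s))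
      - avg (samples l) (\<lambda>s. dens l i (fst s j) * ?S (Wr y 0 + relem \<nu> l s))\<bar>
      = \<bar>avg (samples l) (\<lambda>s. dens l i (fst s j) * (?I (Wr y 0 + relem \<nu> l s) - ?S (Wr y 0 + relem \<nu> l s)))\<bar>"
    unfolding right_diff_distrib avg_diff ..
  also have "\<dots> \<le> avg (samples l) (\<lambda>s. \<bar>dens l i (fst s j) * (?I (Wr y 0 + relem \<nu> l s) - ?S (Wr y 0 + relem \<nu> l s))\<bar>)"
    by (rule avg_abs)
  also have "\<dots> \<le> avg (samples l) (\<lambda>s. dens l i (fst s j) * (length ys * C / l))"
    by (rule avg_mono) (unfold abs_mult abs_of_nonneg[OF dens_nonneg], rule mult_left_mono[OF IH dens_nonneg])
  also have "\<dots> = (1 - 1 / l) * (length ys * C / l)"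
    unfolding avg_cmult_right using samples_weight[OF l(1,2), of "dens l i"] avg_dens_1[OF i] by simp
  also have "\<dots> \<le> 1 * (length ys * C / l)"
  proof (rule mult_right_mono)
    have "0 \<le> C" using Cons.prems(5)[of "[]"] by linarith
    then show "0 \<le> length ys * C / l" by simp
  qed simp
  finally have b: "\<bar>avg (samples l) (\<lambda>s. dens l i (fst s j) * ?I (Wr y 0 + relem \<nu> l s))
      - avg (samples l) (\<lambda>s. dens l i (fst s j) * ?S (Wr y 0 + relem \<nu> l s))\<bar> \<le> length ys * C / l" by simp
  have c: "smean l (length (y # ys)) (\<lambda>ss. wt l (i # is) j ss * F (addl \<nu> l (y # ys) ss))
     = avg (samples l) (\<lambda>s. dens l i (fst s j) * ?S (Wr y 0 + relem \<nu> l s))"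
    by (simp add: smean_cmult mult.assoc)
  have d: "imean (wmean \<nu> l) (map2 (\<lambda>i y. Wr (single j (\<nu> i) + y) 0) (i # is) (y # ys)) F
     = avg (samples l) (\<lambda>s. ?I (Wr (single j (\<nu> i) + y) 0 + relem \<nu> l s))"
    by (simp add: wmean_def)
  have "real (length (y # ys)) * C / l = length ys * C / l + C / l" by (simp add: algebra_simps add_divide_distrib)
  then show ?case unfolding c d using a b by linarith
qed simp

text \<open>Since \<open>t\<close> fixes every \<open>y\<close>, the permutation commutes past the
  lamp parts and reaches the random elements, whose law absorbs it. For invariant \<open>F\<close>
  the permutation on the left is free, so the weight may travel from lamp \<open>j\<close> to
  \<open>papp t j\<close>; this is \<open>smean_perm\<close>.\<close>

lemma smean_perm_aux:
  assumes "length is = length ys" and t: "t \<in> symk (nlamps l)" "\<forall>y\<in>set ys. act t y = y"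
  shows "smean l (length ys) (\<lambda>ss. wt l is j ss * F (map ((+) (Wr 0 t)) (addl \<nu> l ys ss)))
    = smean l (length ys) (\<lambda>ss. wt l is (papp t j) ss * F (addl \<nu> l ys ss))"
  using assms
proof (induction "is" ys arbitrary: F rule: list_induct2)
  case (Cons i "is" y ys)
  let ?S = "\<lambda>z. smean l (length ys) (\<lambda>ss. wt l is (papp t j) ss * F (z # addl \<nu> l ys ss))"
  have comm: "Wr 0 t + (Wr y 0 + z) = Wr y 0 + (Wr 0 t + z)" for z
    using Cons.prems by (simp add: add.assoc[symmetric] Wr_plus)
  have IH: "smean l (length ys) (\<lambda>ss. wt l is j ss * F (z # map ((+) (Wr 0 t)) (addl \<nu> l ys ss))) = ?S z" for z
    by (rule Cons.IH) (use Cons.prems in auto)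
  have "smean l (length (y # ys)) (\<lambda>ss. wt l (i # is) j ss * F (map ((+) (Wr 0 t)) (addl \<nu> l (y # ys) ss)))
    = avg (samples l) (\<lambda>s. dens l i (fst s j) * ?S (Wr y 0 + (Wr 0 t + relem \<nu> l s)))"
    by (simp add: smean_cmult mult.assoc comm IH)
  also have "\<dots> = avg (samples l) (\<lambda>s. dens l i (fst s (papp t j)) * ?S (Wr y 0 + relem \<nu> l s))"
    by (rule samples_perm[OF t(1), of "\<lambda>a u. dens l i a * ?S (Wr y 0 + u)"])
  also have "\<dots> = smean l (length (y # ys)) (\<lambda>ss. wt l (i # is) (papp t j) ss * F (addl \<nu> l (y # ys) ss))"
    by (simp add: smean_cmult mult.assoc)
  finally show ?case .
qed simp

lemma smean_perm:
  assumes "length is = length ys" and t: "t \<in> symk (nlamps l)" "\<forall>y\<in>set ys. act t y = y"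
    and "translation_inv F"
  shows "smean l (length ys) (\<lambda>ss. wt l is j ss * F (addl \<nu> l ys ss))
    = smean l (length ys) (\<lambda>ss. wt l is (papp t j) ss * F (addl \<nu> l ys ss))"
  using smean_perm_aux[OF assms(1-3), of j F \<nu>] assms(4) by (simp add: translation_inv_def)

lemma wt_moments:
  assumes l: "l \<ge> 1" "j < nlamps l" "\<forall>i\<in>set is. i < l"
  shows "smean l (length is) (wt l is j) = (1 - 1 / l) ^ length is"
    and "j' < nlamps l \<Longrightarrow> j \<noteq> j' \<Longrightarrow> smean l (length is) (\<lambda>ss. wt l is j ss * wt l is j' ss) = ((1 - 1 / l) ^ length is)\<^sup>2"
    and "smean l (length is) (\<lambda>ss. wt l is j ss * wt l is j ss) \<le> real l ^ length is"
proof -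
  show "smean l (length is) (wt l is j) = (1 - 1 / l) ^ length is" using l(3)
  proof (induction "is")
    case (Cons i "is")
    then show ?case
      by (simp add: smean_cmult avg_cmult_right samples_weight[OF l(1,2)] avg_dens_1)
  qed (simp add: smean_const[OF l(1)])
  show "smean l (length is) (\<lambda>ss. wt l is j ss * wt l is j' ss) = ((1 - 1 / l) ^ length is)\<^sup>2"
    if j': "j' < nlamps l" "j \<noteq> j'" using l(3)
  proof (induction "is")
    case (Cons i "is")
    have "smean l (length (i # is)) (\<lambda>ss. wt l (i # is) j ss * wt l (i # is) j' ss)
      = avg (samples l) (\<lambda>s. (dens l i (fst s j) * dens l i (fst s j')) * smean l (length is) (\<lambda>ss. wt l is j ss * wt l is j' ss))"
      by (simp add: smean_cmult[symmetric] mult_ac)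
    also have "\<dots> = (1 - 1 / l)\<^sup>2 * ((1 - 1 / l) ^ length is)\<^sup>2"
      unfolding avg_cmult_right using Cons samples_weight2[OF l(1,2) j', of "dens l i" "dens l i"]
      by (simp add: avg_dens_1 power2_eq_square)
    finally show ?case by (simp add: power_mult_distrib)
  qed (simp add: smean_const[OF l(1)])
  show "smean l (length is) (\<lambda>ss. wt l is j ss * wt l is j ss) \<le> real l ^ length is" using l(3)
  proof (induction "is")
    case (Cons i "is")
    have "smean l (length (i # is)) (\<lambda>ss. wt l (i # is) j ss * wt l (i # is) j ss)
      = avg (samples l) (\<lambda>s. (dens l i (fst s j) * dens l i (fst s j)) * smean l (length is) (\<lambda>ss. wt l is j ss * wt l is j ss))"
      by (simp add: smean_cmult[symmetric] mult_ac)
    also have "\<dots> = avg (words l) (\<lambda>w. dens l i w * dens l i w) * smean l (length is) (\<lambda>ss. wt l is j ss * wt l is j ss)"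
      unfolding avg_cmult_right samples_weight[OF l(1,2), of "\<lambda>w. dens l i w * dens l i w"] ..
    also have "\<dots> \<le> l * real l ^ length is"
    proof (rule mult_mono)
      show "0 \<le> smean l (length is) (\<lambda>ss. wt l is j ss * wt l is j ss)"
        using smean_mono[of "\<lambda>_. 0" "\<lambda>ss. wt l is j ss * wt l is j ss" l "length is"] smean_const[OF l(1), of _ 0] by simp
    qed (use Cons avg_dens_sq in auto)
    finally show ?case by simp
  qed (simp add: smean_const[OF l(1)])
qed

text \<open>A second moment argument as in Chebyshev's inequality. Weights at distinct lamps are
  uncorrelated, so their sum over \<open>J\<close> has variance at most \<open>card J\<close> times
  the second moment; \<open>smean_square\<close> turns this into a bound on the mean absolute
  deviation.\<close>

lemma wt_lln:
  assumes l: "l \<ge> 1" "finite J" "J \<subseteq> {..<nlamps l}" "\<forall>i\<in>set is. i < l" and C: "C \<ge> 0" "\<And>ss. \<bar>f ss\<bar> \<le> C"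
  shows "\<bar>(\<Sum>j\<in>J. smean l (length is) (\<lambda>ss. wt l is j ss * f ss))
     - card J * (1 - 1 / l) ^ length is * smean l (length is) f\<bar> \<le> C * sqrt (card J * real l ^ length is)"
proof -
  let ?n = "length is" let ?r = "(1 - 1 / real l) ^ length is" let ?K = "real (card J)"
  let ?D = "\<lambda>ss. (\<Sum>j\<in>J. wt l is j ss) - ?K * ?r"
  have m1: "smean l ?n (wt l is j) = ?r" if "j \<in> J" for j using wt_moments(1)[OF l(1) _ l(4)] that l(3) by auto
  have m2: "(\<Sum>j'\<in>J. smean l ?n (\<lambda>ss. wt l is j ss * wt l is j' ss)) \<le> real l ^ ?n + ?K * ?r\<^sup>2" if j: "j \<in> J" for j
  proof -
    have jl: "j < nlamps l" using j l(3) by auto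
    have "(\<Sum>j'\<in>J. smean l ?n (\<lambda>ss. wt l is j ss * wt l is j' ss))
      = smean l ?n (\<lambda>ss. wt l is j ss * wt l is j ss) + (\<Sum>j'\<in>J - {j}. smean l ?n (\<lambda>ss. wt l is j ss * wt l is j' ss))"
      by (rule sum.remove[OF l(2) j])
    also have "(\<Sum>j'\<in>J - {j}. smean l ?n (\<lambda>ss. wt l is j ss * wt l is j' ss)) = (\<Sum>j'\<in>J - {j}. ?r\<^sup>2)"
      by (rule sum.cong) (use l(3) wt_moments(2)[OF l(1) jl l(4)] in auto)
    also have "\<dots> \<le> ?K * ?r\<^sup>2"
      by (simp add: mult_right_mono card_mono l(2))
    finally show ?thesis using wt_moments(3)[OF l(1) jl l(4)] by linarith
  qed
  have "smean l ?n (\<lambda>ss. (?D ss)\<^sup>2)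
    = smean l ?n (\<lambda>ss. (\<Sum>j\<in>J. \<Sum>j'\<in>J. wt l is j ss * wt l is j' ss) + ((- 2 * ?K * ?r) * (\<Sum>j\<in>J. wt l is j ss) + (?K * ?r)\<^sup>2))"
    by (rule smean_cong) (simp add: power2_eq_square sum_product algebra_simps)
  also have "\<dots> = (\<Sum>j\<in>J. \<Sum>j'\<in>J. smean l ?n (\<lambda>ss. wt l is j ss * wt l is j' ss))
      + ((- 2 * ?K * ?r) * (\<Sum>j\<in>J. smean l ?n (wt l is j)) + (?K * ?r)\<^sup>2)"
    unfolding smean_add smean_sum smean_cmult smean_const[OF l(1)] by simp
  also have "(\<Sum>j\<in>J. smean l ?n (wt l is j)) = ?K * ?r" using m1 by simp
  also have "(\<Sum>j\<in>J. \<Sum>j'\<in>J. smean l ?n (\<lambda>ss. wt l is j ss * wt l is j' ss)) + ((- 2 * ?K * ?r) * (?K * ?r) + (?K * ?r)\<^sup>2)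
     \<le> ?K * (real l ^ ?n + ?K * ?r\<^sup>2) + ((- 2 * ?K * ?r) * (?K * ?r) + (?K * ?r)\<^sup>2)"
    by (intro add_right_mono) (use sum_bounded_above[of J, OF m2] in simp)
  also have "\<dots> = ?K * real l ^ ?n" by (simp add: power2_eq_square algebra_simps)
  finally have D2: "smean l ?n (\<lambda>ss. (?D ss)\<^sup>2) \<le> ?K * real l ^ ?n" .
  have "(smean l ?n (\<lambda>ss. \<bar>?D ss\<bar>))\<^sup>2 \<le> ?K * real l ^ ?n"
    using smean_square[OF l(1), of ?n "\<lambda>ss. \<bar>?D ss\<bar>"] D2 by simp
  then have D1: "smean l ?n (\<lambda>ss. \<bar>?D ss\<bar>) \<le> sqrt (?K * real l ^ ?n)" by (rule real_le_rsqrt)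
  have "(\<Sum>j\<in>J. smean l ?n (\<lambda>ss. wt l is j ss * f ss)) - ?K * ?r * smean l ?n f = smean l ?n (\<lambda>ss. ?D ss * f ss)"
    unfolding left_diff_distrib smean_diff smean_cmult sum_distrib_right smean_sum ..
  also have "\<bar>\<dots>\<bar> \<le> smean l ?n (\<lambda>ss. \<bar>?D ss * f ss\<bar>)" by (rule smean_abs)
  also have "\<dots> \<le> smean l ?n (\<lambda>ss. C * \<bar>?D ss\<bar>)"
    by (rule smean_mono) (simp add: abs_mult mult.commute[of C] mult_left_mono C)
  also have "\<dots> \<le> C * sqrt (?K * real l ^ ?n)" unfolding smean_cmult by (rule mult_left_mono[OF D1 C(1)])
  finally show ?thesis .
qed

section \<open>Emptying one lamp of a tuple at vanishing cost\<close>

definition zero_at :: "nat \<Rightarrow> 'g::group_add fs \<Rightarrow> 'g fs" where "zero_at j y = single j (- lamp y j) + y"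

lemma lamp_zero_at: "lamp (zero_at j y) i = (if i = j then 0 else lamp y i)"
  by (simp add: zero_at_def lamp_single)

text \<open>The contents of lamp \<open>j\<close> are traded for a weight at \<open>j\<close>, the
  weight for its average over all lamps where the emptied entries vanish, and that average for its
  expectation. Of the two terms n/l (with n the length of \<open>ys\<close>), one comes from the
  trade for weights, the other from the expectation (1 - 1/l)^n not being exactly 1.\<close>

lemma column_estimate:
  fixes \<nu> :: "nat \<Rightarrow> 'g::group_add" and C :: real
  assumes F: "translation_inv F" "\<And>u. \<bar>F u\<bar> \<le> C" "C \<ge> 0"
    and l: "l \<ge> 1" "j < nlamps l" and "is": "length is = length ys" "\<forall>i\<in>set is. i < l" "map \<nu> is = map (\<lambda>y. lamp y j) ys"
    and S: "finite S" "\<forall>y\<in>set ys. \<forall>i. lamp y i \<noteq> 0 \<longrightarrow> i \<in> S" "card S < nlamps l"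
  shows "\<bar>imean (wmean \<nu> l) (map (\<lambda>y. Wr y 0) ys) F - imean (wmean \<nu> l) (map (\<lambda>y. Wr y 0) (map (zero_at j) ys)) F\<bar>
    \<le> C * (2 * length ys / l + sqrt (real l ^ length ys / (nlamps l - card S)))"
proof -
  let ?zs = "map (zero_at j) ys" let ?n = "length ys" let ?r = "(1 - 1 / real l) ^ ?n"
  let ?W = "\<lambda>j. smean l ?n (\<lambda>ss. wt l is j ss * F (addl \<nu> l ?zs ss))"
  define M where "M = smean l ?n (\<lambda>ss. F (addl \<nu> l ?zs ss))"
  have M: "imean (wmean \<nu> l) (map (\<lambda>y. Wr y 0) ?zs) F = M" unfolding M_def imean_wmean by simp
  have "map2 (\<lambda>i y. Wr (single j (\<nu> i) + y) 0) is ?zs = map (\<lambda>y. Wr y 0) ys"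
  proof (rule nth_equalityI)
    fix k assume k: "k < length (map2 (\<lambda>i y. Wr (single j (\<nu> i) + y) 0) is ?zs)"
    then have "\<nu> (is ! k) = lamp (ys ! k) j" using "is" by (metis length_map length_zip min_less_iff_conj nth_map)
    then have "single j (\<nu> (is ! k)) + zero_at j (ys ! k) = ys ! k"
      by (intro fs_eqI) (simp add: lamp_zero_at lamp_single)
    then show "map2 (\<lambda>i y. Wr (single j (\<nu> i) + y) 0) is ?zs ! k = map (\<lambda>y. Wr y 0) ys ! k" using k by simp
  qed (use "is" in simp)
  then have 1: "\<bar>imean (wmean \<nu> l) (map (\<lambda>y. Wr y 0) ys) F - ?W j\<bar> \<le> ?n * C / l"
    using imean_shift[of "is" ?zs l j F C \<nu>] "is" l F(2) by (simp add: lamp_zero_at)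
  \<comment> \<open>Lamps that are 0 in every emptied entry: those outside the common support, and
    \<open>j\<close> itself, which may lie in \<open>S\<close> and is therefore added by hand. The
    transposition of \<open>j\<close> with any of them fixes the entries.\<close>
  define J where "J = insert j ({..<nlamps l} - S)"
  have J: "finite J" "J \<subseteq> {..<nlamps l}" using l by (auto simp: J_def)
  have "card {..<nlamps l} - card S \<le> card ({..<nlamps l} - S)" by (rule diff_card_le_card_Diff[OF S(1)])
  also have "\<dots> \<le> card J" by (rule card_mono[OF J(1)]) (auto simp: J_def)
  finally have cJ: "real (nlamps l) - real (card S) \<le> card J" using S(3) by simp
  have pos: "real (nlamps l) - real (card S) > 0" using S(3) by simp
  have WJ: "?W j' = ?W j" if "j' \<in> J" for j'
  proof -
    have j': "j' < nlamps l" using that J(2) by blast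
    have "papp (fswap j j') i = i" if "i \<ge> nlamps l" for i
      using that l(2) j' by (simp add: papp_fswap)
    then have "fswap j j' \<in> symk (nlamps l)" by (simp add: symk_def)
    moreover have "\<forall>y\<in>set ?zs. act (fswap j j') y = y"
    proof
      fix z assume "z \<in> set ?zs"
      then obtain y where y: "y \<in> set ys" "z = zero_at j y" by auto
      have "j' = j \<or> j' \<notin> S" using that unfolding J_def by blast
      then have "lamp z j' = 0" using y S(2) by (auto simp: lamp_zero_at)
      moreover have "lamp z j = 0" using y by (simp add: lamp_zero_at)
      ultimately show "act (fswap j j') z = z" by (intro fs_eqI) (simp add: papp_minus_fswap)
    qed
    ultimately have "smean l (length ?zs) (\<lambda>ss. wt l is j ss * F (addl \<nu> l ?zs ss))
      = smean l (length ?zs) (\<lambda>ss. wt l is (papp (fswap j j') j) ss * F (addl \<nu> l ?zs ss))"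
      by (intro smean_perm) (use "is" F in auto)
    then show ?thesis by (simp add: papp_fswap)
  qed
  have "\<bar>card J * ?W j - card J * ?r * M\<bar> \<le> C * sqrt (card J * real l ^ ?n)"
    using wt_lln[OF l(1) J "is"(2) F(3), of "\<lambda>ss. F (addl \<nu> l ?zs ss)"] F(2) WJ "is"(1) by (simp add: M_def)
  then have "card J * \<bar>?W j - ?r * M\<bar> \<le> C * sqrt (card J * real l ^ ?n)"
  proof -
    have "real (card J) * \<bar>a - b\<bar> = \<bar>card J * a - card J * b\<bar>" for a b :: real
      by (simp add: abs_mult right_diff_distrib[symmetric])
    then show ?thesis using \<open>\<bar>card J * ?W j - card J * ?r * M\<bar> \<le> C * sqrt (card J * real l ^ ?n)\<close>
      by (simp only: mult.assoc)
  qed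
  also have "\<dots> = C * (card J * sqrt (real l ^ ?n / card J))"
  proof -
    have "sqrt (K * a) = K * sqrt (a / K)" if K: "K > 0" for K a :: real
    proof -
      have "K * sqrt (a / K) = (sqrt K * sqrt K) * (sqrt a / sqrt K)" using K by (simp add: real_sqrt_divide)
      also have "\<dots> = sqrt K * sqrt a" using K by (simp add: field_simps del: real_sqrt_mult_self)
      finally show ?thesis by (simp add: real_sqrt_mult)
    qed
    then show ?thesis using cJ pos by simp
  qed
  finally have "\<bar>?W j - ?r * M\<bar> \<le> C * sqrt (real l ^ ?n / card J)"
    using cJ pos by (simp add: mult.left_commute[of C])
  also have "\<dots> \<le> C * sqrt (real l ^ ?n / (nlamps l - card S))"
    using cJ pos F(3) by (intro mult_left_mono real_sqrt_le_mono divide_left_mono) auto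
  finally have 2: "\<bar>?W j - ?r * M\<bar> \<le> C * sqrt (real l ^ ?n / (nlamps l - card S))" .
  have "1 + ?n * (- 1 / real l) \<le> (1 + (- 1 / real l)) ^ ?n"
    by (rule Bernoulli_inequality) (use l in \<open>simp add: field_simps\<close>)
  then have r: "1 - ?r \<le> ?n / l" by simp
  have r1: "?r \<le> 1" using l by (intro power_le_one) (auto simp: field_simps)
  have "\<bar>M\<bar> \<le> smean l ?n (\<lambda>_. C)" unfolding M_def by (rule order_trans[OF smean_abs smean_mono[OF F(2)]])
  then have "\<bar>M\<bar> \<le> C" by (simp add: smean_const[OF l(1)])
  have "\<bar>?r * M - M\<bar> = (1 - ?r) * \<bar>M\<bar>"
  proof -
    have "?r * M - M = - ((1 - ?r) * M)" by (simp add: algebra_simps)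
    then show ?thesis using r1 by (simp add: abs_mult)
  qed
  also have "\<dots> \<le> (?n / l) * C" using r r1 \<open>\<bar>M\<bar> \<le> C\<close> by (intro mult_mono) auto
  finally have 3: "\<bar>?r * M - M\<bar> \<le> ?n * C / l" by simp
  have "C * (2 * ?n / l + sqrt (real l ^ ?n / (nlamps l - card S)))
    = ?n * C / l + C * sqrt (real l ^ ?n / (nlamps l - card S)) + ?n * C / l" by (simp add: algebra_simps)
  then show ?thesis unfolding M using 1 2 3 by linarith
qed

lemma column_tendsto:
  fixes \<nu> :: "nat \<Rightarrow> 'g::group_add"
  assumes F: "translation_inv F" "bddf F" and \<nu>: "surj \<nu>"
  shows "(\<lambda>l. imean (wmean \<nu> l) (map (\<lambda>y. Wr y 0) ys) F
     - imean (wmean \<nu> l) (map (\<lambda>y. Wr y 0) (map (zero_at j) ys)) F) \<longlonglongrightarrow> 0"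
proof -
  obtain C where C: "C \<ge> 0" "\<And>u. \<bar>F u\<bar> \<le> C" using F(2) by (rule bddfE) blast
  define "is" where "is = map (\<lambda>y. SOME i. \<nu> i = lamp y j) ys"
  have is1: "length is = length ys" by (simp add: is_def)
  have "\<nu> (SOME i. \<nu> i = lamp y j) = lamp y j" for y
    using \<nu> by (intro someI_ex[of "\<lambda>i. \<nu> i = lamp y j"]) (metis surjD)
  then have is2: "map \<nu> is = map (\<lambda>y. lamp y j) ys" by (simp add: is_def)
  define S where "S = (\<Union>y\<in>set ys. {i. lamp y i \<noteq> 0})"
  have S: "finite S" "\<forall>y\<in>set ys. \<forall>i. lamp y i \<noteq> 0 \<longrightarrow> i \<in> S" by (auto simp: S_def finite_lamp)
  define n where "n = length ys"
  \<comment> \<open>One sum collects all thresholds: the letters in \<open>is\<close>, the lamp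
    \<open>j\<close>, twice the size of the support, and the exponent \<open>n + 2\<close>. Two
    powers of l beyond l^n make the square root at most 2/l.\<close>
  define N where "N = n + 2 * card S + j + sum_list is + 4"
  have bound: "\<bar>imean (wmean \<nu> l) (map (\<lambda>y. Wr y 0) ys) F - imean (wmean \<nu> l) (map (\<lambda>y. Wr y 0) (map (zero_at j) ys)) F\<bar>
      \<le> C * (2 * n + 2) * (1 / l)" if l: "l \<ge> N" for l
  proof -
    have l1: "l \<ge> 1" "n + 2 \<le> l" "j < l" "2 * card S < l" using l by (auto simp: N_def)
    have il: "\<forall>i\<in>set is. i < l" using l member_le_sum_list[of _ "is"] by (fastforce simp: N_def)
    have ll: "l \<le> nlamps l" using l1 self_le_power[of l l] by (simp add: nlamps_def)
    have "l ^ (n + 2) \<le> nlamps l" unfolding nlamps_def using l1 by (intro power_increasing) auto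
    then have k1: "real l ^ (n + 2) \<le> real (nlamps l)" by (metis of_nat_le_iff of_nat_power)
    have k2: "2 * real (card S) \<le> real (nlamps l)" using l1(4) ll by linarith
    have k3: "real l ^ (n + 2) / 2 \<le> real (nlamps l) - real (card S)" using k1 k2 by linarith
    have pos: "real l ^ (n + 2) > 0" using l1 by simp
    have "real l ^ n / (nlamps l - card S) \<le> real l ^ n / (real l ^ (n + 2) / 2)"
      using k3 pos by (intro divide_left_mono mult_pos_pos) auto
    also have "\<dots> = 2 / (real l)\<^sup>2" using l1 by (simp add: power_add field_simps power2_eq_square)
    also have "\<dots> \<le> (2 / real l)\<^sup>2" by (simp add: power_divide divide_right_mono)
    finally have "sqrt (real l ^ n / (nlamps l - card S)) \<le> 2 / l" by (intro real_le_lsqrt) auto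
    then have "C * (2 * n / l + sqrt (real l ^ n / (nlamps l - card S))) \<le> C * (2 * n / l + 2 / l)"
      using C(1) by (intro mult_left_mono) auto
    also have "\<dots> = C * (2 * n + 2) * (1 / l)" by (simp add: algebra_simps add_divide_distrib)
    finally have 1: "C * (2 * n / l + sqrt (real l ^ n / (nlamps l - card S))) \<le> C * (2 * n + 2) * (1 / l)" .
    have jl: "j < nlamps l" and cs: "card S < nlamps l" using l1 ll by linarith+
    show ?thesis
      using column_estimate[OF F(1) C(2,1) l1(1) jl is1 il is2 S cs] 1 unfolding n_def by (rule order_trans)
  qed
  have "(\<lambda>l::nat. C * (2 * n + 2) * (1 / l)) \<longlonglongrightarrow> C * (2 * n + 2) * 0"
    by (intro tendsto_mult tendsto_const lim_1_over_n)
  then have lim: "(\<lambda>l::nat. C * (2 * n + 2) * (1 / l)) \<longlonglongrightarrow> 0" by simp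
  show ?thesis
    by (rule Lim_null_comparison[OF _ lim]) (use bound in \<open>auto simp: eventually_sequentially\<close>)
qed

lemma lamps_tendsto:
  fixes \<nu> :: "nat \<Rightarrow> 'g::group_add"
  assumes F: "translation_inv F" "bddf F" and \<nu>: "surj \<nu>"
  shows "(\<lambda>l. imean (wmean \<nu> l) (map (\<lambda>y. Wr y 0) ys) F - imean (wmean \<nu> l) (map (\<lambda>_. 0) ys) F) \<longlonglongrightarrow> 0"
proof -
  have main: "(\<lambda>l. imean (wmean \<nu> l) (map (\<lambda>y. Wr y 0) ys) F - imean (wmean \<nu> l) (map (\<lambda>_. 0) ys) F) \<longlonglongrightarrow> 0"
    if "finite S" "\<forall>y\<in>set ys. \<forall>i. lamp y i \<noteq> 0 \<longrightarrow> i \<in> S" for S ys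
    using that
  proof (induction S arbitrary: ys rule: finite_induct)
    case empty
    then have "\<forall>y\<in>set ys. y = 0" by (auto intro: fs_eqI)
    then have "map (\<lambda>y. Wr y 0) ys = map (\<lambda>_. 0) ys" by (simp add: zero_wr_def)
    then show ?case by (simp only: diff_self tendsto_const)
  next
    case (insert j S)
    let ?I = "\<lambda>ys l. imean (wmean \<nu> l) (map (\<lambda>y. Wr y 0) ys) F"
    let ?zs = "map (zero_at j) ys"
    have "(\<lambda>l. ?I ?zs l - imean (wmean \<nu> l) (map (\<lambda>_. 0) ?zs) F) \<longlonglongrightarrow> 0"
      by (rule insert.IH) (use insert.prems in \<open>auto simp: lamp_zero_at split: if_splits\<close>)
    from tendsto_add[OF column_tendsto[OF F \<nu>, of ys j] this]
    show ?case by (simp add: comp_def)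
  qed
  have "finite (\<Union>y\<in>set ys. {i. lamp y i \<noteq> 0})" by (auto simp: finite_lamp)
  from main[OF this, of ys] show ?thesis by auto
qed

text \<open>A permutation of the lamps in use is absorbed by the law of the samples without error,
  so only the lamp parts of the tuple remain to be dealt with.\<close>

lemma imean_wmean_perm:
  assumes "\<forall>g\<in>set gs. wperm g \<in> symk (nlamps l)"
  shows "imean (wmean \<nu> l) gs F = imean (wmean \<nu> l) (map (\<lambda>g. Wr (wlamp g) 0) gs) F"
  using assms
proof (induction gs arbitrary: F)
  case (Cons g gs)
  let ?f = "\<lambda>z. imean (wmean \<nu> l) (map (\<lambda>g. Wr (wlamp g) 0) gs) (\<lambda>l. F (z # l))"
  have "g + z = Wr (wlamp g) 0 + (Wr 0 (wperm g) + z)" for z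
    by (metis add.assoc wr_split)
  then have "wmean \<nu> l (\<lambda>z. ?f (g + z)) = avg (samples l) (\<lambda>s. ?f (Wr (wlamp g) 0 + (Wr 0 (wperm g) + relem \<nu> l s)))"
    by (simp add: wmean_def)
  also have "\<dots> = avg (samples l) (\<lambda>s. ?f (Wr (wlamp g) 0 + relem \<nu> l s))"
    using samples_perm[of "wperm g" l "\<lambda>_ u. ?f (Wr (wlamp g) 0 + u)"] Cons.prems by simp
  also have "\<dots> = wmean \<nu> l (\<lambda>z. ?f (Wr (wlamp g) 0 + z))" by (simp only: wmean_def)
  finally show ?case using Cons by simp
qed simp

theorem coboundary_wr:
  fixes F :: "'g::group_add wr list \<Rightarrow> real"
  assumes \<nu>: "surj (\<nu> :: nat \<Rightarrow> 'g)" and "cocycle n F" "n \<ge> 1"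
  shows "coboundary n F"
proof (rule coboundary_of_asymptotic_invariance[OF _ _ assms(2,3)])
  \<comment> \<open>At length bound 0 there are no words, hence no samples and no mean; the sequence
    is therefore started at 1.\<close>
  show "is_mean (wmean \<nu> (Suc k))" for k by (rule is_mean_wmean) simp
  fix F :: "'g wr list \<Rightarrow> real" and gs :: "'g wr list" assume F: "translation_inv F" "bddf F"
  have "eventually (\<lambda>l. \<forall>g\<in>set gs. wperm g \<in> symk (nlamps l)) sequentially"
  proof (rule eventually_ball_finite)
    show "\<forall>g\<in>set gs. eventually (\<lambda>l. wperm g \<in> symk (nlamps l)) sequentially"
    proof
      fix g assume "g \<in> set gs"
      obtain k where k: "\<forall>k'\<ge>k. wperm g \<in> symk k'" using ex_symk by blast
      have "k \<le> nlamps l" if "l \<ge> Suc k" for l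
        using that self_le_power[of l l] unfolding nlamps_def by simp
      then show "eventually (\<lambda>l. wperm g \<in> symk (nlamps l)) sequentially"
        using k unfolding eventually_sequentially by blast
    qed
  qed simp
  then have "eventually (\<lambda>l. imean (wmean \<nu> l) (map (\<lambda>y. Wr y 0) (map wlamp gs)) F - imean (wmean \<nu> l) (map (\<lambda>_. 0) (map wlamp gs)) F
     = imean (wmean \<nu> l) gs F - imean (wmean \<nu> l) (map (\<lambda>_. 0) gs) F) sequentially"
    by eventually_elim (simp add: imean_wmean_perm[of gs] comp_def)
  then have "(\<lambda>l. imean (wmean \<nu> l) gs F - imean (wmean \<nu> l) (map (\<lambda>_. 0) gs) F) \<longlonglongrightarrow> 0"
    using tendsto_cong lamps_tendsto[OF F \<nu>, of "map wlamp gs"] by fastforce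
  then show "(\<lambda>k. imean (wmean \<nu> (Suc k)) gs F - imean (wmean \<nu> (Suc k)) (map (\<lambda>_. 0) gs) F) \<longlonglongrightarrow> 0"
    by (rule LIMSEQ_Suc)
qed

text \<open>The group is the increasing union of the finite groups \<open>symk k\<close>. Uniform
  means over these absorb a given finite tuple exactly as soon as \<open>k\<close> is large.\<close>

theorem coboundary_fsym:
  fixes F :: "fsym list \<Rightarrow> real"
  assumes "cocycle n F" "n \<ge> 1"
  shows "coboundary n F"
proof (rule coboundary_of_asymptotic_invariance[OF _ _ assms])
  define E where "E = (\<lambda>k. \<lambda>f::fsym \<Rightarrow> real. avg (symk k) f)"
  show "is_mean (E k)" for k
    unfolding E_def using is_mean_avg[OF finite_symk, of k "\<lambda>s. s"] symk_0[of k] by auto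
  fix F :: "fsym list \<Rightarrow> real" and gs assume F: "translation_inv F" "bddf F"
  have "imean (E k) gs F = imean (E k) (map (\<lambda>_. 0) gs) F" if "\<forall>g\<in>set gs. g \<in> symk k" for k F
    using that
  proof (induction gs arbitrary: F)
    case (Cons g gs)
    let ?f = "\<lambda>z. imean (E k) (map (\<lambda>_. 0) gs) (\<lambda>l. F (z # l))"
    have g: "g \<in> symk k" using Cons.prems by simp
    have "bij_betw ((+) g) (symk k) (symk k)"
      by (rule bij_betw_byWitness[of _ "(+) (- g)"]) (use symk_plus[OF g] symk_plus[OF symk_uminus[OF g]] in auto)
    then have "E k (\<lambda>x. ?f (g + x)) = E k ?f" unfolding E_def by (rule avg_bij)
    then show ?case using Cons by simp
  qed simp
  moreover have "eventually (\<lambda>k. \<forall>g\<in>set gs. g \<in> symk k) sequentially"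
    by (rule eventually_ball_finite) (use ex_symk in \<open>auto simp: eventually_sequentially\<close>)
  ultimately have "eventually (\<lambda>k. imean (E k) gs F - imean (E k) (map (\<lambda>_. 0) gs) F = 0) sequentially"
    by (auto elim!: eventually_mono)
  then show "(\<lambda>k. imean (E k) gs F - imean (E k) (map (\<lambda>_. 0) gs) F) \<longlonglongrightarrow> 0"
    by (rule tendsto_eventually)
qed

section \<open>Cup products and shuffles\<close>

text \<open>The Eilenberg-Zilber shuffle: a signed sum over the monotone lattice paths through the
  grid \<open>A\<close> times \<open>Y\<close>, with \<open>P\<close> evaluated at the list of
  vertices. A step along \<open>Y\<close> takes its sign from the number of steps along
  \<open>A\<close> still to come. Running out of \<open>A\<close> counts 0 and running out of
  \<open>Y\<close> counts only at the last entry of \<open>A\<close>, so each path is counted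
  once.\<close>

fun shuf :: "('a \<Rightarrow> 'b \<Rightarrow> 'h) \<Rightarrow> 'a list \<Rightarrow> 'b list \<Rightarrow> ('h list \<Rightarrow> real) \<Rightarrow> real" where
  "shuf e [] Y P = 0"
| "shuf e (a # A) [] P = (if A = [] then P [] else 0)"
| "shuf e (a # A) (y # Y) P = shuf e A (y # Y) (\<lambda>l. P (e a y # l)) + (-1) ^ length A * shuf e (a # A) Y (\<lambda>l. P (e a y # l))"

lemma shuf_diff: "shuf e A Y (\<lambda>l. P l - Q l) = shuf e A Y P - shuf e A Y Q"
  by (induction e A Y P arbitrary: Q rule: shuf.induct) (simp_all add: right_diff_distrib)

lemma shuf_zero [simp]: "shuf e A Y (\<lambda>_. 0) = 0"
  using shuf_diff[of e A Y "\<lambda>_. 0" "\<lambda>_. 0"] by simp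

lemma shuf_cong:
  "(\<And>l. Suc (length l) = length A + length Y \<Longrightarrow> P l = Q l) \<Longrightarrow> shuf e A Y P = shuf e A Y Q"
proof (induction e A Y P arbitrary: Q rule: shuf.induct)
  case (3 e a A y Y P)
  have "shuf e A (y # Y) (\<lambda>l. P (e a y # l)) = shuf e A (y # Y) (\<lambda>l. Q (e a y # l))"
    by (rule 3(1)) (use 3(3) in auto)
  moreover have "shuf e (a # A) Y (\<lambda>l. P (e a y # l)) = shuf e (a # A) Y (\<lambda>l. Q (e a y # l))"
    by (rule 3(2)) (use 3(3) in auto)
  ultimately show ?case by simp
qed auto

lemma shuf_map: "shuf e (map u A) (map v Y) P = shuf (\<lambda>a y. e (u a) (v y)) A Y P"
  by (induction "\<lambda>a y. e (u a) (v y)" A Y P rule: shuf.induct) auto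

lemma shuf_comp: "shuf (\<lambda>a y. h (e a y)) A Y P = shuf e A Y (\<lambda>l. P (map h l))"
  by (induction "\<lambda>a y. h (e a y)" A Y P rule: shuf.induct) auto

lemma shuf_le:
  assumes "\<And>l. \<bar>P l\<bar> \<le> C" shows "\<bar>shuf e A Y P\<bar> \<le> C * 2 ^ (length A + length Y)"
  using assms
proof (induction e A Y P rule: shuf.induct)
  case (1 e Y P) then show ?case using order_trans[OF abs_ge_zero 1[of "[]"]] by simp
next
  case (2 e a A P)
  have C: "0 \<le> C" using order_trans[OF abs_ge_zero 2[of "[]"]] by simp
  have "C * 1 \<le> C * 2 ^ (length (a # A) + length [])" using C by (intro mult_left_mono one_le_power) auto
  then show ?case using 2[of "[]"] C by auto
next
  case (3 e a A y Y P)
  have "\<bar>shuf e A (y # Y) (\<lambda>l. P (e a y # l))\<bar> \<le> C * 2 ^ (length A + length (y # Y))" by (rule 3(1)) (rule 3(3))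
  moreover have "\<bar>shuf e (a # A) Y (\<lambda>l. P (e a y # l))\<bar> \<le> C * 2 ^ (length (a # A) + length Y)" by (rule 3(2)) (rule 3(3))
  moreover have "\<bar>(-1) ^ length A * shuf e (a # A) Y (\<lambda>l. P (e a y # l))\<bar> = \<bar>shuf e (a # A) Y (\<lambda>l. P (e a y # l))\<bar>"
    by (simp add: abs_mult power_abs)
  ultimately show ?case by simp
qed

text \<open>The Leibniz rule for the boundary of a product of simplices. Deleting a corner of a path
  leaves the same list as for the path around the other side of the square, with the opposite sign;
  the other deletions are faces of \<open>A\<close> or of \<open>Y\<close>.\<close>

lemma shuf_boundary:
  "shuf e A Y (cobd P) = cobd (\<lambda>A. shuf e A Y P) A - (-1) ^ length A * cobd (\<lambda>Y. shuf e A Y P) Y"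
proof (induction e A Y P rule: shuf.induct)
  case (1 e Y P) show ?case by (simp add: cobd_const)
next
  case (2 e a A P)
  have "shuf e A [] P = cobd (\<lambda>A. if A = [] then P [] else 0) A"
  proof (cases A)
    case (Cons b B)
    have "cobd (\<lambda>l. if b # l = [] then P [] else 0) B = 0" by (simp add: cobd_const)
    then show ?thesis using Cons by simp
  qed simp
  then show ?case by simp
next
  case (3 e a A y Y P)
  let ?p = "\<lambda>l. P (e a y # l)" let ?s = "(-1::real) ^ length A"
  have c1: "cobd (\<lambda>A'. shuf e (a # A') (y # Y) P) A = cobd (\<lambda>A'. shuf e A' (y # Y) ?p) A - ?s * cobd (\<lambda>A'. shuf e (a # A') Y ?p) A"
  proof -
    have "cobd (\<lambda>A'. shuf e (a # A') (y # Y) P) A = cobd (\<lambda>A'. shuf e A' (y # Y) ?p + (- ?s) * shuf e (a # A') Y ?p) A"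
    proof (rule cobd_cong)
      fix l :: "'a list" assume "Suc (length l) = length A"
      then have "?s = - ((-1) ^ length l)" by (metis mult_minus1 power_Suc)
      then show "shuf e (a # l) (y # Y) P = shuf e l (y # Y) ?p + (- ?s) * shuf e (a # l) Y ?p" by simp
    qed
    then show ?thesis unfolding cobd_add cobd_cmult by simp
  qed
  have c2: "cobd (\<lambda>Y'. shuf e (a # A) (y # Y') P) Y = cobd (\<lambda>Y'. shuf e A (y # Y') ?p) Y + ?s * cobd (\<lambda>Y'. shuf e (a # A) Y' ?p) Y"
    by (simp add: cobd_add cobd_cmult)
  have i1: "shuf e A (y # Y) (cobd ?p) = cobd (\<lambda>A. shuf e A (y # Y) ?p) A - ?s * (shuf e A Y ?p - cobd (\<lambda>Y'. shuf e A (y # Y') ?p) Y)"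
    using 3(1) by simp
  have i2: "shuf e (a # A) Y (cobd ?p) = shuf e A Y ?p - cobd (\<lambda>A'. shuf e (a # A') Y ?p) A + ?s * cobd (\<lambda>Y'. shuf e (a # A) Y' ?p) Y"
    using 3(2) by simp
  have L: "shuf e (a # A) (y # Y) (cobd P) = (shuf e A (y # Y) P - shuf e A (y # Y) (cobd ?p)) + ?s * (shuf e (a # A) Y P - shuf e (a # A) Y (cobd ?p))"
    by (simp add: shuf_diff)
  have R: "cobd (\<lambda>A. shuf e A (y # Y) P) (a # A) - (-1) ^ length (a # A) * cobd (\<lambda>Y. shuf e (a # A) Y P) (y # Y)
     = shuf e A (y # Y) P - cobd (\<lambda>A'. shuf e (a # A') (y # Y) P) A + ?s * (shuf e (a # A) Y P - cobd (\<lambda>Y'. shuf e (a # A) (y # Y') P) Y)"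
    by simp
  have "(a - (u - s * (v - w))) + s * (b - (v - t + s * r)) = a - (u - s * t) + s * (b - (w + s * r))"
    for a b r s t u v w :: real by (simp add: algebra_simps)
  then show ?case unfolding L R c1 c2 i1 i2 .
qed

lemma shuf_single: "shuf e [a] Y P = P (map (e a) Y)"
  by (induction Y arbitrary: P) auto

text \<open>The Alexander-Whitney product: the front and the back face share entry
  \<open>m\<close>.\<close>

definition cup :: "nat \<Rightarrow> ('g list \<Rightarrow> real) \<Rightarrow> ('g list \<Rightarrow> real) \<Rightarrow> 'g list \<Rightarrow> real" where
  "cup m F G xs = F (take (Suc m) xs) * G (drop m xs)"

lemma cobd_cup:
  assumes "length xs \<ge> m + 2"
  shows "cobd (cup m F G) xs = cobd F (take (m + 2) xs) * G (drop (m + 1) xs) + (-1) ^ m * F (take (m + 1) xs) * cobd G (drop m xs)"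
  using assms
proof (induction m arbitrary: F xs)
  case 0
  then obtain p l0 where l0: "xs = p # l0" by (cases xs) auto
  with 0 obtain q l where "l0 = q # l" by (cases l0) auto
  with l0 have xs: "xs = p # q # l" by simp
  have "cobd (\<lambda>l. cup 0 F G (p # l)) (q # l) = cobd (\<lambda>l. F [p] * G (p # l)) (q # l)" by (rule cobd_cong) (simp add: cup_def)
  also have "\<dots> = F [p] * (G (q # l) - cobd G (p # q # l))" unfolding cobd_cmult by simp
  finally show ?case unfolding xs cobd.simps(2)[of "cup 0 F G" p] by (simp add: cup_def algebra_simps numeral_2_eq_2)
next
  case (Suc m)
  then obtain p l where xs: "xs = p # l" "length l \<ge> m + 2" by (cases xs) auto
  have "cobd (\<lambda>l. cup (Suc m) F G (p # l)) l = cobd (cup m (\<lambda>l. F (p # l)) G) l" by (rule cobd_cong) (simp add: cup_def)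
  also have "\<dots> = cobd (\<lambda>l. F (p # l)) (take (m + 2) l) * G (drop (m + 1) l) + (-1) ^ m * F (p # take (m + 1) l) * cobd G (drop m l)"
    by (rule Suc.IH) (rule xs)
  finally show ?case using xs by (simp add: cup_def algebra_simps)
qed

lemma cocycle_cup:
  assumes F: "cocycle m F" and G: "cocycle n G" shows "cocycle (m + n) (cup m F G)"
  unfolding cocycle_def
proof (intro conjI allI impI)
  show "translation_inv (cup m F G)" using F G by (simp add: cocycle_def translation_inv_def cup_def take_map drop_map)
  show "bddf (cup m F G)" unfolding cup_def[abs_def]
    using bddf_mult[OF bddf_comp[of F "take (Suc m)"] bddf_comp[of G "drop m"]] F G by (simp add: cocycle_def)
  fix xs :: "'a list" assume len: "length xs = m + n + 2"
  have "length (take (m + 2) xs) = m + 2" "length (drop m xs) = n + 2" using len by auto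
  then show "cobd (cup m F G) xs = 0" using cobd_cup[of m xs F G] F G len by (simp add: cocycle_def)
qed

section \<open>Pullbacks along homomorphisms and nonvanishing of products\<close>

definition additive :: "('g::group_add \<Rightarrow> 'h::group_add) \<Rightarrow> bool" where
  "additive r \<longleftrightarrow> (\<forall>x y. r (x + y) = r x + r y)"

lemma cocycle_pullback: assumes "additive r" "cocycle n F" shows "cocycle n (\<lambda>xs. F (map r xs))"
proof -
  have "map r (map ((+) g) xs) = map ((+) (r g)) (map r xs)" for g xs using assms(1) by (simp add: additive_def)
  then show ?thesis using assms(2) unfolding cocycle_def translation_inv_def
    by (metis bddf_comp cobd_map length_map)
qed

lemma coboundary_pullback: assumes "additive r" "coboundary n F" shows "coboundary n (\<lambda>xs. F (map r xs))"
proof -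
  obtain B where B: "translation_inv B" "bddf B" "\<And>xs. length xs = n + 1 \<Longrightarrow> F xs = cobd B xs"
    using assms(2) by (auto simp: coboundary_def)
  have "map r (map ((+) g) xs) = map ((+) (r g)) (map r xs)" for g xs using assms(1) by (simp add: additive_def)
  then have "translation_inv (\<lambda>xs. B (map r xs))" using B(1) unfolding translation_inv_def by metis
  then show ?thesis unfolding coboundary_def using B bddf_comp[OF B(2)]
    by (intro exI[of _ "\<lambda>xs. B (map r xs)"]) (auto simp: cobd_map)
qed

definition normalized :: "('g list \<Rightarrow> real) \<Rightarrow> bool" where
  "normalized F \<longleftrightarrow> (\<forall>l x l'. F (l @ [x, x] @ l') = 0)"

text \<open>Only the path that uses up \<open>A\<close> before it moves along \<open>Y\<close>
  survives: an earlier step along \<open>Y\<close> repeats an entry in the front face, where a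
  normalized cochain vanishes.\<close>

lemma shuf_cup:
  assumes r: "\<And>a y. rA (e a y) = a" "\<And>a y. rB (e a y) = y" and F: "normalized F"
  shows "shuf e (a # A) (y # Y) (cup (length A) (\<lambda>l. F (map rA l)) (\<lambda>l. G (map rB l))) = F (a # A) * G (y # Y)"
  using F
proof (induction A arbitrary: a F)
  case Nil
  have "map rA (map (e a) l) = map (\<lambda>_. a) l" "map rB (map (e a) l) = l" for l using r by (simp_all add: comp_def)
  then show ?case unfolding shuf_single cup_def by (simp add: r)
next
  case (Cons a' A)
  let ?P = "cup (length (a' # A)) (\<lambda>l. F (map rA l)) (\<lambda>l. G (map rB l))"
  have nz: "normalized (\<lambda>l. F (a # l))" using Cons.prems unfolding normalized_def by (metis append_Cons)
  have "(\<lambda>l. ?P (e a y # l)) = cup (length A) (\<lambda>l. F (a # map rA l)) (\<lambda>l. G (map rB l))"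
    by (auto simp: cup_def r)
  then have 1: "shuf e (a' # A) (y # Y) (\<lambda>l. ?P (e a y # l)) = F (a # a' # A) * G (y # Y)"
    using Cons.IH[OF nz, of a'] by simp
  have 2: "shuf e (a # a' # A) Y (\<lambda>l. ?P (e a y # l)) = 0"
  proof (cases Y)
    case (Cons y' Y')
    have "F (a # a # l) = 0" for l using \<open>normalized F\<close> unfolding normalized_def by (metis append_Cons append_Nil)
    then have "?P (e a y # e a y' # l) = 0" for l by (simp add: cup_def r)
    then show ?thesis unfolding Cons shuf.simps(3) by simp
  qed simp
  have "shuf e (a # a' # A) (y # Y) ?P = shuf e (a' # A) (y # Y) (\<lambda>l. ?P (e a y # l))
      + (-1) ^ length (a' # A) * shuf e (a # a' # A) Y (\<lambda>l. ?P (e a y # l))" by (rule shuf.simps(3))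
  then show ?case unfolding 1 2 by (simp only: mult_zero_right add_0_right)
qed

text \<open>A bounded functional on cochains of degree \<open>n\<close> that vanishes on
  coboundaries of bounded invariant cochains but not on \<open>c\<close>. It acts on arbitrary
  bounded cochains, so that it can be applied in one variable of a cochain of two; the uniform
  constant \<open>K\<close> keeps the outcome bounded.\<close>

definition detects :: "nat \<Rightarrow> (('g::group_add list \<Rightarrow> real) \<Rightarrow> real) \<Rightarrow> ('g list \<Rightarrow> real) \<Rightarrow> bool" where
  "detects n \<mu> c \<longleftrightarrow> (\<forall>f g. (\<forall>l. length l = n + 1 \<longrightarrow> f l = g l) \<longrightarrow> \<mu> f = \<mu> g)
    \<and> (\<forall>f g. bddf f \<longrightarrow> bddf g \<longrightarrow> \<mu> (\<lambda>l. f l + g l) = \<mu> f + \<mu> g)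
    \<and> (\<forall>f k. bddf f \<longrightarrow> \<mu> (\<lambda>l. k * f l) = k * \<mu> f)
    \<and> (\<exists>K. \<forall>f C. (\<forall>l. \<bar>f l\<bar> \<le> C) \<longrightarrow> \<bar>\<mu> f\<bar> \<le> K * C)
    \<and> (\<forall>f. translation_inv f \<longrightarrow> bddf f \<longrightarrow> \<mu> (cobd f) = 0) \<and> \<mu> c \<noteq> 0"

lemma cobd_functional_swap:
  assumes add: "\<And>f g. bddf f \<Longrightarrow> bddf g \<Longrightarrow> \<mu> (\<lambda>l. f l + g l) = \<mu> f + \<mu> (g :: 'x \<Rightarrow> real)"
    and cm: "\<And>f k. bddf f \<Longrightarrow> \<mu> (\<lambda>l. k * f l) = k * \<mu> f"
    and b: "\<And>x l. \<bar>F x l\<bar> \<le> C"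
  shows "cobd (\<lambda>l. \<mu> (\<lambda>x. F x l)) gs = \<mu> (\<lambda>x. cobd (F x) gs)"
  using b
proof (induction gs arbitrary: F)
  case Nil show ?case using cm[of "\<lambda>_. 0" 0] by simp
next
  case (Cons p gs)
  have 1: "bddf (\<lambda>x. F x gs)" using Cons.prems by (intro bddf_I)
  have 2: "bddf (\<lambda>x. cobd (\<lambda>l. F x (p # l)) gs)"
    by (rule bddf_I[of _ "C * length gs"]) (rule cobd_abs_le, rule Cons.prems)
  have "cobd (\<lambda>l. \<mu> (\<lambda>x. F x (p # l))) gs = \<mu> (\<lambda>x. cobd (\<lambda>l. F x (p # l)) gs)"
    by (rule Cons.IH) (rule Cons.prems)
  then show ?case using add[OF 1 bddf_cmult[OF 2, of "-1"]] cm[OF 2, of "-1"] by simp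
qed

text \<open>A slant product. A primitive \<open>P\<close> of the product is evaluated on shuffles of
  tuples of the two commuting factors, and \<open>\<mu>\<close> is applied in the first variable.
  The face terms of that variable form a coboundary, which \<open>\<mu>\<close> kills; what remains
  exhibits a nonzero multiple of \<open>CB\<close> as a coboundary.\<close>

theorem cup_not_coboundary:
  fixes sA :: "'a::group_add \<Rightarrow> 'h::group_add" and sB :: "'b::group_add \<Rightarrow> 'h"
  assumes add: "additive sA" "additive sB" "additive rA" "additive rB"
    and comm: "\<And>a y. sA a + sB y = sB y + sA a"
    and r: "\<And>a y. rA (sA a + sB y) = a" "\<And>a y. rB (sA a + sB y) = y"
    and CA: "cocycle m CA" "normalized CA" "detects m \<mu> CA" and CB: "\<not> coboundary n CB"
  shows "\<not> coboundary (m + n) (cup m (\<lambda>xs. CA (map rA xs)) (\<lambda>xs. CB (map rB xs)))"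
proof
  let ?\<Phi> = "cup m (\<lambda>xs. CA (map rA xs)) (\<lambda>xs. CB (map rB xs))"
  assume "coboundary (m + n) ?\<Phi>"
  then obtain P where P: "translation_inv P" "bddf P" "\<And>xs. length xs = m + n + 1 \<Longrightarrow> ?\<Phi> xs = cobd P xs"
    by (auto simp: coboundary_def)
  obtain C where C: "C \<ge> 0" "\<And>l. \<bar>P l\<bar> \<le> C" using P(2) by (rule bddfE) blast
  define e where "e = (\<lambda>a y. sA a + sB y)"
  have \<mu>: "\<And>f g. (\<And>l. length l = m + 1 \<Longrightarrow> f l = g l) \<Longrightarrow> \<mu> f = \<mu> g"
    "\<And>f g. bddf f \<Longrightarrow> bddf g \<Longrightarrow> \<mu> (\<lambda>l. f l + g l) = \<mu> f + \<mu> g"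
    "\<And>f k. bddf f \<Longrightarrow> \<mu> (\<lambda>l. k * f l) = k * \<mu> f"
    "\<And>f. translation_inv f \<Longrightarrow> bddf f \<Longrightarrow> \<mu> (cobd f) = 0" "\<mu> CA \<noteq> 0"
    using CA(3) unfolding detects_def by blast+
  obtain K where K: "\<And>f C. (\<And>l. \<bar>f l\<bar> \<le> C) \<Longrightarrow> \<bar>\<mu> f\<bar> \<le> K * C" using CA(3) unfolding detects_def by blast
  \<comment> \<open>Cut off at the lengths in use, since the bound for \<open>shuf\<close> grows
    with the number of lattice paths. The index \<open>m + 1\<close> serves \<open>\<beta>\<close>,
    the index \<open>m\<close> serves the cochain \<open>\<psi>\<close> whose coboundary is
    killed.\<close>
  define f where "f = (\<lambda>k A Y. if length A = k \<and> length Y \<le> n + 1 then shuf e A Y P else 0)"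
  define D where "D = C * 2 ^ (m + 1 + (n + 1))"
  have fD: "\<bar>f k A Y\<bar> \<le> D" if "k \<le> m + 1" for k A Y
  proof (cases "length A = k \<and> length Y \<le> n + 1")
    case True
    have "\<bar>shuf e A Y P\<bar> \<le> C * 2 ^ (length A + length Y)" by (rule shuf_le[OF C(2)])
    also have "\<dots> \<le> D" unfolding D_def using True that C(1) by (intro mult_left_mono power_increasing) auto
    finally show ?thesis using True by (simp add: f_def)
  qed (use C in \<open>auto simp: f_def D_def\<close>)
  define \<beta> where "\<beta> = (\<lambda>Y. \<mu> (\<lambda>A. f (m + 1) A Y))"
  have eA: "e (g + a) y = sA g + e a y" and eB: "e a (g' + y) = sB g' + e a y" for g a g' y
    using add comm by (simp_all add: e_def additive_def add.assoc[symmetric])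
  have sA: "shuf e (map ((+) g) A) Y P = shuf e A Y P" for g A Y
    using shuf_map[of e "(+) g" A "\<lambda>y. y" Y P] shuf_comp[of "(+) (sA g)" e A Y P] P(1)
    by (simp add: eA translation_inv_def)
  have sB: "shuf e A (map ((+) g) Y) P = shuf e A Y P" for g A Y
    using shuf_map[of e "\<lambda>a. a" A "(+) g" Y P] shuf_comp[of "(+) (sB g)" e A Y P] P(1)
    by (simp add: eB translation_inv_def)
  have \<beta>1: "translation_inv \<beta>" by (simp add: \<beta>_def translation_inv_def f_def sB cong: if_cong)
  have \<beta>2: "bddf \<beta>" unfolding \<beta>_def by (rule bddf_I[of _ "K * D"]) (rule K, rule fD, simp)
  have key: "cobd \<beta> Y = (-1) ^ m * \<mu> CA * CB Y" if Y: "length Y = n + 1" for Y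
  proof -
    define \<psi> where "\<psi> = (\<lambda>A. f m A Y)"
    have \<psi>: "translation_inv \<psi>" "bddf \<psi>"
      using fD[of m] by (auto simp: \<psi>_def translation_inv_def f_def sA intro!: bddf_I[of _ D] cong: if_cong)
    have bCA: "bddf CA" using CA(1) by (simp add: cocycle_def)
    have "cobd \<beta> Y = \<mu> (\<lambda>A. cobd (f (m + 1) A) Y)" unfolding \<beta>_def
      by (rule cobd_functional_swap[OF \<mu>(2,3)]) (auto intro: fD)
    also have "\<dots> = \<mu> (\<lambda>A. (-1) ^ m * (CB Y * CA A) + (- ((-1) ^ m)) * trunc (m + 1) (cobd \<psi>) A)"
    proof (rule \<mu>(1))
      fix A :: "'a list" assume A: "length A = m + 1"
      have 1: "cobd (f (m + 1) A) Y = cobd (\<lambda>Y. shuf e A Y P) Y" by (rule cobd_cong) (use A Y in \<open>auto simp: f_def\<close>)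
      have 2: "cobd \<psi> A = cobd (\<lambda>A. shuf e A Y P) A" by (rule cobd_cong) (use A Y in \<open>auto simp: f_def \<psi>_def\<close>)
      obtain a A' y Y' where AY: "A = a # A'" "length A' = m" "Y = y # Y'" using A Y by (cases A; cases Y) auto
      have "shuf e A Y (cobd P) = shuf e A Y ?\<Phi>" by (rule shuf_cong) (use A Y P(3) in auto)
      also have "\<dots> = CA A * CB Y" using shuf_cup[of rA e rB CA a A' y Y' CB] r CA(2) AY by (simp add: e_def)
      finally have 3: "CA A * CB Y = cobd \<psi> A - (-1) ^ length A * cobd (f (m + 1) A) Y"
        unfolding 1 2 by (simp add: shuf_boundary)
      have s: "(-1::real) ^ m * (-1) ^ m = 1" by (simp add: power_mult_distrib[symmetric])
      have "(-1) ^ m * (CB Y * CA A) + (- ((-1) ^ m)) * cobd \<psi> A = ((-1) ^ m * (-1) ^ m) * cobd (f (m + 1) A) Y"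
        using 3 A by (simp add: algebra_simps)
      then show "cobd (f (m + 1) A) Y = (-1) ^ m * (CB Y * CA A) + (- ((-1) ^ m)) * trunc (m + 1) (cobd \<psi>) A"
        using s A by (simp add: trunc_def)
    qed
    also have "\<dots> = (-1) ^ m * (CB Y * \<mu> CA) + (- ((-1) ^ m)) * \<mu> (trunc (m + 1) (cobd \<psi>))"
      using bCA bddf_trunc_cobd[OF \<psi>(2)] by (simp only: \<mu>(2,3) bddf_cmult)
    also have "\<mu> (trunc (m + 1) (cobd \<psi>)) = \<mu> (cobd \<psi>)" by (rule \<mu>(1)) (simp add: trunc_def)
    also have "\<dots> = 0" by (rule \<mu>(4)[OF \<psi>])
    finally show ?thesis by simp
  qed
  let ?k = "(-1) ^ m / \<mu> CA"
  have "coboundary n (cobd \<beta>)" using \<beta>1 \<beta>2 by (auto simp: coboundary_def)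
  then have "coboundary n (\<lambda>Y. ?k * cobd \<beta> Y)" by (rule coboundary_cmult)
  moreover have "?k * cobd \<beta> Y = CB Y" if "length Y = n + 1" for Y
  proof -
    have s: "(-1::real) ^ m * (-1) ^ m = 1" by (simp add: power_mult_distrib[symmetric])
    have "?k * cobd \<beta> Y = ((-1) ^ m * (-1) ^ m) * CB Y" using key[OF that] \<mu>(5) by simp
    then show ?thesis using s by simp
  qed
  ultimately show False using CB coboundary_cong[of n "\<lambda>Y. ?k * cobd \<beta> Y" CB] by blast
qed

section \<open>Invariant means for commuting maps\<close>

definition orbavg :: "('x \<Rightarrow> 'x) \<Rightarrow> nat \<Rightarrow> ('x \<Rightarrow> real) \<Rightarrow> 'x \<Rightarrow> real" where
  "orbavg T N f x = avg {..<N} (\<lambda>j. f ((T ^^ j) x))"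

primrec iavg :: "(nat \<Rightarrow> 'x \<Rightarrow> 'x) \<Rightarrow> nat \<Rightarrow> nat list \<Rightarrow> ('x \<Rightarrow> real) \<Rightarrow> 'x \<Rightarrow> real" where
  "iavg T N [] f = f"
| "iavg T N (j # js) f = orbavg (T j) N (iavg T N js f)"

lemma iavg_add: "iavg T N js (\<lambda>x. f x + g x) = (\<lambda>x. iavg T N js f x + iavg T N js g x)"
  by (induction js) (auto simp: orbavg_def avg_add)

lemma iavg_cmult: "iavg T N js (\<lambda>x. c * f x) = (\<lambda>x. c * iavg T N js f x)"
  by (induction js) (auto simp: orbavg_def avg_cmult)

lemma iavg_const: "N \<ge> 1 \<Longrightarrow> iavg T N js (\<lambda>x. c) = (\<lambda>x. c)"
  by (induction js) (auto simp: orbavg_def avg_const lessThan_empty_iff)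

lemma iavg_le: assumes "N \<ge> 1" "\<And>x. \<bar>f x\<bar> \<le> C" shows "\<bar>iavg T N js f x\<bar> \<le> C"
proof (induction js arbitrary: x)
  case (Cons j js)
  show ?case unfolding iavg.simps orbavg_def
    by (rule avg_le) (use assms Cons in \<open>auto simp: lessThan_empty_iff\<close>)
qed (use assms in simp)

text \<open>An ultralimit of averages over boxes of iterates of more and more of the maps. Shifting
  along one map telescopes in its own average and, by commutation, passes through the others, so it
  costs at most 2C/N. Only points reachable from \<open>x0\<close> are evaluated; all lie in
  \<open>S\<close>, which concentrates the mean there.\<close>

lemma commuting_mean_exists:
  fixes T :: "'i::countable \<Rightarrow> 'x \<Rightarrow> 'x"
  assumes X0: "x0 \<in> S" and TX: "\<And>i x. x \<in> S \<Longrightarrow> T i x \<in> S"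
    and comm: "\<And>i j x. x \<in> S \<Longrightarrow> T i (T j x) = T j (T i x)"
  shows "\<exists>m. is_mean m \<and> (\<forall>i f. bddf f \<longrightarrow> m (\<lambda>x. f (T i x)) = m f)
    \<and> (\<forall>f g. (\<forall>x\<in>S. f x = g x) \<longrightarrow> m f = m g)"
proof -
  define U where "U = (\<lambda>n::nat. T (from_nat n))"
  have UX: "(U j ^^ k) x \<in> S" if "x \<in> S" for x j k using that TX by (induction k) (auto simp: U_def)
  have Uc: "(U j ^^ k) (T i x) = T i ((U j ^^ k) x)" if "x \<in> S" for x i j k
    using that UX by (induction k) (auto simp: U_def comm)
  have scong: "iavg U N js f x = iavg U N js g x" if "\<And>x. x \<in> S \<Longrightarrow> f x = g x" "x \<in> S" for N js f g x
    using that UX by (induction js arbitrary: x) (auto simp: orbavg_def intro!: avg_cong)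
  have shift: "iavg U N js (\<lambda>x. f (T i x)) x = iavg U N js f (T i x)" if "x \<in> S" for N js f x i
    using that UX by (induction js arbitrary: x) (auto simp: orbavg_def Uc intro!: avg_cong)
  have inv: "\<bar>iavg U N js (\<lambda>x. f (U i x)) x - iavg U N js f x\<bar> \<le> 2 * C / N"
    if "N \<ge> 1" "i \<in> set js" "\<And>x. \<bar>f x\<bar> \<le> C" "x \<in> S" for N js f i x C
    using that(2,4)
  proof (induction js arbitrary: x)
    case (Cons j js)
    let ?g = "iavg U N js f"
    show ?case
    proof (cases "i = j")
      case True
      have "orbavg (U i) N (iavg U N js (\<lambda>x. f (U i x))) x = avg {..<N} (\<lambda>k. ?g ((U i ^^ Suc k) x))"
        unfolding orbavg_def using shift UX Cons.prems(2) by (intro avg_cong) (simp add: U_def)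
      then have "orbavg (U i) N (iavg U N js (\<lambda>x. f (U i x))) x - orbavg (U i) N ?g x
         = ((\<Sum>k<N. ?g ((U i ^^ Suc k) x)) - (\<Sum>k<N. ?g ((U i ^^ k) x))) / N"
        by (simp add: orbavg_def avg_def diff_divide_distrib)
      also have "\<dots> = (?g ((U i ^^ N) x) - ?g x) / N"
        using sum_lessThan_telescope[of "\<lambda>k. ?g ((U i ^^ k) x)" N] by (simp add: sum_subtractf)
      also have "\<bar>\<dots>\<bar> \<le> 2 * C / N"
      proof -
        have g: "\<bar>?g z\<bar> \<le> C" for z by (rule iavg_le[OF that(1,3)])
        have "\<bar>?g ((U i ^^ N) x) - ?g x\<bar> \<le> 2 * C" using g[of "(U i ^^ N) x"] g[of x] by linarith
        then show ?thesis by (simp add: divide_right_mono)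
      qed
      finally show ?thesis using True by simp
    next
      case False
      then have i: "i \<in> set js" using Cons.prems by simp
      have "iavg U N (j # js) (\<lambda>x. f (U i x)) x - iavg U N (j # js) f x
          = avg {..<N} (\<lambda>k. iavg U N js (\<lambda>x. f (U i x)) ((U j ^^ k) x) - ?g ((U j ^^ k) x))"
        by (simp add: orbavg_def avg_diff)
      also have "\<bar>\<dots>\<bar> \<le> 2 * C / N"
        by (rule avg_le) (use that(1) Cons.IH[OF i] UX Cons.prems in \<open>auto simp: lessThan_empty_iff\<close>)
      finally show ?thesis .
    qed
  qed simp
  define m where "m = (\<lambda>f. ulim (\<lambda>k. iavg U (Suc k) [0..<k] f x0))"
  have b: "bddf (\<lambda>k. iavg U (Suc k) [0..<k] f x0)" if "bddf f" for f
  proof -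
    obtain C where "\<And>x. \<bar>f x\<bar> \<le> C" using \<open>bddf f\<close> by (auto simp: bddf_def)
    then show ?thesis by (intro bddf_I[of _ C] iavg_le) auto
  qed
  show ?thesis
  proof (intro exI[of _ m] conjI allI impI)
    show "is_mean m" unfolding is_mean_def m_def
      using b by (auto simp: iavg_add iavg_cmult iavg_const ulim_add ulim_cmult intro!: ulim_le iavg_le)
    show "m f = m g" if "\<forall>x\<in>S. f x = g x" for f g
      unfolding m_def using scong[of f g x0] that X0 by simp
    fix i and f :: "'x \<Rightarrow> real" assume bf: "bddf f"
    obtain C where C: "C \<ge> 0" "\<And>x. \<bar>f x\<bar> \<le> C" using bf by (rule bddfE) blast
    obtain n where n: "T i = U n" unfolding U_def by (metis from_nat_to_nat)
    have "(\<lambda>k. iavg U (Suc k) [0..<k] (\<lambda>x. f (T i x)) x0 - iavg U (Suc k) [0..<k] f x0) \<longlonglongrightarrow> 0"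
    proof (rule Lim_null_comparison)
      show "eventually (\<lambda>k. norm (iavg U (Suc k) [0..<k] (\<lambda>x. f (T i x)) x0 - iavg U (Suc k) [0..<k] f x0) \<le> 2 * C * inverse (real (Suc k))) sequentially"
        unfolding eventually_sequentially
      proof (intro exI[of _ "Suc n"] allI impI)
        fix k assume "Suc n \<le> k"
        then show "norm (iavg U (Suc k) [0..<k] (\<lambda>x. f (T i x)) x0 - iavg U (Suc k) [0..<k] f x0) \<le> 2 * C * inverse (real (Suc k))"
          using inv[of "Suc k" n "[0..<k]" f C x0] C X0 n by (simp add: divide_inverse)
      qed
      show "(\<lambda>k. 2 * C * inverse (real (Suc k))) \<longlonglongrightarrow> 0"
        using tendsto_mult[OF tendsto_const[of "2 * C"] LIMSEQ_inverse_real_of_nat] by simp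
    qed
    then have "ulim (\<lambda>k. iavg U (Suc k) [0..<k] (\<lambda>x. f (T i x)) x0 - iavg U (Suc k) [0..<k] f x0) = 0" by (rule ulim_null)
    then show "m (\<lambda>x. f (T i x)) = m f"
      using ulim_diff[OF b[OF bddf_comp[OF bf, of "T i"]] b[OF bf]] by (simp add: m_def)
  qed
qed

section \<open>Groups of matrices of rank two\<close>

text \<open>The predicate \<open>okdet\<close> singles out the admissible determinants: positive ones over the rationals,
  arbitrary nonzero ones over the Gaussian rationals.\<close>

class detfield = field +
  fixes okdet :: "'a \<Rightarrow> bool"
  assumes okdet_0: "okdet x \<Longrightarrow> x \<noteq> 0" and okdet_1: "okdet 1"
    and okdet_mult: "okdet x \<Longrightarrow> okdet y \<Longrightarrow> okdet (x * y)"
    and okdet_inverse: "okdet x \<Longrightarrow> okdet (inverse x)"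

text \<open>Entries are listed by rows, and matrix multiplication will be written as
  \<open>+\<close>, with the identity matrix as 0. The column (\<open>m11\<close>,
  \<open>m21\<close>) is the image of the base point of the projective line.\<close>

typedef (overloaded) 'k mat = "{(a, b, c, d). okdet (a * d - b * c :: 'k::detfield)}" morphisms rep_mat Abs_mat
  by (rule exI[of _ "(1, 0, 0, 1)"]) (simp add: okdet_1)

definition Mt :: "'k::detfield \<Rightarrow> 'k \<Rightarrow> 'k \<Rightarrow> 'k \<Rightarrow> 'k mat" where "Mt a b c d = Abs_mat (a, b, c, d)"
definition m11 :: "'k::detfield mat \<Rightarrow> 'k" where "m11 x = fst (rep_mat x)"
definition m12 :: "'k::detfield mat \<Rightarrow> 'k" where "m12 x = fst (snd (rep_mat x))"
definition m21 :: "'k::detfield mat \<Rightarrow> 'k" where "m21 x = fst (snd (snd (rep_mat x)))"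
definition m22 :: "'k::detfield mat \<Rightarrow> 'k" where "m22 x = snd (snd (snd (rep_mat x)))"

lemma Mt_sel: assumes "okdet (a * d - b * c)"
  shows "m11 (Mt a b c d) = a" "m12 (Mt a b c d) = b" "m21 (Mt a b c d) = c" "m22 (Mt a b c d) = d"
  using assms by (simp_all add: m11_def m12_def m21_def m22_def Mt_def Abs_mat_inverse)

lemma okdet_mat: "okdet (m11 x * m22 x - m12 x * m21 x)"
  using rep_mat[of x] by (auto simp: m11_def m12_def m21_def m22_def)

lemma det_nz: "m11 x * m22 x - m12 x * m21 x \<noteq> 0" using okdet_mat okdet_0 by blast

lemma mat_eqI: "m11 x = m11 y \<Longrightarrow> m12 x = m12 y \<Longrightarrow> m21 x = m21 y \<Longrightarrow> m22 x = m22 y \<Longrightarrow> x = y"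
  unfolding m11_def m12_def m21_def m22_def by (metis prod.collapse rep_mat_inject)

instantiation mat :: (detfield) group_add
begin
definition zero_mat :: "'a mat" where "zero_mat = Mt 1 0 0 1"
definition plus_mat :: "'a mat \<Rightarrow> 'a mat \<Rightarrow> 'a mat" where
  "plus_mat x y = Mt (m11 x * m11 y + m12 x * m21 y) (m11 x * m12 y + m12 x * m22 y)
     (m21 x * m11 y + m22 x * m21 y) (m21 x * m12 y + m22 x * m22 y)"
definition uminus_mat :: "'a mat \<Rightarrow> 'a mat" where
  "uminus_mat x = (let i = inverse (m11 x * m22 x - m12 x * m21 x) in Mt (i * m22 x) (- i * m12 x) (- i * m21 x) (i * m11 x))"
definition minus_mat :: "'a mat \<Rightarrow> 'a mat \<Rightarrow> 'a mat" where "minus_mat a b = a + (- b)"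

lemma sel_plus_mat: fixes x y :: "'a mat"
  shows "m11 (x + y) = m11 x * m11 y + m12 x * m21 y" "m12 (x + y) = m11 x * m12 y + m12 x * m22 y"
    "m21 (x + y) = m21 x * m11 y + m22 x * m21 y" "m22 (x + y) = m21 x * m12 y + m22 x * m22 y"
proof -
  have "okdet ((m11 x * m22 x - m12 x * m21 x) * (m11 y * m22 y - m12 y * m21 y))"
    by (intro okdet_mult okdet_mat)
  also have "(m11 x * m22 x - m12 x * m21 x) * (m11 y * m22 y - m12 y * m21 y)
    = (m11 x * m11 y + m12 x * m21 y) * (m21 x * m12 y + m22 x * m22 y) - (m11 x * m12 y + m12 x * m22 y) * (m21 x * m11 y + m22 x * m21 y)"
    by (simp add: algebra_simps)
  finally show "m11 (x + y) = m11 x * m11 y + m12 x * m21 y" "m12 (x + y) = m11 x * m12 y + m12 x * m22 y"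
    "m21 (x + y) = m21 x * m11 y + m22 x * m21 y" "m22 (x + y) = m21 x * m12 y + m22 x * m22 y"
    unfolding plus_mat_def by (simp_all add: Mt_sel)
qed

lemma sel_zero_mat: "m11 (0::'a mat) = 1" "m12 (0::'a mat) = 0" "m21 (0::'a mat) = 0" "m22 (0::'a mat) = 1"
  by (simp_all add: zero_mat_def Mt_sel okdet_1)

lemma sel_uminus_mat: fixes x :: "'a mat"
  defines "i \<equiv> inverse (m11 x * m22 x - m12 x * m21 x)"
  shows "m11 (- x) = i * m22 x" "m12 (- x) = - i * m12 x" "m21 (- x) = - i * m21 x" "m22 (- x) = i * m11 x"
proof -
  have nz: "m11 x * m22 x - m12 x * m21 x \<noteq> 0" by (rule det_nz)
  have "okdet i" unfolding i_def by (intro okdet_inverse okdet_mat)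
  also have "i = i * (i * (m11 x * m22 x - m12 x * m21 x))" using nz by (simp add: i_def)
  also have "\<dots> = (i * m22 x) * (i * m11 x) - (- i * m12 x) * (- i * m21 x)" by (simp add: algebra_simps)
  finally show "m11 (- x) = i * m22 x" "m12 (- x) = - i * m12 x" "m21 (- x) = - i * m21 x" "m22 (- x) = i * m11 x"
    unfolding uminus_mat_def Let_def i_def by (simp_all only: Mt_sel)
qed

instance
proof
  fix a b c :: "'a mat"
  show "a + b + c = a + (b + c)" by (rule mat_eqI) (simp_all add: sel_plus_mat algebra_simps)
  show "0 + a = a" "a + 0 = a" by (rule mat_eqI; simp add: sel_plus_mat sel_zero_mat)+
  have nz: "m11 a * m22 a - m12 a * m21 a \<noteq> 0" by (rule det_nz)
  show "- a + a = 0"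
  proof (rule mat_eqI)
    let ?d = "m11 a * m22 a - m12 a * m21 a"
    have "inverse ?d * m22 a * m11 a + - inverse ?d * m12 a * m21 a = inverse ?d * ?d" by (simp add: algebra_simps)
    then show "m11 (- a + a) = m11 0" using nz by (simp add: sel_plus_mat sel_uminus_mat sel_zero_mat)
    have "- inverse ?d * m21 a * m12 a + inverse ?d * m11 a * m22 a = inverse ?d * ?d" by (simp add: algebra_simps)
    then show "m22 (- a + a) = m22 0" using nz by (simp add: sel_plus_mat sel_uminus_mat sel_zero_mat)
  qed (simp_all add: sel_plus_mat sel_uminus_mat sel_zero_mat)
  show "a + - b = a - b" by (simp add: minus_mat_def)
qed
end

lemma countable_mat: "countable (UNIV :: 'k::{detfield, countable} mat set)"
proof -
  have "inj (rep_mat :: 'k mat \<Rightarrow> _)" by (simp add: inj_on_def rep_mat_inject)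
  then show ?thesis using countable_image_inj_eq by (metis countableI_type)
qed

text \<open>The bracket of the first columns of two matrices, taken as points of the projective
  line; it vanishes exactly when the points coincide.\<close>

definition cdet :: "'k::detfield mat \<Rightarrow> 'k mat \<Rightarrow> 'k" where
  "cdet x y = m11 x * m21 y - m21 x * m11 y"

lemma cdet_plus: "cdet (g + x) (g + y) = (m11 g * m22 g - m12 g * m21 g) * cdet x y"
  by (simp add: cdet_def sel_plus_mat algebra_simps)

lemma cdet_refl [simp]: "cdet x x = 0" by (simp add: cdet_def)
lemma cdet_swap: "cdet y x = - cdet x y" by (simp add: cdet_def algebra_simps)

lemma col_nz: "m11 x \<noteq> 0 \<or> m21 x \<noteq> 0" using det_nz[of x] by auto

lemma cdet_0E:
  assumes "cdet x y = 0"
  obtains k where "k \<noteq> 0" "m11 y = k * m11 x" "m21 y = k * m21 x"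
proof (cases "m11 x = 0")
  case True
  then have x: "m21 x \<noteq> 0" using col_nz by blast
  then have "m11 y = 0" using assms True by (simp add: cdet_def)
  then have "m21 y \<noteq> 0" using col_nz by blast
  show ?thesis by (rule that[of "m21 y / m21 x"]) (use x True \<open>m11 y = 0\<close> \<open>m21 y \<noteq> 0\<close> in auto)
next
  case False
  have e: "m21 y = m11 y / m11 x * m21 x" using assms False by (simp add: cdet_def field_simps)
  have "m11 y \<noteq> 0" using e col_nz[of y] by auto
  show ?thesis by (rule that[of "m11 y / m11 x"]) (use False e \<open>m11 y \<noteq> 0\<close> in auto)
qed

text \<open>The upper triangular group is metabelian: its mean is assembled from an invariant mean
  on the unipotent part, taken inside, and one on the diagonal part, taken outside. Both parts are
  abelian, so translations give commuting maps.\<close>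

lemma borel_mean_exists:
  "\<exists>m :: ('k::{detfield, countable} mat \<Rightarrow> real) \<Rightarrow> real. is_mean m
    \<and> (\<forall>b f. m21 b = 0 \<longrightarrow> bddf f \<longrightarrow> m (\<lambda>x. f (b + x)) = m f)
    \<and> (\<forall>f c. (\<forall>x. m21 x = 0 \<longrightarrow> f x = c) \<longrightarrow> m f = c)"
proof -
  have "\<exists>m :: ('k \<Rightarrow> real) \<Rightarrow> real. is_mean m \<and> (\<forall>v f. bddf f \<longrightarrow> m (\<lambda>u. f (u + v)) = m f) \<and> (\<forall>f g. (\<forall>x\<in>UNIV. f x = g x) \<longrightarrow> m f = m g)"
    by (rule commuting_mean_exists[of "0::'k" UNIV "\<lambda>v u. u + v"]) (simp_all add: ac_simps)
  then obtain mU :: "('k \<Rightarrow> real) \<Rightarrow> real" where U: "is_mean mU" "\<And>v f. bddf f \<Longrightarrow> mU (\<lambda>u. f (u + v)) = mU f"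
    by blast
  define S where "S = {q :: 'k \<times> 'k. okdet (fst q * snd q)}"
  \<comment> \<open>Pairs with inadmissible determinant act as the identity, so that the maps can be
    indexed by a whole countable type.\<close>
  define T where "T = (\<lambda>p q :: 'k \<times> 'k. if p \<in> S then (fst p * fst q, snd p * snd q) else q)"
  have TS: "T p q \<in> S" if "q \<in> S" for p q
  proof (cases "p \<in> S")
    case True
    then have "okdet ((fst p * snd p) * (fst q * snd q))" using that okdet_mult[of "fst p * snd p" "fst q * snd q"] by (simp add: S_def)
    then show ?thesis using True by (simp add: T_def S_def mult_ac)
  qed (use that in \<open>simp add: T_def\<close>)
  have "\<exists>m. is_mean m \<and> (\<forall>p f. bddf f \<longrightarrow> m (\<lambda>q. f (T p q)) = m f) \<and> (\<forall>f g. (\<forall>x\<in>S. f x = g x) \<longrightarrow> m f = m g)"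
  proof (rule commuting_mean_exists[of "(1, 1)"])
    show "(1, 1) \<in> S" by (simp add: S_def okdet_1)
    show "T i (T j x) = T j (T i x)" for i j x by (simp add: T_def mult_ac)
  qed (rule TS)
  then obtain mT :: "('k \<times> 'k \<Rightarrow> real) \<Rightarrow> real" where T: "is_mean mT" "\<And>p f. bddf f \<Longrightarrow> mT (\<lambda>q. f (T p q)) = mT f"
    "\<And>f g. (\<And>q. q \<in> S \<Longrightarrow> f q = g q) \<Longrightarrow> mT f = mT g"
    by blast
  define h where "h = (\<lambda>(f :: 'k mat \<Rightarrow> real) q. mU (\<lambda>u. f (Mt (fst q) (fst q * u) 0 (snd q))))"
  define m where "m = (\<lambda>f. mT (h f))"
  have bh: "bddf (h f)" if "bddf f" for f
  proof -
    obtain C where C: "\<And>x. \<bar>f x\<bar> \<le> C" using \<open>bddf f\<close> by (auto simp: bddf_def)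
    show ?thesis unfolding h_def by (rule bddf_I[of _ C], rule is_meanD(3)[OF U(1)]) (rule C)
  qed
  show ?thesis
  proof (intro exI[of _ m] conjI allI impI)
    show "is_mean m" unfolding is_mean_def
    proof (intro conjI allI impI)
      fix f g :: "'k mat \<Rightarrow> real" assume fg: "bddf f" "bddf g"
      have "h (\<lambda>x. f x + g x) = (\<lambda>q. h f q + h g q)" unfolding h_def
        by (rule ext, rule is_meanD(1)[OF U(1)]) (rule bddf_comp[OF fg(1)], rule bddf_comp[OF fg(2)])
      then show "m (\<lambda>x. f x + g x) = m f + m g" unfolding m_def using is_meanD(1)[OF T(1) bh bh] fg by simp
    next
      fix f :: "'k mat \<Rightarrow> real" and c assume f: "bddf f"
      have "h (\<lambda>x. c * f x) = (\<lambda>q. c * h f q)" unfolding h_def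
        by (rule ext, rule is_meanD(2)[OF U(1)]) (rule bddf_comp[OF f])
      then show "m (\<lambda>x. c * f x) = c * m f" unfolding m_def using is_meanD(2)[OF T(1) bh] f by simp
    next
      fix f :: "'k mat \<Rightarrow> real" and C assume f: "\<forall>x. \<bar>f x\<bar> \<le> C"
      show "\<bar>m f\<bar> \<le> C" unfolding m_def h_def
        by (rule is_meanD(3)[OF T(1)], rule is_meanD(3)[OF U(1)]) (use f in blast)
    next
      fix c show "m (\<lambda>_. c) = c" unfolding m_def h_def by (simp add: is_meanD(4)[OF U(1)] is_meanD(4)[OF T(1)])
    qed
    show "m f = c" if fc: "\<forall>x. m21 x = 0 \<longrightarrow> f x = c" for f c
    proof -
      have "mT (h f) = mT (\<lambda>_. c)"
      proof (rule T(3))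
        fix q assume "q \<in> S"
        then have "m21 (Mt (fst q) (fst q * u) 0 (snd q)) = 0" for u by (simp add: S_def Mt_sel case_prod_beta)
        then have "f (Mt (fst q) (fst q * u) 0 (snd q)) = c" for u using fc by blast
        then show "h f q = c" unfolding h_def by (simp add: is_meanD(4)[OF U(1)])
      qed
      then show ?thesis by (simp add: m_def is_meanD(4)[OF T(1)])
    qed
    show "m (\<lambda>x. f (b + x)) = m f" if b: "m21 b = 0" and f: "bddf f" for b f
    proof -
      let ?p = "(m11 b, m22 b)"
      have p: "?p \<in> S" using okdet_mat[of b] b by (simp add: S_def)
      have "h (\<lambda>x. f (b + x)) q = h f (T ?p q)" if q: "q \<in> S" for q
      proof -
        have ok: "okdet (fst q * snd q)" using q by (auto simp: S_def)
        have nz: "fst q \<noteq> 0" "m11 b \<noteq> 0" using okdet_0[OF ok] det_nz[of b] b by auto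
        have ok2: "okdet ((m11 b * fst q) * (m22 b * snd q))" using TS[OF q, of ?p] p by (simp add: T_def S_def)
        \<comment> \<open>In the coordinates diag(p, q) times a unipotent matrix with entry u, left
          multiplication by \<open>b\<close> multiplies the diagonal part and shifts u by this
          amount, which depends on the diagonal part but not on u.\<close>
        let ?v = "m12 b * snd q / (m11 b * fst q)"
        have "b + Mt (fst q) (fst q * u) 0 (snd q) = Mt (m11 b * fst q) ((m11 b * fst q) * (u + ?v)) 0 (m22 b * snd q)" for u
          by (rule mat_eqI) (use b ok ok2 nz in \<open>simp_all add: sel_plus_mat Mt_sel distrib_left\<close>)
        then have "h (\<lambda>x. f (b + x)) q = mU (\<lambda>u. f (Mt (m11 b * fst q) ((m11 b * fst q) * (u + ?v)) 0 (m22 b * snd q)))"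
          by (simp add: h_def)
        also have "\<dots> = mU (\<lambda>u. f (Mt (m11 b * fst q) ((m11 b * fst q) * u) 0 (m22 b * snd q)))"
          by (rule U(2)[of "\<lambda>u. f (Mt (m11 b * fst q) ((m11 b * fst q) * u) 0 (m22 b * snd q))", OF bddf_comp[OF f]])
        also have "\<dots> = h f (T ?p q)" using p by (simp add: h_def T_def)
        finally show ?thesis .
      qed
      then have "m (\<lambda>x. f (b + x)) = mT (\<lambda>q. h f (T ?p q))" unfolding m_def by (intro T(3))
      also have "\<dots> = m f" unfolding m_def by (rule T(2)[OF bh[OF f]])
      finally show ?thesis .
    qed
  qed
qed

section \<open>Detecting classes by averaging over a Borel subgroup\<close>

text \<open>Right factors from \<open>B\<close> are absorbed by the mean, so averaged cochains
  descend to tuples of cosets; for the Borel subgroup these are tuples of points.\<close>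

lemma imean_right_inv:
  assumes m: "is_mean m" and inv: "\<And>b f. b \<in> B \<Longrightarrow> bddf f \<Longrightarrow> m (\<lambda>x. f (b + x)) = m f"
    and "bddf F" "length l = length bs" "set bs \<subseteq> B"
  shows "imean m (map2 (+) l bs) F = imean m l F"
  using assms(4,3,5)
proof (induction l bs arbitrary: F rule: list_induct2)
  case (Cons g l b bs)
  obtain C where C: "\<And>x. \<bar>F x\<bar> \<le> C" using Cons.prems by (auto simp: bddf_def)
  have IH: "imean m (map2 (+) l bs) (\<lambda>l. F (z # l)) = imean m l (\<lambda>l. F (z # l))" for z
    by (rule Cons.IH) (use Cons.prems bddf_comp[of F "\<lambda>l. z # l"] in auto)
  have "bddf (\<lambda>x. imean m l (\<lambda>l. F ((g + x) # l)))"
    by (rule bddf_I[of _ C], rule imean_le[OF m]) (rule C)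
  then have "m (\<lambda>x. imean m l (\<lambda>l. F ((g + (b + x)) # l))) = m (\<lambda>x. imean m l (\<lambda>l. F ((g + x) # l)))"
    using inv[of b "\<lambda>x. imean m l (\<lambda>l. F ((g + x) # l))"] Cons.prems by simp
  then show ?case by (simp add: IH add.assoc)
qed simp

definition par :: "'k::detfield mat list \<Rightarrow> 'k mat list \<Rightarrow> bool" where
  "par l l' \<longleftrightarrow> list_all2 (\<lambda>x y. cdet x y = 0) l l'"

lemma m21_diff: "m21 (- x + y) = 0 \<longleftrightarrow> cdet x y = 0"
proof -
  have "m21 (- x + y) = inverse (m11 x * m22 x - m12 x * m21 x) * cdet x y"
    by (simp add: sel_plus_mat sel_uminus_mat cdet_def algebra_simps)
  then show ?thesis using det_nz[of x] by simp
qed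

locale borel_mean =
  fixes m :: "('k::{detfield, countable} mat \<Rightarrow> real) \<Rightarrow> real"
  assumes mean: "is_mean m" and left_inv: "\<And>b f. m21 b = 0 \<Longrightarrow> bddf f \<Longrightarrow> m (\<lambda>x. f (b + x)) = m f"
    and conc: "\<And>f c. (\<And>x. m21 x = 0 \<Longrightarrow> f x = c) \<Longrightarrow> m f = c"
begin

text \<open>By \<open>m21_diff\<close>, two matrices give the same point exactly when they differ by
  a right Borel factor. Together with the invariance of \<open>F\<close>, its average depends only
  on the orbit of the tuple of points.\<close>

lemma imean_orbit:
  assumes F: "translation_inv F" "bddf F" and l: "par (map ((+) g) l) l'"
  shows "imean m l' F = imean m l F"
proof -
  let ?bs = "map2 (\<lambda>x y. - (g + x) + y) l l'"
  have len: "length l = length l'" using l by (auto simp: par_def dest: list_all2_lengthD)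
  have "map2 (+) (map ((+) g) l) ?bs = l'"
    using len by (intro nth_equalityI) (auto simp: add.assoc[symmetric])
  moreover have "set ?bs \<subseteq> {b. m21 b = 0}"
    using l len by (auto simp: par_def list_all2_conv_all_nth set_zip m21_diff)
  ultimately have "imean m l' F = imean m (map ((+) g) l) F"
    using imean_right_inv[OF mean, of "{b. m21 b = 0}" F "map ((+) g) l" ?bs] left_inv F(2) len by simp
  then show ?thesis using imean_inv[OF F(1)] by simp
qed

lemma imean_columns:
  assumes "\<And>l l'. par l l' \<Longrightarrow> F l = F l'" shows "imean m gs F = F gs"
  using assms
proof (induction gs arbitrary: F)
  case (Cons g gs)
  have refl: "par l l" for l :: "'k mat list" by (simp add: par_def list_all2_refl)
  have 1: "imean m gs (\<lambda>l. F (z # l)) = F (z # gs)" for z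
    by (rule Cons.IH) (rule Cons.prems, simp add: par_def)
  have "F ((g + x) # gs) = F (g # gs)" if "m21 x = 0" for x
    by (rule Cons.prems) (use that refl[of gs] in \<open>simp add: par_def cdet_def sel_plus_mat algebra_simps\<close>)
  then have "m (\<lambda>x. F ((g + x) # gs)) = F (g # gs)" by (rule conc)
  then show ?case by (simp add: 1)
qed simp

text \<open>If all faces of \<open>T\<close> and \<open>T'\<close> have the averages of one tuple
  \<open>R\<close>, then coboundaries average to the same value over \<open>T\<close> and
  \<open>T'\<close>, and the difference of the two averages kills them. A cochain that depends on
  points only is not changed by averaging, so there the difference is
  \<open>c T - c T'\<close>.\<close>

lemma detects_by_mean:
  assumes len: "length T = n + 1" "length T' = n + 1" and c: "\<And>l l'. par l l' \<Longrightarrow> c l = c l'" "c T \<noteq> c T'"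
    and faces: "\<And>\<beta> i. translation_inv \<beta> \<Longrightarrow> bddf \<beta> \<Longrightarrow> i \<le> n \<Longrightarrow> imean m (del i T) \<beta> = imean m R \<beta>"
      "\<And>\<beta> i. translation_inv \<beta> \<Longrightarrow> bddf \<beta> \<Longrightarrow> i \<le> n \<Longrightarrow> imean m (del i T') \<beta> = imean m R \<beta>"
  shows "detects n (\<lambda>f. imean m T f - imean m T' f) c"
  unfolding detects_def
proof (intro conjI allI impI)
  fix f g :: "'k mat list \<Rightarrow> real" assume "\<forall>l. length l = n + 1 \<longrightarrow> f l = g l"
  then have "imean m T f = imean m T g" "imean m T' f = imean m T' g" using len by (auto intro!: imean_cong)
  then show "imean m T f - imean m T' f = imean m T g - imean m T' g" by simp
next
  show "\<exists>K. \<forall>f C. (\<forall>l. \<bar>f l\<bar> \<le> C) \<longrightarrow> \<bar>imean m T f - imean m T' f\<bar> \<le> K * C"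
  proof (intro exI[of _ 2] allI impI)
    fix f :: "'k mat list \<Rightarrow> real" and C assume "\<forall>l. \<bar>f l\<bar> \<le> C"
    then have "\<bar>imean m T f\<bar> \<le> C" "\<bar>imean m T' f\<bar> \<le> C" using imean_le[OF mean] by blast+
    then show "\<bar>imean m T f - imean m T' f\<bar> \<le> 2 * C" by linarith
  qed
next
  fix f :: "'k mat list \<Rightarrow> real" assume f: "translation_inv f" "bddf f"
  have "imean m T (cobd f) = (\<Sum>i<n+1. (-1) ^ i * imean m R f)"
    unfolding imean_cobd[OF mean f(2)] cobd_sum len by (rule sum.cong) (use faces(1)[OF f] in auto)
  moreover have "imean m T' (cobd f) = (\<Sum>i<n+1. (-1) ^ i * imean m R f)"
    unfolding imean_cobd[OF mean f(2)] cobd_sum len by (rule sum.cong) (use faces(2)[OF f] in auto)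
  ultimately show "imean m T (cobd f) - imean m T' (cobd f) = 0" by simp
next
  show "imean m T c - imean m T' c \<noteq> 0" using c(2) imean_columns[of c] c(1) by simp
qed (auto simp: imean_add[OF mean] imean_cmult[OF mean] algebra_simps)

end

lemma ex_borel_mean: "\<exists>m :: ('k::{detfield, countable} mat \<Rightarrow> real) \<Rightarrow> real. borel_mean m"
proof -
  obtain m :: "('k mat \<Rightarrow> real) \<Rightarrow> real" where m: "is_mean m"
    "\<forall>b f. m21 b = 0 \<longrightarrow> bddf f \<longrightarrow> m (\<lambda>x. f (b + x)) = m f"
    "\<forall>f c. (\<forall>x. m21 x = 0 \<longrightarrow> f x = c) \<longrightarrow> m f = c"
    using borel_mean_exists by blast
  have "borel_mean m" by (rule borel_mean.intro) (use m in blast)+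
  then show ?thesis by blast
qed

lemma detects_not_coboundary: assumes "detects n \<mu> c" shows "\<not> coboundary n c"
proof
  assume "coboundary n c"
  then obtain B where B: "translation_inv B" "bddf B" "\<And>xs. length xs = n + 1 \<Longrightarrow> c xs = cobd B xs"
    by (auto simp: coboundary_def)
  then have "\<mu> c = \<mu> (cobd B)" "\<mu> (cobd B) = 0" using assms unfolding detects_def by blast+
  then show False using assms by (simp add: detects_def)
qed

section \<open>A bounded class of degree two: the orientation cocycle\<close>

instantiation rat :: detfield
begin
definition okdet_rat :: "rat \<Rightarrow> bool" where "okdet_rat x \<longleftrightarrow> x > 0"
instance by standard (auto simp: okdet_rat_def)
end

text \<open>The cyclic orientation of three points of the rational projective line. Each vector
  occurs in two brackets, so rescaling it, even by a negative factor, does not change the product of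
  signs.\<close>

fun orient :: "rat mat list \<Rightarrow> real" where
  "orient [x, y, z] = real_of_rat (sgn (cdet x y) * sgn (cdet y z) * sgn (cdet z x))"
| "orient _ = 0"

lemma plucker: "cdet x y * cdet z w - cdet x z * cdet y w + cdet x w * cdet y z = 0"
  by (simp add: cdet_def algebra_simps)

lemma orient_par: assumes "par l l'" shows "orient l = orient l'"
proof (cases l rule: orient.cases)
  case (1 x y z)
  then obtain x' y' z' where l': "l' = [x', y', z']" "cdet x x' = 0" "cdet y y' = 0" "cdet z z' = 0"
    using assms by (auto simp: par_def list_all2_Cons1)
  obtain a where a: "a \<noteq> 0" "m11 x' = a * m11 x" "m21 x' = a * m21 x" using cdet_0E[OF l'(2)] by blast
  obtain b where b: "b \<noteq> 0" "m11 y' = b * m11 y" "m21 y' = b * m21 y" using cdet_0E[OF l'(3)] by blast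
  obtain c where c: "c \<noteq> 0" "m11 z' = c * m11 z" "m21 z' = c * m21 z" using cdet_0E[OF l'(4)] by blast
  have e: "cdet x' y' = (a * b) * cdet x y" "cdet y' z' = (b * c) * cdet y z" "cdet z' x' = (c * a) * cdet z x"
    using a b c by (simp_all add: cdet_def algebra_simps)
  have s: "sgn a * sgn a = 1" "sgn b * sgn b = 1" "sgn c * sgn c = 1" using a b c by (auto simp: sgn_if)
  have "sgn (cdet x' y') * sgn (cdet y' z') * sgn (cdet z' x')
    = (sgn a * sgn a) * (sgn b * sgn b) * (sgn c * sgn c) * (sgn (cdet x y) * sgn (cdet y z) * sgn (cdet z x))"
    unfolding e sgn_mult by (simp only: mult_ac)
  then show ?thesis using 1 l' s by simp
qed (use assms in \<open>auto simp: par_def list_all2_Cons1\<close>)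

text \<open>Coincident points are handled by the alternating symmetry. For distinct points the sign
  patterns that violate the identity would make the three terms of the Plucker relation all of one
  sign, while their sum is 0.\<close>

lemma orient_cocycle_aux:
  fixes x y z w :: "rat mat"
  defines "c \<equiv> \<lambda>x y z. sgn (cdet x y) * sgn (cdet y z) * sgn (cdet z x)"
  shows "c y z w - c x z w + c x y w - c x y z = 0"
proof -
  have anti: "c y x z = - c x y z" "c x z y = - c x y z" for x y z
    by (simp_all add: c_def cdet_swap[of x y] cdet_swap[of y z] cdet_swap[of x z] sgn_minus)
  have rot: "c y z x = c x y z" for x y z by (simp add: c_def mult_ac)
  have par1: "c y u v = c x u v" if "cdet x y = 0" for x y u v
    using orient_par[of "[x, u, v]" "[y, u, v]"] that by (auto simp: par_def c_def)
  have par2: "c u y v = c u x v" if "cdet x y = 0" for x y u v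
    using par1[OF that, of u v] anti(1)[of u y v] anti(1)[of u x v] by simp
  have par3: "c u v y = c u v x" if "cdet x y = 0" for x y u v
    using par1[OF that, of u v] rot by simp
  have z: "c x y u = 0" "c x u y = 0" "c u x y = 0" if "cdet x y = 0" for x y u
    using that cdet_swap[of x y] by (simp_all add: c_def)
  consider "cdet x y = 0" | "cdet x z = 0" | "cdet x w = 0" | "cdet y z = 0" | "cdet y w = 0" | "cdet z w = 0"
    | "cdet x y \<noteq> 0" "cdet x z \<noteq> 0" "cdet x w \<noteq> 0" "cdet y z \<noteq> 0" "cdet y w \<noteq> 0" "cdet z w \<noteq> 0" by blast
  then show ?thesis
  proof cases
    case 1 show ?thesis using par1[OF 1, of z w] z[OF 1] by simp
  next
    case 2 show ?thesis using par2[OF 2, of y w] z[OF 2] anti(1)[of x y w] by simp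
  next
    case 3 show ?thesis using par3[OF 3, of y z] z[OF 3] rot[of y z x] by simp
  next
    case 4 show ?thesis using par2[OF 4, of x w] z[OF 4] by simp
  next
    case 5 show ?thesis using par3[OF 5, of x z] z[OF 5] anti(2)[of x y z] by simp
  next
    case 6 show ?thesis using par3[OF 6, of x y] z[OF 6] by simp
  next
    case 7
    let ?p = "cdet x y * cdet z w" and ?q = "cdet x z * cdet y w" and ?r = "cdet x w * cdet y z"
    have sg: "sgn a = 1 \<or> sgn a = -1" if "a \<noteq> 0" for a :: rat using that by (auto simp: sgn_if)
    have "\<not> (?p > 0 \<and> ?q < 0 \<and> ?r > 0)" "\<not> (?p < 0 \<and> ?q > 0 \<and> ?r < 0)" using plucker[of x y z w] by linarith+
    then have P: "\<not> (sgn ?p = 1 \<and> sgn ?q = -1 \<and> sgn ?r = 1)" "\<not> (sgn ?p = -1 \<and> sgn ?q = 1 \<and> sgn ?r = -1)"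
      by (simp_all add: sgn_1_pos sgn_1_neg)
    show ?thesis
      using sg[OF 7(1)] sg[OF 7(2)] sg[OF 7(3)] sg[OF 7(4)] sg[OF 7(5)] sg[OF 7(6)] P
      unfolding c_def sgn_mult cdet_swap[of x z] cdet_swap[of y w] cdet_swap[of x w] cdet_swap[of z w] sgn_minus
      by (elim disjE) simp_all
  qed
qed

lemma cocycle_orient: "cocycle 2 orient"
  unfolding cocycle_def
proof (intro conjI allI impI)
  show "translation_inv orient" unfolding translation_inv_def
  proof (intro allI)
    fix g :: "rat mat" and xs
    have "sgn (m11 g * m22 g - m12 g * m21 g) = 1" using okdet_mat[of g] by (simp add: okdet_rat_def)
    then show "orient (map ((+) g) xs) = orient xs"
      by (cases xs rule: orient.cases) (auto simp: cdet_plus sgn_mult)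
  qed
  have "\<bar>orient xs\<bar> \<le> 1" for xs
  proof (cases xs rule: orient.cases)
    case (1 x y z)
    then show ?thesis by (auto simp: sgn_if)
  qed auto
  then show "bddf orient" by (rule bddf_I)
  fix xs :: "rat mat list" assume "length xs = 2 + 2"
  then obtain x y z w where xs: "xs = [x, y, z, w]" by (auto simp: numeral_eq_Suc length_Suc_conv)
  let ?c = "\<lambda>x y z. sgn (cdet x y) * sgn (cdet y z) * sgn (cdet z x)"
  have "cobd orient xs = real_of_rat (?c y z w - ?c x z w + ?c x y w - ?c x y z)"
    unfolding xs by (simp add: of_rat_diff of_rat_add)
  then show "cobd orient xs = 0" unfolding orient_cocycle_aux by simp
qed

lemma normalized_orient: "normalized orient"
  unfolding normalized_def
proof (intro allI)
  fix l x and l' :: "rat mat list"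
  show "orient (l @ [x, x] @ l') = 0"
    by (cases "l @ [x, x] @ l'" rule: orient.cases) (auto simp: append_eq_Cons_conv)
qed

text \<open>The points are infinity, 0 and 1; exchanging two of them reverses the orientation, while
  all ordered pairs of distinct points form one orbit. A pair with negative bracket is brought to
  positive determinant by negating one column, which represents the same point.\<close>

lemma ex_detects_orient: "\<exists>\<mu>. detects 2 \<mu> orient"
proof -
  obtain m :: "(rat mat \<Rightarrow> real) \<Rightarrow> real" where m: "borel_mean m" using ex_borel_mean by blast
  interpret borel_mean m by (rule m)
  define a where "a = (0 :: rat mat)"
  define b where "b = (Mt 0 (-1) 1 0 :: rat mat)"
  define c where "c = (Mt 1 0 1 1 :: rat mat)"
  have sel: "m11 a = 1" "m21 a = 0" "m11 b = 0" "m21 b = 1" "m11 c = 1" "m21 c = 1"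
    by (simp_all add: a_def b_def c_def sel_zero_mat Mt_sel okdet_rat_def)
  have pair: "imean m [x, y] \<beta> = imean m [a, b] \<beta>" if "cdet x y \<noteq> 0" "translation_inv \<beta>" "bddf \<beta>" for x y \<beta>
  proof (cases "cdet x y > 0")
    case True
    define g where "g = Mt (m11 x) (m11 y) (m21 x) (m21 y)"
    have "okdet (m11 x * m21 y - m11 y * m21 x)" using True by (simp add: okdet_rat_def cdet_def mult.commute)
    then have "par (map ((+) g) [a, b]) [x, y]"
      by (simp add: par_def g_def cdet_def sel_plus_mat sel Mt_sel)
    then show ?thesis by (rule imean_orbit[OF that(2,3)])
  next
    case False
    define g where "g = Mt (m11 x) (- m11 y) (m21 x) (- m21 y)"
    have "okdet (m11 x * (- m21 y) - (- m11 y) * m21 x)" using False that(1) by (simp add: okdet_rat_def cdet_def mult.commute)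
    then have "par (map ((+) g) [a, b]) [x, y]"
      by (simp add: par_def g_def cdet_def sel_plus_mat sel Mt_sel)
    then show ?thesis by (rule imean_orbit[OF that(2,3)])
  qed
  have nz: "cdet a b \<noteq> 0" "cdet b a \<noteq> 0" "cdet a c \<noteq> 0" "cdet b c \<noteq> 0" by (simp_all add: cdet_def sel)
  have "detects 2 (\<lambda>f. imean m [a, b, c] f - imean m [b, a, c] f) orient"
  proof (rule detects_by_mean[of _ _ _ _ "[a, b]"])
    show "orient [a, b, c] \<noteq> orient [b, a, c]" by (simp add: cdet_def sel)
    fix \<beta> :: "rat mat list \<Rightarrow> real" and i :: nat assume \<beta>: "translation_inv \<beta>" "bddf \<beta>" "i \<le> 2"
    then have i: "i = 0 \<or> i = Suc 0 \<or> i = Suc (Suc 0)" by auto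
    show "imean m (del i [a, b, c]) \<beta> = imean m [a, b] \<beta>" "imean m (del i [b, a, c]) \<beta> = imean m [a, b] \<beta>"
      using i pair[OF nz(2) \<beta>(1,2)] pair[OF nz(3) \<beta>(1,2)] pair[OF nz(4) \<beta>(1,2)]
      by (elim disjE; simp only: del_0 del_Suc)+
  qed (use orient_par in auto)
  then show ?thesis by blast
qed

section \<open>The dilogarithm on the unit circle\<close>

text \<open>The dilogarithm series; its term at n = 0 is 0 because division by 0 yields 0.\<close>

definition Li2 :: "complex \<Rightarrow> complex" where "Li2 u = suminf (\<lambda>n. (1 / of_nat n ^ 2) * u ^ n)"

lemma summable_inv_sq: "summable (\<lambda>n. 1 / real n ^ 2)"
  using inverse_power_summable[of 2, where 'a = real] by (simp add: inverse_eq_divide)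

lemma Li2_term_le: "norm (u :: complex) \<le> 1 \<Longrightarrow> norm ((1 / of_nat n ^ 2) * u ^ n) \<le> 1 / real n ^ 2"
  by (simp add: norm_mult norm_divide norm_power divide_right_mono power_le_one)

lemma summable_Li2: "norm (u :: complex) \<le> 1 \<Longrightarrow> summable (\<lambda>n. (1 / of_nat n ^ 2) * u ^ n)"
  by (rule summable_comparison_test'[OF summable_inv_sq]) (rule Li2_term_le)

lemma Li2_le: "norm u \<le> 1 \<Longrightarrow> norm (Li2 u) \<le> suminf (\<lambda>n. 1 / real n ^ 2)"
  unfolding Li2_def by (rule norm_suminf_le[OF Li2_term_le summable_inv_sq])

lemma Li2_cnj: "norm u \<le> 1 \<Longrightarrow> Li2 (cnj u) = cnj (Li2 u)"
  using sums_cnj[of "\<lambda>n. (1 / of_nat n ^ 2) * u ^ n" "Li2 u"] summable_Li2[of u]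
  by (simp add: Li2_def sums_iff summable_sums)

lemma continuous_on_Li2: "continuous_on (cball 0 1) Li2"
proof -
  have "uniform_limit (cball 0 1) (\<lambda>n u. \<Sum>k<n. (1 / of_nat k ^ 2) * u ^ k) Li2 sequentially"
    unfolding Li2_def by (rule Weierstrass_m_test[OF _ summable_inv_sq]) (use Li2_term_le in simp)
  then show ?thesis
  proof (rule uniform_limit_theorem[rotated])
    show "eventually (\<lambda>n. continuous_on (cball 0 1) (\<lambda>u::complex. \<Sum>k<n. (1 / of_nat k ^ 2) * u ^ k)) sequentially"
      by (intro always_eventually allI continuous_intros)
  qed simp
qed

text \<open>Termwise differentiation gives the series of the logarithm. The product form avoids a
  division by \<open>z\<close>, so that \<open>z = 0\<close> is covered.\<close>

lemma Li2_deriv: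
  assumes "norm z < 1"
  obtains D where "(Li2 has_field_derivative D) (at z)" "z * D = - Ln (1 - z)"
proof
  let ?c = "\<lambda>n. 1 / of_nat n ^ 2 :: complex"
  show "(Li2 has_field_derivative (suminf (\<lambda>n. diffs ?c n * z ^ n))) (at z)"
    unfolding Li2_def by (rule termdiffs_strong'[of 1]) (use assms summable_Li2[OF less_imp_le] in \<open>simp_all\<close>)
  have d: "diffs ?c n = 1 / of_nat (Suc n)" for n
    by (simp add: diffs_def power2_eq_square del: of_nat_Suc)
  have "(\<lambda>n. - (z ^ n / of_nat n)) sums Ln (1 - z)" using Ln_series'[of "- z"] assms by simp
  then have "(\<lambda>n. z ^ n / of_nat n) sums - Ln (1 - z)" using sums_minus by fastforce
  then have s: "(\<lambda>n. z ^ Suc n / of_nat (Suc n)) sums - Ln (1 - z)"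
    by (subst sums_Suc_iff) simp
  have t: "summable (\<lambda>n. diffs ?c n * z ^ n)"
    by (rule termdiff_converges[of z 1]) (use assms summable_Li2[OF less_imp_le] in \<open>simp_all\<close>)
  have "(\<lambda>n. z * (diffs ?c n * z ^ n)) sums (z * (suminf (\<lambda>n. diffs ?c n * z ^ n)))"
    by (rule sums_mult[OF summable_sums[OF t]])
  then have "(\<lambda>n. z ^ Suc n / of_nat (Suc n)) sums (z * (suminf (\<lambda>n. diffs ?c n * z ^ n)))"
    by (simp add: d field_simps del: of_nat_Suc)
  then show "z * (suminf (\<lambda>n. diffs ?c n * z ^ n)) = - Ln (1 - z)" using s sums_unique2 by blast
qed

text \<open>The Clausen function, the sum of sin(nt)/n^2.\<close>

definition Cl :: "real \<Rightarrow> real" where "Cl t = Im (Li2 (cis t))"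

lemma Cl_r_deriv:
  assumes "0 < r" "r < 1"
  shows "((\<lambda>t. Im (Li2 (of_real r * cis t))) has_real_derivative - ln (norm (1 - of_real r * cis t))) (at t)"
proof -
  let ?z = "of_real r * cis t"
  have n: "norm ?z < 1" using assms by (simp add: norm_mult)
  obtain D where D: "(Li2 has_field_derivative D) (at ?z)" "?z * D = - Ln (1 - ?z)" using Li2_deriv[OF n] by blast
  have c: "(cis has_vector_derivative \<i> * cis t) (at t)"
    unfolding cis_conv_exp
    by (rule has_vector_derivative_real_field[where f = "\<lambda>z. exp (\<i> * z)"])
       (auto intro!: derivative_eq_intros)
  have vd: "((\<lambda>t. of_real r * cis t) has_vector_derivative of_real r * (\<i> * cis t)) (at t)"
    by (rule has_vector_derivative_mult_right[OF c])
  have "((\<lambda>t. Li2 (of_real r * cis t)) has_vector_derivative (of_real r * (\<i> * cis t)) * D) (at t)"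
    using field_vector_diff_chain_at[OF vd D(1)] by (simp add: comp_def)
  then have "((\<lambda>t. Im (Li2 (of_real r * cis t))) has_vector_derivative Im ((of_real r * (\<i> * cis t)) * D)) (at t)"
    by (rule bounded_linear.has_vector_derivative[OF bounded_linear_Im])
  moreover have "(of_real r * (\<i> * cis t)) * D = \<i> * (?z * D)" by (simp add: mult_ac)
  moreover have "1 - ?z \<noteq> 0" using n by auto
  ultimately show ?thesis by (simp add: D(2) has_real_derivative_iff_has_vector_derivative Re_Ln)
qed

lemma ln_diff_le: assumes "x \<ge> c" "y \<ge> c" "c > 0" shows "\<bar>ln x - ln y\<bar> \<le> \<bar>x - y\<bar> / (c::real)"
proof -
  have 1: "ln x - ln y \<le> \<bar>x - y\<bar> / c" if "x \<ge> c" "y \<ge> c" for x y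
  proof -
    have p: "x > 0" "y > 0" using that assms by auto
    have "ln x - ln y = ln (x / y)" using p by (simp add: ln_div)
    also have "\<dots> \<le> x / y - 1" using p by (intro ln_le_minus_one) auto
    also have "\<dots> = (x - y) / y" using p by (simp add: field_simps)
    also have "\<dots> \<le> \<bar>x - y\<bar> / y" using p by (intro divide_right_mono) auto
    also have "\<dots> \<le> \<bar>x - y\<bar> / c" using p that assms by (intro divide_left_mono) auto
    finally show ?thesis .
  qed
  show ?thesis using 1[OF assms(1,2)] 1[OF assms(2,1)] by (simp add: abs_le_iff abs_minus_commute)
qed

text \<open>The power series cannot be differentiated on the unit circle itself. On circles of
  radius r < 1 the derivative is known; as r tends to 1 these derivatives converge uniformly near
  \<open>t0\<close>, because there the distance from 1 stays bounded away from 0.\<close>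

lemma Cl_deriv:
  assumes "cis t0 \<noteq> 1"
  shows "(Cl has_real_derivative - ln (norm (1 - cis t0))) (at t0)"
proof -
  define c where "c = norm (1 - cis t0) / 2"
  have c: "c > 0" using assms by (simp add: c_def)
  have "isCont (\<lambda>t. norm (1 - cis t)) t0" unfolding cis_conv_exp by (intro continuous_intros)
  then obtain d where d: "d > 0" "\<And>t. dist t t0 < d \<Longrightarrow> dist (norm (1 - cis t)) (norm (1 - cis t0)) < c"
    using c unfolding continuous_at_eps_delta by blast
  let ?S = "ball t0 d"
  have lb: "norm (1 - cis t) \<ge> c" if "t \<in> ?S" for t
  proof -
    have "dist t t0 < d" using that by (simp add: dist_commute)
    from d(2)[OF this] have "- (norm (1 - cis t) - norm (1 - cis t0)) < c" by (simp only: dist_real_def abs_less_iff)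
    then show ?thesis by (simp add: c_def)
  qed
  define r where "r = (\<lambda>n::nat. 1 - 1 / (real n + 2))"
  have r: "0 < r n" "r n < 1" "1 - r n = 1 / (real n + 2)" for n by (auto simp: r_def field_simps)
  have r0: "(\<lambda>n. 1 - r n) \<longlonglongrightarrow> 0"
  proof -
    have "(\<lambda>n. 1 / real (n + 2)) \<longlonglongrightarrow> 0" using LIMSEQ_ignore_initial_segment[OF lim_1_over_n, of 2] by simp
    then show ?thesis by (simp add: r add.commute)
  qed
  define f where "f = (\<lambda>n t. Im (Li2 (of_real (r n) * cis t)))"
  have lim: "(\<lambda>n. f n t) \<longlonglongrightarrow> Cl t" for t
  proof -
    have "(\<lambda>n. of_real (r n) * cis t) \<longlonglongrightarrow> of_real 1 * cis t"
      using tendsto_diff[OF tendsto_const[of 1] r0] by (intro tendsto_intros) simp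
    then have "(\<lambda>n. Li2 (of_real (r n) * cis t)) \<longlonglongrightarrow> Li2 (cis t)"
      by (intro continuous_on_tendsto_compose[OF continuous_on_Li2])
         (use r in \<open>auto simp: norm_mult less_imp_le intro!: always_eventually\<close>)
    then show ?thesis unfolding f_def Cl_def by (rule tendsto_Im)
  qed
  have "\<exists>g. \<forall>x\<in>?S. (\<lambda>n. f n x) \<longlonglongrightarrow> g x \<and> (g has_derivative (*) (- ln (norm (1 - cis x)))) (at x within ?S)"
  proof (rule has_derivative_sequence[of ?S f "\<lambda>n x. (*) (- ln (norm (1 - of_real (r n) * cis x)))" _ t0 "Cl t0"])
    show "(f n has_derivative (*) (- ln (norm (1 - of_real (r n) * cis x)))) (at x within ?S)" for n x
      using Cl_r_deriv[OF r(1,2)[of n], of x] unfolding f_def has_field_derivative_def by (rule has_derivative_at_withinI)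
    fix e :: real assume e: "e > 0"
    have "eventually (\<lambda>n. 1 - r n < min (c / 2) (e * c / 2)) sequentially"
      using order_tendstoD(2)[OF r0, of "min (c / 2) (e * c / 2)"] c e by simp
    then show "eventually (\<lambda>n. \<forall>x\<in>?S. \<forall>h. norm ((- ln (norm (1 - of_real (r n) * cis x))) * h - (- ln (norm (1 - cis x))) * h) \<le> e * norm h) sequentially"
    proof eventually_elim
      case (elim n)
      show ?case
      proof (intro ballI allI)
        fix x h :: real assume x: "x \<in> ?S"
        have "norm ((1 - of_real (r n) * cis x) - (1 - cis x)) = norm (of_real (1 - r n) * cis x)"
          by (simp add: algebra_simps)
        also have "\<dots> = 1 - r n" using r(2)[of n] by (simp add: norm_mult del: of_real_diff)
        finally have nd: "norm ((1 - of_real (r n) * cis x) - (1 - cis x)) = 1 - r n" .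
        have dn: "\<bar>norm (1 - of_real (r n) * cis x) - norm (1 - cis x)\<bar> \<le> 1 - r n"
          using norm_triangle_ineq3[of "1 - of_real (r n) * cis x" "1 - cis x"] nd by simp
        have "norm (1 - of_real (r n) * cis x) \<ge> c / 2" "norm (1 - cis x) \<ge> c / 2"
          using dn lb[OF x] elim c by auto
        then have "\<bar>ln (norm (1 - of_real (r n) * cis x)) - ln (norm (1 - cis x))\<bar>
            \<le> \<bar>norm (1 - of_real (r n) * cis x) - norm (1 - cis x)\<bar> / (c / 2)"
          using c by (intro ln_diff_le) auto
        also have "\<dots> \<le> (e * c / 2) / (c / 2)" using dn elim c by (intro divide_right_mono) auto
        also have "\<dots> = e" using c by simp
        finally have 1: "\<bar>ln (norm (1 - of_real (r n) * cis x)) - ln (norm (1 - cis x))\<bar> \<le> e" .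
        have "(- ln (norm (1 - of_real (r n) * cis x))) * h - (- ln (norm (1 - cis x))) * h
           = - (ln (norm (1 - of_real (r n) * cis x)) - ln (norm (1 - cis x))) * h" by (simp add: algebra_simps)
        then show "norm ((- ln (norm (1 - of_real (r n) * cis x))) * h - (- ln (norm (1 - cis x))) * h) \<le> e * norm h"
          using 1 by (simp add: abs_mult mult_right_mono)
      qed
    qed
  qed (use d lim in auto)
  then obtain g where g: "\<And>x. x \<in> ?S \<Longrightarrow> (\<lambda>n. f n x) \<longlonglongrightarrow> g x"
    "\<And>x. x \<in> ?S \<Longrightarrow> (g has_derivative (*) (- ln (norm (1 - cis x)))) (at x within ?S)" by blast
  have gC: "g x = Cl x" if "x \<in> ?S" for x using LIMSEQ_unique[OF g(1)[OF that] lim] .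
  have t0: "t0 \<in> ?S" using d by simp
  have "(g has_real_derivative - ln (norm (1 - cis t0))) (at t0)"
    using g(2)[OF t0] at_within_open[OF t0 open_ball] unfolding has_field_derivative_def by simp
  then show ?thesis
    by (rule has_field_derivative_transform_within_open[OF _ open_ball t0]) (rule gC)
qed

text \<open>The Lobachevsky function of the argument \<theta> of \<open>w\<close>:
  \<open>w / cnj w\<close> has argument 2\<theta>, so this is half the Clausen function at
  2\<theta>. It depends only on the real line spanned by \<open>w\<close>.\<close>

definition ell :: "complex \<Rightarrow> real" where "ell w = Im (Li2 (w / cnj w)) / 2"

lemma norm_div_cnj: "norm (w / cnj w) \<le> 1" by (cases "w = 0") (simp_all add: norm_divide)

lemma ell_le: "\<bar>ell w\<bar> \<le> suminf (\<lambda>n. 1 / real n ^ 2)"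
proof -
  have "\<bar>Im (Li2 (w / cnj w))\<bar> \<le> suminf (\<lambda>n. 1 / real n ^ 2)"
    using abs_Im_le_cmod Li2_le[OF norm_div_cnj] order_trans by blast
  then show ?thesis unfolding ell_def by (simp add: abs_divide)
qed

lemma ell_inverse: "ell (inverse w) = - ell w"
proof -
  have "inverse w / cnj (inverse w) = cnj (w / cnj w)" by (simp add: field_simps)
  then show ?thesis unfolding ell_def using Li2_cnj[OF norm_div_cnj[of w]] by simp
qed

lemma ell_divide_swap: "ell (b / a) = - ell (a / b)"
  using ell_inverse[of "a / b"] by (simp add: field_simps)

lemma ell_scale: "r \<noteq> 0 \<Longrightarrow> ell (of_real r * w) = ell w"
  by (simp add: ell_def)

lemma ell_minus: "ell (- w) = ell w"
  by (simp add: ell_def)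

lemma ell_0 [simp]: "ell 0 = 0"
proof -
  have "Li2 (cnj 0) = cnj (Li2 0)" by (rule Li2_cnj) simp
  then have "Im (Li2 0) = 0" by (metis complex_cnj_zero complex_cnj_cnj Reals_cnj_iff complex_is_Real_iff)
  then show ?thesis by (simp add: ell_def)
qed

lemma ell_real: assumes "Im w = 0" shows "ell w = 0"
proof (cases "w = 0")
  case False
  have w: "cnj w = w" using assms by (simp add: complex_eq_iff)
  have "Li2 (cnj 1) = cnj (Li2 1)" by (rule Li2_cnj) simp
  then have "Im (Li2 1) = 0" by (metis complex_cnj_one Reals_cnj_iff complex_is_Real_iff)
  then show ?thesis using w False by (simp add: ell_def)
qed simp

lemma ell_Cl: assumes "w \<noteq> 0" shows "ell w = Cl (2 * Im (Ln w)) / 2"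
proof -
  have "w = exp (Ln w)" "cnj w = exp (cnj (Ln w))" using assms by (simp_all add: exp_cnj[symmetric])
  then have "w / cnj w = exp (Ln w - cnj (Ln w))" by (metis exp_diff)
  also have "Ln w - cnj (Ln w) = \<i> * of_real (2 * Im (Ln w))" by (simp add: complex_eq_iff)
  finally show ?thesis by (simp add: ell_def Cl_def cis_conv_exp)
qed

lemma continuous_on_ell: "continuous_on (- {0}) ell"
proof -
  have 1: "continuous_on (- {0}) (\<lambda>w. w / cnj w)" by (intro continuous_intros) auto
  have "(\<lambda>w. w / cnj w) ` (- {0}) \<subseteq> cball 0 1" using norm_div_cnj by auto
  from continuous_on_compose2[OF continuous_on_Li2 1 this]
  show ?thesis unfolding ell_def by (intro continuous_intros) auto
qed

text \<open>The Lobachevsky function has derivative -ln |2 sin \<theta>|; here |sin \<theta>| is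
  \<open>\<bar>Im (w t)\<bar> / norm (w t)\<close> and the angular velocity is
  \<open>Im (w' / w t)\<close>.\<close>

lemma ell_deriv:
  assumes w: "(w has_vector_derivative w') (at t)" and nr: "Im (w t) \<noteq> 0"
  shows "((\<lambda>t. ell (w t)) has_real_derivative - ln (2 * \<bar>Im (w t)\<bar> / norm (w t)) * Im (w' / w t)) (at t)"
proof -
  have nz: "w t \<noteq> 0" using nr by auto
  have np: "w t \<notin> \<real>\<^sub>\<le>\<^sub>0" using nr by (auto simp: complex_nonpos_Reals_iff)
  have "((\<lambda>t. Ln (w t)) has_vector_derivative w' * inverse (w t)) (at t)"
    using field_vector_diff_chain_at[OF w has_field_derivative_Ln[OF np]] by (simp add: comp_def)
  then have "((\<lambda>t. Im (Ln (w t))) has_real_derivative Im (w' / w t)) (at t)"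
    unfolding has_real_derivative_iff_has_vector_derivative divide_inverse by (rule bounded_linear.has_vector_derivative[OF bounded_linear_Im])
  then have d1: "((\<lambda>t. 2 * Im (Ln (w t))) has_real_derivative 2 * Im (w' / w t)) (at t)"
    by (rule DERIV_cmult)
  have ci: "cis (2 * Im (Ln (w t))) = w t / cnj (w t)"
  proof -
    have "w t = exp (Ln (w t))" "cnj (w t) = exp (cnj (Ln (w t)))" using nz by (simp_all add: exp_cnj[symmetric])
    then have "w t / cnj (w t) = exp (Ln (w t) - cnj (Ln (w t)))" by (metis exp_diff)
    also have "Ln (w t) - cnj (Ln (w t)) = \<i> * of_real (2 * Im (Ln (w t)))" by (simp add: complex_eq_iff)
    finally show ?thesis by (simp add: cis_conv_exp)
  qed
  have e: "1 - w t / cnj (w t) = (cnj (w t) - w t) / cnj (w t)" using nz by (simp add: field_simps)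
  have "norm (cnj (w t) - w t) = 2 * \<bar>Im (w t)\<bar>" by (simp add: cmod_def power2_eq_square real_sqrt_mult abs_mult)
  then have n: "norm (1 - w t / cnj (w t)) = 2 * \<bar>Im (w t)\<bar> / norm (w t)" unfolding e by (simp add: norm_divide)
  have "cis (2 * Im (Ln (w t))) \<noteq> 1"
  proof
    assume "cis (2 * Im (Ln (w t))) = 1"
    then have "norm (1 - w t / cnj (w t)) = 0" unfolding ci by simp
    then show False using n nr nz by simp
  qed
  from DERIV_chain2[OF Cl_deriv[OF this] d1]
  have "((\<lambda>t. Cl (2 * Im (Ln (w t)))) has_real_derivative - ln (2 * \<bar>Im (w t)\<bar> / norm (w t)) * (2 * Im (w' / w t))) (at t)"
    unfolding ci n .
  from DERIV_cdivide[OF this, of 2]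
  have d: "((\<lambda>t. Cl (2 * Im (Ln (w t))) / 2) has_real_derivative - ln (2 * \<bar>Im (w t)\<bar> / norm (w t)) * Im (w' / w t)) (at t)"
    by simp
  have "continuous (at t) w" using w by (rule has_vector_derivative_continuous)
  then obtain \<epsilon> where \<epsilon>: "\<epsilon> > 0" "\<And>s. dist t s < \<epsilon> \<Longrightarrow> w s \<noteq> 0" using continuous_at_avoid nz by blast
  show ?thesis
    by (rule has_field_derivative_transform_within[OF d \<epsilon>(1)]) (use \<epsilon>(2) ell_Cl in \<open>auto simp: dist_commute\<close>)
qed

section \<open>The volume cocycle and its five-term relation\<close>

text \<open>For A - B + C = 0 these are the Lobachevsky functions of the angles of the triangle with
  sides A, -B, C, that is, up to orientation, the volume of the ideal tetrahedron with these
  dihedral angles. The homogeneous form treats the three opposite pairs of edges alike and needs no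
  cross ratio.\<close>

definition vol :: "complex \<Rightarrow> complex \<Rightarrow> complex \<Rightarrow> real" where
  "vol A B C = ell (A / B) + ell (B / C) + ell (C / A)"

lemma vol_scale: "k \<noteq> 0 \<Longrightarrow> vol (k * A) (k * B) (k * C) = vol A B C"
  by (simp add: vol_def)

lemma vol_swap1: "vol (- A) C B = - vol A B C"
  using ell_divide_swap[of C A] ell_divide_swap[of B A] ell_divide_swap[of B C]
  by (simp add: vol_def ell_minus)

lemma vol_swap2: "vol B A (- C) = - vol A B C"
  using ell_divide_swap[of B A] ell_divide_swap[of A C] ell_divide_swap[of C B] ell_minus[of "A / C"] ell_minus[of "C / B"]
  by (simp add: vol_def)

lemma vol_0: "vol 0 B B = 0"
  by (cases "B = 0") (simp_all add: vol_def ell_real)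

lemma vol_le: "\<bar>vol A B C\<bar> \<le> 3 * suminf (\<lambda>n. 1 / real n ^ 2)"
  using ell_le[of "A / B"] ell_le[of "B / C"] ell_le[of "C / A"] unfolding vol_def by linarith

lemma ell_quotient_deriv:
  assumes A: "(A has_vector_derivative A') (at t)" and B: "(B has_vector_derivative B') (at t)"
    and nz: "A t \<noteq> 0" "B t \<noteq> 0" and s: "Im (A t * cnj (B t)) \<noteq> 0"
  shows "((\<lambda>t. ell (A t / B t)) has_real_derivative
    - (ln (2 * \<bar>Im (A t * cnj (B t))\<bar>) - ln (norm (A t)) - ln (norm (B t))) * (Im (A' / A t) - Im (B' / B t))) (at t)"
proof -
  have d: "((\<lambda>t. A t / B t) has_vector_derivative (A' * B t - A t * B') / (B t * B t)) (at t)"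
  proof -
    have "((\<lambda>t. A t / B t) has_derivative (\<lambda>h. ((h *\<^sub>R A') * B t - A t * (h *\<^sub>R B')) / (B t * B t))) (at t)"
      by (rule has_derivative_divide') (use A B nz in \<open>auto simp: has_vector_derivative_def\<close>)
    moreover have "(\<lambda>h. ((h *\<^sub>R A') * B t - A t * (h *\<^sub>R B')) / (B t * B t)) = (\<lambda>h. h *\<^sub>R ((A' * B t - A t * B') / (B t * B t)))"
      by (auto simp: scaleR_conv_of_real diff_divide_distrib algebra_simps)
    ultimately show ?thesis by (simp add: has_vector_derivative_def)
  qed
  have im: "Im (A t / B t) = Im (A t * cnj (B t)) / (norm (B t))\<^sup>2"
    by (metis Im_divide_of_real complex_div_cnj of_real_power)
  have i0: "Im (A t / B t) \<noteq> 0" using im s nz by simp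
  have e1: "2 * \<bar>Im (A t / B t)\<bar> / norm (A t / B t) = 2 * \<bar>Im (A t * cnj (B t))\<bar> / (norm (A t) * norm (B t))"
    unfolding im using nz by (simp add: norm_divide power2_eq_square field_simps abs_divide)
  have e2: "(A' * B t - A t * B') / (B t * B t) / (A t / B t) = A' / A t - B' / B t"
    using nz by (simp add: field_simps)
  have "ln (2 * \<bar>Im (A t * cnj (B t))\<bar> / (norm (A t) * norm (B t))) = ln (2 * \<bar>Im (A t * cnj (B t))\<bar>) - ln (norm (A t)) - ln (norm (B t))"
    using s nz by (simp add: ln_div ln_mult)
  then show ?thesis using ell_deriv[OF d i0] unfolding e1 e2 by simp
qed

text \<open>Each logarithm of a sine splits into an area term and the logarithms of two side
  lengths. As A - B + C = 0, the area term is the same for all three quotients, and it cancels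
  because the differences of angular velocities add up to 0. For triangles degenerate at all times
  the volume vanishes identically and the three angular velocities agree.\<close>

lemma vol_deriv:
  assumes A: "(A has_vector_derivative A') (at t)" and B: "(B has_vector_derivative B') (at t)"
    and C: "(C has_vector_derivative C') (at t)" and eq: "\<And>t. A t - B t + C t = 0"
    and nz: "A t \<noteq> 0" "B t \<noteq> 0" "C t \<noteq> 0"
    and s: "Im (A t * cnj (B t)) \<noteq> 0 \<or> (\<forall>t. Im (A t * cnj (B t)) = 0)"
  shows "((\<lambda>t. vol (A t) (B t) (C t)) has_real_derivative
    - (Im (A' / A t) * (ln (norm (C t)) - ln (norm (B t))) + Im (B' / B t) * (ln (norm (A t)) - ln (norm (C t)))
      + Im (C' / C t) * (ln (norm (B t)) - ln (norm (A t))))) (at t)"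
proof -
  have CB: "C t = B t - A t" for t using eq[of t] by (simp add: algebra_simps)
  have s2: "Im (B t * cnj (C t)) = Im (A t * cnj (B t))" and s3: "Im (C t * cnj (A t)) = - Im (A t * cnj (B t))" for t
    unfolding CB by (simp_all add: algebra_simps)
  show ?thesis
  proof (cases "Im (A t * cnj (B t)) = 0")
    case False
    have "((\<lambda>t. vol (A t) (B t) (C t)) has_real_derivative
      - (ln (2 * \<bar>Im (A t * cnj (B t))\<bar>) - ln (norm (A t)) - ln (norm (B t))) * (Im (A' / A t) - Im (B' / B t))
      + - (ln (2 * \<bar>Im (B t * cnj (C t))\<bar>) - ln (norm (B t)) - ln (norm (C t))) * (Im (B' / B t) - Im (C' / C t))
      + - (ln (2 * \<bar>Im (C t * cnj (A t))\<bar>) - ln (norm (C t)) - ln (norm (A t))) * (Im (C' / C t) - Im (A' / A t))) (at t)"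
      unfolding vol_def
      by (intro DERIV_add ell_quotient_deriv A B C nz) (use False s2 s3 in auto)
    then have "((\<lambda>t. vol (A t) (B t) (C t)) has_real_derivative
      - (ln (2 * \<bar>Im (A t * cnj (B t))\<bar>) - ln (norm (A t)) - ln (norm (B t))) * (Im (A' / A t) - Im (B' / B t))
      + - (ln (2 * \<bar>Im (A t * cnj (B t))\<bar>) - ln (norm (B t)) - ln (norm (C t))) * (Im (B' / B t) - Im (C' / C t))
      + - (ln (2 * \<bar>Im (A t * cnj (B t))\<bar>) - ln (norm (C t)) - ln (norm (A t))) * (Im (C' / C t) - Im (A' / A t))) (at t)"
      unfolding s2 s3 abs_minus_cancel .
    moreover have "- (L - x - y) * (p - q) + - (L - y - z) * (q - r) + - (L - z - x) * (r - p)
      = - (p * (z - y) + q * (x - z) + r * (y - x))" for L x y z p q r :: real by (simp add: algebra_simps)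
    ultimately show ?thesis by (rule DERIV_cong)
  next
    case True
    then have z: "\<And>t. Im (A t * cnj (B t)) = 0" using s by blast
    have imq: "Im (P / Q) = 0" if "Im (P * cnj Q) = 0" for P Q :: complex
      using that by (metis Im_divide_of_real complex_div_cnj of_real_power divide_eq_0_iff)
    have "vol (A t) (B t) (C t) = 0" for t
      unfolding vol_def using z s2 s3 by (simp add: ell_real imq)
    then have d0: "((\<lambda>t. vol (A t) (B t) (C t)) has_real_derivative 0) (at t)" by simp
    have par: "Im (P' / P t) = Im (Q' / Q t)" if P: "(P has_vector_derivative P') (at t)" and Q: "(Q has_vector_derivative Q') (at t)"
        and nz: "P t \<noteq> 0" "Q t \<noteq> 0" and z: "\<And>t. Im (P t * cnj (Q t)) = 0" for P Q P' Q'
    proof -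
      have "((\<lambda>t. Im (P t * cnj (Q t))) has_vector_derivative Im (P t * cnj Q' + P' * cnj (Q t))) (at t)"
        by (intro bounded_linear.has_vector_derivative[OF bounded_linear_Im] has_vector_derivative_mult P
              bounded_linear.has_vector_derivative[OF bounded_linear_cnj] Q)
      moreover have "((\<lambda>t. Im (P t * cnj (Q t))) has_vector_derivative 0) (at t)" unfolding z by simp
      ultimately have 0: "Im (P t * cnj Q' + P' * cnj (Q t)) = 0" by (rule vector_derivative_unique_at)
      obtain r where r: "P t * cnj (Q t) = of_real r" using z[of t] by (metis complex_is_Real_iff Reals_cases)
      have r0: "r \<noteq> 0" using r nz by (metis complex_cnj_zero_iff mult_eq_0_iff of_real_0)
      have e1: "P t * cnj Q' = of_real r * cnj (Q' / Q t)" unfolding r[symmetric] using nz by simp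
      have e2: "P' * cnj (Q t) = of_real r * (P' / P t)" unfolding r[symmetric] using nz by simp
      have "Im (of_real r * cnj q + of_real r * p) = r * (Im p - Im q)" for p q by (simp add: algebra_simps)
      then have "r * (Im (P' / P t) - Im (Q' / Q t)) = 0" using 0 unfolding e1 e2 by (simp only:)
      then show ?thesis using r0 by simp
    qed
    have "Im (A' / A t) = Im (B' / B t)" by (rule par[OF A B nz(1,2) z])
    moreover have "Im (B' / B t) = Im (C' / C t)" by (rule par[OF B C nz(2,3)]) (unfold s2, rule z)
    ultimately show ?thesis using d0 by (simp add: algebra_simps)
  qed
qed

text \<open>Applied to areas along a straight path: a triangle is degenerate throughout or at
  finitely many times, which is the alternative that \<open>vol_deriv\<close> needs off a finite
  set.\<close>

lemma quadratic_zeros: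
  fixes f :: "real \<Rightarrow> real"
  assumes "\<And>t. f t = p * t\<^sup>2 + q * t + r"
  shows "(\<forall>t. f t = 0) \<or> finite {t. f t = 0}"
proof (cases "[:r, q, p:] = 0")
  case True then show ?thesis using assms by simp
next
  case False
  have "f t = poly [:r, q, p:] t" for t using assms by (simp add: algebra_simps power2_eq_square)
  then show ?thesis using poly_roots_finite[OF False] by simp
qed

text \<open>Move \<open>a\<close> along the segment from 0: the sum is continuous, has derivative 0
  off finitely many times, and vanishes at the start. Minimality of the norm of \<open>a\<close>
  keeps the segment away from \<open>b\<close> and \<open>c\<close>.\<close>

lemma five_term_min:
  fixes a b c :: complex
  assumes nz: "a \<noteq> 0" "b \<noteq> 0" "c \<noteq> 0" and ne: "a \<noteq> b" "a \<noteq> c" "b \<noteq> c" and mn: "norm a \<le> norm b" "norm a \<le> norm c"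
  shows "vol (a * (b - c)) (b * (a - c)) (c * (a - b)) - vol (b - c) (a - c) (a - b)
    + vol (b - c) (- c) (- b) - vol (a - c) (- c) (- a) + vol (a - b) (- b) (- a) = 0"
proof -
  define z where "z = (\<lambda>t::real. of_real t * a)"
  have zne: "z t \<noteq> u" if t: "0 \<le> t" "t \<le> 1" and u: "u \<noteq> a" "u \<noteq> 0" "norm a \<le> norm u" for t u
  proof
    assume e: "z t = u"
    then have n: "t * norm a = norm u" using t by (auto simp: z_def norm_mult)
    then have "t * norm a \<ge> 1 * norm a" using u by simp
    then have "t \<ge> 1" using nz by (simp add: mult_le_cancel_right)
    then have "t = 1" using t by simp
    then show False using e u by (simp add: z_def)
  qed
  have zb: "z t - b \<noteq> 0" and zc: "z t - c \<noteq> 0" if "t \<in> {0..1}" for t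
    using zne[of t b] zne[of t c] that nz ne mn by auto
  have dz: "((\<lambda>t. z t) has_vector_derivative a) (at t)" for t
    unfolding z_def by (auto intro!: derivative_eq_intros simp: has_vector_derivative_def scaleR_conv_of_real)
  define V1 where "V1 = (\<lambda>t. vol (z t * (b - c)) (b * (z t - c)) (c * (z t - b)))"
  define V2 where "V2 = (\<lambda>t. vol (b - c) (z t - c) (z t - b))"
  define V4 where "V4 = (\<lambda>t. vol (z t - c) (- c) (- z t))"
  define V5 where "V5 = (\<lambda>t. vol (z t - b) (- b) (- z t))"
  define V3 where "V3 = vol (b - c) (- c) (- b)"
  \<comment> \<open>For \<open>t > 0\<close> the point \<open>z t\<close> may be replaced by \<open>a\<close> wherever it occurs as a factor; this extends the
    sum continuously to \<open>t = 0\<close>.\<close>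
  define E where "E = (\<lambda>t. (ell (a * (b - c) / (b * (z t - c))) + ell (b * (z t - c) / (c * (z t - b))) + ell (c * (z t - b) / (a * (b - c))))
    - (ell ((b - c) / (z t - c)) + ell ((z t - c) / (z t - b)) + ell ((z t - b) / (b - c)))
    + V3 - (ell ((z t - c) / (- c)) + ell (- c / (- a)) + ell (- a / (z t - c)))
    + (ell ((z t - b) / (- b)) + ell (- b / (- a)) + ell (- a / (z t - b))))"
  have EV: "E t = V1 t - V2 t + V3 - V4 t + V5 t" if "t > 0" for t
  proof -
    have t0: "t \<noteq> 0" using that by simp
    have 1: "ell (z t * u / v) = ell (a * u / v)" for u v
      using ell_scale[OF t0, of "a * u / v"] by (simp add: z_def mult_ac)
    have 2: "ell (v / (z t * u)) = ell (v / (a * u))" for u v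
      using 1[of u v] ell_divide_swap[of v "z t * u"] ell_divide_swap[of v "a * u"] by simp
    show ?thesis unfolding E_def V1_def V2_def V4_def V5_def V3_def vol_def
      using 1[of "b - c"] 2[of _ "b - c"] 1[of 1] 2[of _ 1] by (simp add: ell_minus)
  qed
  have cell: "continuous_on {0..1} (\<lambda>t. ell (f t / g t))"
    if "continuous_on {0..1} f" "continuous_on {0..1} g" "\<And>t. t \<in> {0..1} \<Longrightarrow> f t \<noteq> 0" "\<And>t. t \<in> {0..1} \<Longrightarrow> g t \<noteq> 0"
    for f g :: "real \<Rightarrow> complex"
    by (rule continuous_on_compose2[OF continuous_on_ell]) (use that in \<open>auto intro!: continuous_intros\<close>)
  have cz: "continuous_on {0..1} z" unfolding z_def by (intro continuous_intros)
  have bc: "b - c \<noteq> 0" using ne by simp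
  have contE: "continuous_on {0..1} E" unfolding E_def
    by (intro continuous_intros cell cz) (use zb zc nz bc in auto)
  \<comment> \<open>At t = 0 the terms are real quotients, where \<open>ell\<close> vanishes, or
    cancel in pairs because \<open>ell\<close> is odd under inversion; those left from
    \<open>V2\<close> add up to \<open>V3\<close>.\<close>
  have E0: "E 0 = 0"
  proof -
    have z0: "z 0 = 0" by (simp add: z_def)
    have "ell (- c / (- a)) + ell (- a / (0 - c)) = 0" "ell (- b / (- a)) + ell (- a / (0 - b)) = 0"
      using ell_divide_swap[of a c] ell_divide_swap[of a b] by simp_all
    moreover have "ell ((0 - c) / - c) = 0" "ell ((0 - b) / - b) = 0" using nz by (simp_all add: ell_real)
    moreover have "ell ((b - c) / (0 - c)) + ell ((0 - c) / (0 - b)) + ell ((0 - b) / (b - c)) = V3"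
      by (simp add: V3_def vol_def)
    moreover have "ell (b * (0 - c) / (c * (0 - b))) = 0" using nz by (simp add: ell_real mult.commute)
    moreover have "ell (a * (b - c) / (b * (0 - c))) + ell (c * (0 - b) / (a * (b - c))) = 0"
      using ell_divide_swap[of "a * (b - c)" "c * (0 - b)"] by (simp add: mult.commute)
    ultimately show ?thesis unfolding E_def z0 by linarith
  qed
  define s1 where "s1 = (\<lambda>t. Im ((z t * (b - c)) * cnj (b * (z t - c))))"
  define s2 where "s2 = (\<lambda>t. Im ((b - c) * cnj (z t - c)))"
  define s4 where "s4 = (\<lambda>t. Im ((z t - c) * cnj (- c)))"
  define s5 where "s5 = (\<lambda>t. Im ((z t - b) * cnj (- b)))"
  define k where "k = {0, 1} \<union> (\<Union>s\<in>{s1, s2, s4, s5}. if \<forall>t. s t = 0 then {} else {t. s t = 0})"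
  have q: "(\<forall>t. s t = 0) \<or> finite {t. s t = 0}" if "s \<in> {s1, s2, s4, s5}" for s
  proof -
    have 1: "s1 t = (Im (a * (b - c) * cnj (b * a))) * t\<^sup>2 + (- Im (a * (b - c) * cnj (b * c))) * t + 0" for t
    proof -
      have "(z t * (b - c)) * cnj (b * (z t - c)) = of_real (t\<^sup>2) * (a * (b - c) * cnj (b * a)) - of_real t * (a * (b - c) * cnj (b * c))"
        by (simp add: z_def algebra_simps power2_eq_square)
      moreover have "Im (of_real u * x - of_real v * y) = Im x * u + (- Im y) * v + 0" for u v x y by simp
      ultimately show ?thesis unfolding s1_def by (simp only:)
    qed
    have 2: "s2 t = 0 * t\<^sup>2 + (Im ((b - c) * cnj a)) * t + (- Im ((b - c) * cnj c))" for t
      by (simp add: s2_def z_def algebra_simps)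
    have 4: "s4 t = 0 * t\<^sup>2 + (- Im (a * cnj c)) * t + 0" for t by (simp add: s4_def z_def algebra_simps)
    have 5: "s5 t = 0 * t\<^sup>2 + (- Im (a * cnj b)) * t + 0" for t by (simp add: s5_def z_def algebra_simps)
    show ?thesis using that quadratic_zeros[of s1, OF 1] quadratic_zeros[of s2, OF 2] quadratic_zeros[of s4, OF 4] quadratic_zeros[of s5, OF 5]
      by blast
  qed
  have fk: "finite k" unfolding k_def using q by auto
  have dE: "(E has_derivative (\<lambda>h. 0)) (at t within {0..1})" if t: "t \<in> {0..1} - k" for t
  proof -
    have t01: "t \<in> {0..1}" "t > 0" "t < 1" using t by (auto simp: k_def)
    have zt: "z t \<noteq> 0" using t01 nz by (simp add: z_def)
    have sk: "s t \<noteq> 0 \<or> (\<forall>t. s t = 0)" if "s \<in> {s1, s2, s4, s5}" for s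
    proof (cases "\<forall>t. s t = 0")
      case False
      then have "{t. s t = 0} \<subseteq> k" using that unfolding k_def by auto
      then show ?thesis using t by auto
    qed simp
    \<comment> \<open>The angular velocities of \<open>z t - c\<close> and \<open>z t - b\<close>;
      that of \<open>z t\<close> is 0 because it moves radially. The coefficients of
      \<open>Q\<close> and of \<open>R\<close>, which are sums of logarithms of distances, cancel
      separately in the five-term sum.\<close>
    define Q where "Q = Im (a / (z t - c))"
    define R where "R = Im (a / (z t - b))"
    have P: "Im (a / z t) = 0" using nz t01 by (simp add: z_def) 
    have l: "ln (norm (x * y)) = ln (norm x) + ln (norm y)" if "x \<noteq> 0" "y \<noteq> 0" for x y :: complex
      using that by (simp add: norm_mult ln_mult)
    have nn: "z t - b \<noteq> 0" "z t - c \<noteq> 0" using zb[OF t01(1)] zc[OF t01(1)] by auto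
    have d1: "(V1 has_real_derivative - (Q * (ln (norm (z t)) + ln (norm (b - c)) - ln (norm c) - ln (norm (z t - b)))
        + R * (ln (norm b) + ln (norm (z t - c)) - ln (norm (z t)) - ln (norm (b - c))))) (at t)"
    proof -
      have D0: "(V1 has_real_derivative - (Im (a * (b - c) / (z t * (b - c))) * (ln (norm (c * (z t - b))) - ln (norm (b * (z t - c))))
         + Im (b * a / (b * (z t - c))) * (ln (norm (z t * (b - c))) - ln (norm (c * (z t - b))))
         + Im (c * a / (c * (z t - b))) * (ln (norm (b * (z t - c))) - ln (norm (z t * (b - c)))))) (at t)"
        unfolding V1_def
      proof (rule vol_deriv)
        show "((\<lambda>t. z t * (b - c)) has_vector_derivative a * (b - c)) (at t)" by (rule has_vector_derivative_mult_left[OF dz])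
        show "((\<lambda>t. b * (z t - c)) has_vector_derivative b * a) (at t)"
          using has_vector_derivative_mult_right[OF has_vector_derivative_diff[OF dz has_vector_derivative_const[of c]], of b] by simp
        show "((\<lambda>t. c * (z t - b)) has_vector_derivative c * a) (at t)"
          using has_vector_derivative_mult_right[OF has_vector_derivative_diff[OF dz has_vector_derivative_const[of b]], of c] by simp
        show "Im (z t * (b - c) * cnj (b * (z t - c))) \<noteq> 0 \<or> (\<forall>t. Im (z t * (b - c) * cnj (b * (z t - c))) = 0)"
          using sk[of s1] by (simp only: s1_def) simp
      qed (use nz nn bc zt in \<open>auto simp: algebra_simps\<close>)
      have i: "Im (a * (b - c) / (z t * (b - c))) = 0" "Im (b * a / (b * (z t - c))) = Q" "Im (c * a / (c * (z t - b))) = R"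
        using P bc nz by (simp_all add: Q_def R_def)
      have ll: "ln (norm (z t * (b - c))) = ln (norm (z t)) + ln (norm (b - c))"
        "ln (norm (c * (z t - b))) = ln (norm c) + ln (norm (z t - b))"
        "ln (norm (b * (z t - c))) = ln (norm b) + ln (norm (z t - c))"
        by (rule l; use nz nn bc zt in simp)+
      show ?thesis by (rule DERIV_cong[OF D0], simp only: i ll, simp add: algebra_simps)
    qed
    have d2: "(V2 has_real_derivative - (Q * (ln (norm (b - c)) - ln (norm (z t - b))) + R * (ln (norm (z t - c)) - ln (norm (b - c))))) (at t)"
    proof -
      have "(V2 has_real_derivative - (Im (0 / (b - c)) * (ln (norm (z t - b)) - ln (norm (z t - c)))
         + Im (a / (z t - c)) * (ln (norm (b - c)) - ln (norm (z t - b)))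
         + Im (a / (z t - b)) * (ln (norm (z t - c)) - ln (norm (b - c))))) (at t)"
        unfolding V2_def
      proof (rule vol_deriv)
        show "((\<lambda>t. z t - c) has_vector_derivative a) (at t)"
          using has_vector_derivative_diff[OF dz has_vector_derivative_const[of c]] by simp
        show "((\<lambda>t. z t - b) has_vector_derivative a) (at t)"
          using has_vector_derivative_diff[OF dz has_vector_derivative_const[of b]] by simp
        show "Im ((b - c) * cnj (z t - c)) \<noteq> 0 \<or> (\<forall>t. Im ((b - c) * cnj (z t - c)) = 0)"
          using sk[of s2] by (simp only: s2_def) simp
      qed (use nn bc in auto)
      then show ?thesis by (simp add: Q_def R_def)
    qed
    have d45: "((\<lambda>t. vol (z t - u) (- u) (- z t)) has_real_derivative - (Im (a / (z t - u)) * (ln (norm (z t)) - ln (norm u)))) (at t)"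
      if "u \<noteq> 0" "z t - u \<noteq> 0" "Im ((z t - u) * cnj (- u)) \<noteq> 0 \<or> (\<forall>t. Im ((z t - u) * cnj (- u)) = 0)" for u
    proof -
      have "((\<lambda>t. vol (z t - u) (- u) (- z t)) has_real_derivative - (Im (a / (z t - u)) * (ln (norm (- z t)) - ln (norm (- u)))
         + Im (0 / (- u)) * (ln (norm (z t - u)) - ln (norm (- z t)))
         + Im (- a / (- z t)) * (ln (norm (- u)) - ln (norm (z t - u))))) (at t)"
      proof (rule vol_deriv)
        show "((\<lambda>t. z t - u) has_vector_derivative a) (at t)"
          using has_vector_derivative_diff[OF dz has_vector_derivative_const[of u]] by simp
        show "((\<lambda>t. - z t) has_vector_derivative - a) (at t)" by (rule has_vector_derivative_minus[OF dz])
      qed (use that zt in auto)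
      then show ?thesis using P by simp
    qed
    have d4: "(V4 has_real_derivative - (Q * (ln (norm (z t)) - ln (norm c)))) (at t)"
      unfolding V4_def Q_def using d45[OF nz(3) nn(2)] sk[of s4] unfolding s4_def by blast
    have d5: "(V5 has_real_derivative - (R * (ln (norm (z t)) - ln (norm b)))) (at t)"
      unfolding V5_def R_def using d45[OF nz(2) nn(1)] sk[of s5] unfolding s5_def by blast
    have "((\<lambda>t. V1 t - V2 t + V3 - V4 t + V5 t) has_real_derivative 0) (at t)"
      by (rule DERIV_cong[OF DERIV_add[OF DERIV_diff[OF DERIV_add[OF DERIV_diff[OF d1 d2] DERIV_const] d4] d5]])
         (simp add: algebra_simps)
    then have "(E has_real_derivative 0) (at t)"
      by (rule has_field_derivative_transform_within_open[OF _ open_greaterThan[of 0]]) (use t01 EV in auto)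
    then have "(E has_derivative (\<lambda>h. 0)) (at t)" unfolding has_field_derivative_def by (simp add: lambda_zero)
    then show ?thesis by (rule has_derivative_at_withinI)
  qed
  have "E 1 = 0"
    by (rule has_derivative_zero_unique_strong_interval[OF fk contE E0 dE]) auto
  then show ?thesis using EV[of 1] by (simp add: V1_def V2_def V3_def V4_def V5_def z_def)
qed

section \<open>A bounded class of degree three\<close>

text \<open>The Gaussian rationals: a countable field that contains points off the real line, as is
  needed for a tetrahedron of nonzero volume.\<close>

typedef grat = "{z::complex. Re z \<in> \<rat> \<and> Im z \<in> \<rat>}" morphisms emb Abs_grat
  by (rule exI[of _ 0]) simp

setup_lifting type_definition_grat

instantiation grat :: field
begin
lift_definition zero_grat :: grat is 0 by simp
lift_definition one_grat :: grat is 1 by simp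
lift_definition plus_grat :: "grat \<Rightarrow> grat \<Rightarrow> grat" is "(+)" by simp
lift_definition minus_grat :: "grat \<Rightarrow> grat \<Rightarrow> grat" is "(-)" by simp
lift_definition uminus_grat :: "grat \<Rightarrow> grat" is "uminus" by simp
lift_definition times_grat :: "grat \<Rightarrow> grat \<Rightarrow> grat" is "(*)" by simp
lift_definition inverse_grat :: "grat \<Rightarrow> grat" is "inverse" by simp
definition divide_grat :: "grat \<Rightarrow> grat \<Rightarrow> grat" where "divide_grat x y = x * inverse y"
instance
proof
  fix a b c :: grat
  show "a * b * c = a * (b * c)" "a + b + c = a + (b + c)" by (transfer, simp add: algebra_simps)+
  show "a * b = b * a" "a + b = b + a" by (transfer, simp add: algebra_simps)+
  show "1 * a = a" "0 + a = a" "- a + a = 0" "a - b = a + - b" by (transfer, simp)+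
  show "(a + b) * c = a * c + b * c" by transfer (simp add: algebra_simps)
  show "(0::grat) \<noteq> 1" by transfer simp
  show "a \<noteq> 0 \<Longrightarrow> inverse a * a = 1" by transfer simp
  show "a div b = a * inverse b" by (simp add: divide_grat_def)
  show "inverse (0::grat) = 0" by transfer simp
qed
end

instantiation grat :: detfield
begin
definition okdet_grat :: "grat \<Rightarrow> bool" where "okdet_grat x \<longleftrightarrow> x \<noteq> 0"
instance by standard (auto simp: okdet_grat_def)
end

instance grat :: countable
proof
  have "countable ((\<lambda>(a, b). Complex a b) ` (\<rat> \<times> \<rat>))" by (intro countable_image countable_SIGMA countable_rat)
  moreover have "range emb \<subseteq> (\<lambda>(a, b). Complex a b) ` (\<rat> \<times> \<rat>)"
  proof
    fix z assume "z \<in> range emb"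
    then have "Re z \<in> \<rat>" "Im z \<in> \<rat>" using emb by auto
    then show "z \<in> (\<lambda>(a, b). Complex a b) ` (\<rat> \<times> \<rat>)" 
      using image_eqI[of z "\<lambda>(a, b). Complex a b" "(Re z, Im z)"] by simp
  qed
  ultimately have "countable (range emb)" by (rule countable_subset[rotated])
  then obtain f :: "complex \<Rightarrow> nat" where "inj_on f (range emb)" by (auto simp: countable_def)
  then have "inj (\<lambda>x. f (emb x))" by (auto simp: inj_on_def emb_inject)
  then show "\<exists>to_nat :: grat \<Rightarrow> nat. inj to_nat" by blast
qed

lemma emb_simps [simp]: "emb 0 = 0" "emb 1 = 1" "emb (x + y) = emb x + emb y" "emb (x - y) = emb x - emb y"
  "emb (- x) = - emb x" "emb (x * y) = emb x * emb y"
  by (transfer, simp)+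

lemma emb_eq_0 [simp]: "emb x = 0 \<longleftrightarrow> x = 0" by transfer simp

text \<open>The arguments are the three products in the Plucker relation, which supplies A - B + C =
  0. Every point occurs once in each product, so rescaling its vector scales all three alike and
  does not affect \<open>vol\<close>.\<close>

definition vol4 :: "grat mat \<Rightarrow> grat mat \<Rightarrow> grat mat \<Rightarrow> grat mat \<Rightarrow> real" where
  "vol4 x y z w = vol (emb (cdet x y * cdet z w)) (emb (cdet x z * cdet y w)) (emb (cdet x w * cdet y z))"

fun volc :: "grat mat list \<Rightarrow> real" where
  "volc [x, y, z, w] = vol4 x y z w"
| "volc _ = 0"

lemma vol4_par:
  assumes "cdet x x' = 0" "cdet y y' = 0" "cdet z z' = 0" "cdet w w' = 0"
  shows "vol4 x y z w = vol4 x' y' z' w'"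
proof -
  obtain a where a: "a \<noteq> 0" "m11 x' = a * m11 x" "m21 x' = a * m21 x" using cdet_0E[OF assms(1)] by blast
  obtain b where b: "b \<noteq> 0" "m11 y' = b * m11 y" "m21 y' = b * m21 y" using cdet_0E[OF assms(2)] by blast
  obtain c where c: "c \<noteq> 0" "m11 z' = c * m11 z" "m21 z' = c * m21 z" using cdet_0E[OF assms(3)] by blast
  obtain d where d: "d \<noteq> 0" "m11 w' = d * m11 w" "m21 w' = d * m21 w" using cdet_0E[OF assms(4)] by blast
  define k where "k = a * b * c * d"
  have "cdet x' y' * cdet z' w' = k * (cdet x y * cdet z w)" "cdet x' z' * cdet y' w' = k * (cdet x z * cdet y w)"
    "cdet x' w' * cdet y' z' = k * (cdet x w * cdet y z)"
    unfolding cdet_def k_def a b c d by (simp_all add: algebra_simps)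
  moreover have "emb k \<noteq> 0" using a b c d by (simp add: k_def)
  ultimately show ?thesis unfolding vol4_def using vol_scale[of "emb k"] by simp
qed

lemma vol4_anti:
  "vol4 y x z w = - vol4 x y z w" "vol4 x z y w = - vol4 x y z w" "vol4 x y w z = - vol4 x y z w"
proof -
  have "cdet y x * cdet z w = - (cdet x y * cdet z w)" by (simp add: cdet_swap[of x y])
  then show "vol4 y x z w = - vol4 x y z w" unfolding vol4_def
    using vol_swap1[of "emb (cdet x y * cdet z w)"] by (simp add: mult.commute)
  have "cdet x w * cdet z y = - (cdet x w * cdet y z)" by (simp add: cdet_swap[of y z])
  then show "vol4 x z y w = - vol4 x y z w" unfolding vol4_def
    using vol_swap2[of "emb (cdet x z * cdet y w)" _ "emb (cdet x w * cdet y z)"] by simp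
  have "cdet x y * cdet w z = - (cdet x y * cdet z w)" by (simp add: cdet_swap[of z w])
  then show "vol4 x y w z = - vol4 x y z w" unfolding vol4_def
    using vol_swap1[of "emb (cdet x y * cdet z w)"] by simp
qed

lemma vol4_zero: assumes "cdet x y = 0" shows "vol4 x y z w = 0"
proof -
  have "cdet x z * cdet y w = cdet x w * cdet y z" using plucker[of x y z w] assms by simp
  then show ?thesis unfolding vol4_def using assms by (simp add: vol_0 flip: emb_simps(6))
qed

section \<open>The five-term relation for five points of the projective line\<close>

definition dvol :: "grat mat \<Rightarrow> grat mat \<Rightarrow> grat mat \<Rightarrow> grat mat \<Rightarrow> grat mat \<Rightarrow> real" where
  "dvol p q r s u = vol4 q r s u - vol4 p r s u + vol4 p q s u - vol4 p q r u + vol4 p q r s"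

lemma dvol_anti:
  "dvol q p r s u = - dvol p q r s u" "dvol p r q s u = - dvol p q r s u"
  "dvol p q s r u = - dvol p q r s u" "dvol p q r u s = - dvol p q r s u"
  using vol4_anti(1)[of p q s u] vol4_anti(1)[of p q r u] vol4_anti(1)[of p q r s]
    vol4_anti(1)[of q r s u] vol4_anti(2)[of p q r u] vol4_anti(2)[of p q r s]
    vol4_anti(2)[of q r s u] vol4_anti(2)[of p r s u] vol4_anti(3)[of p q r s]
    vol4_anti(3)[of q r s u] vol4_anti(3)[of p r s u] vol4_anti(3)[of p q s u]
    vol4_anti(1)[of q p s u] vol4_anti(1)[of q p r u] vol4_anti(1)[of q p r s]
    vol4_anti(1)[of r q s u] vol4_anti(2)[of p r q u] vol4_anti(2)[of p r q s]
    vol4_anti(2)[of q s r u] vol4_anti(2)[of p s r u] vol4_anti(3)[of p q s r]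
    vol4_anti(3)[of q r u s] vol4_anti(3)[of p r u s] vol4_anti(3)[of p q u s]
  unfolding dvol_def by linarith+

lemma dvol_par: assumes "cdet p q = 0" shows "dvol p q r s u = 0"
proof -
  have "vol4 p r s u = vol4 q r s u" by (rule vol4_par) (use assms in auto)
  then show ?thesis using vol4_zero[OF assms] by (simp add: dvol_def)
qed

text \<open>\<open>a\<close> is the affine coordinate with \<open>p\<close> at infinity and
  \<open>q\<close> at 0. The Plucker relation expresses every bracket by coordinates up to factors
  that \<open>vol_scale\<close> removes, which leaves \<open>five_term_min\<close>.\<close>

lemma dvol_generic_min:
  fixes p q r s u :: "grat mat"
  defines "a \<equiv> \<lambda>i. - emb (cdet q i) / emb (cdet p i)"
  assumes pq: "cdet p q \<noteq> 0" and pn: "cdet p r \<noteq> 0" "cdet p s \<noteq> 0" "cdet p u \<noteq> 0"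
    and qn: "cdet q r \<noteq> 0" "cdet q s \<noteq> 0" "cdet q u \<noteq> 0" and rn: "cdet r s \<noteq> 0" "cdet r u \<noteq> 0" "cdet s u \<noteq> 0"
    and mn: "norm (a r) \<le> norm (a s)" "norm (a r) \<le> norm (a u)"
  shows "dvol p q r s u = 0"
proof -
  let ?d = "emb (cdet p q)" let ?P = "\<lambda>i. emb (cdet p i)"
  have qi: "emb (cdet q i) = - (a i * ?P i)" if "cdet p i \<noteq> 0" for i using that by (simp add: a_def)
  have ij: "emb (cdet i j) = ?P i * ?P j * (a i - a j) / ?d" if "cdet p i \<noteq> 0" "cdet p j \<noteq> 0" for i j
  proof -
    have "emb (cdet p q * cdet i j - cdet p i * cdet q j + cdet p j * cdet q i) = 0" unfolding plucker by simp
    then have "?d * emb (cdet i j) = ?P i * emb (cdet q j) - ?P j * emb (cdet q i)" by (simp add: algebra_simps)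
    also have "\<dots> = ?P i * ?P j * (a i - a j)" unfolding qi[OF that(1)] qi[OF that(2)] by (simp add: algebra_simps)
    finally show ?thesis using pq by (simp add: field_simps)
  qed
  have W1: "vol4 p q i j = vol (a i - a j) (- a j) (- a i)" if n: "cdet p i \<noteq> 0" "cdet p j \<noteq> 0" for i j
  proof -
    have k: "?P i * ?P j \<noteq> 0" using n by simp
    have "emb (cdet p q * cdet i j) = (?P i * ?P j) * (a i - a j)" using ij[OF n] pq by simp
    moreover have "emb (cdet p i * cdet q j) = (?P i * ?P j) * (- a j)" using qi[OF n(2)] by simp
    moreover have "emb (cdet p j * cdet q i) = (?P i * ?P j) * (- a i)" using qi[OF n(1)] by simp
    ultimately show ?thesis unfolding vol4_def by (simp only: vol_scale[OF k])
  qed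
  let ?k = "?P r * ?P s * ?P u / ?d"
  have k: "?k \<noteq> 0" "- ?k \<noteq> 0" using pq pn by simp_all
  have W2: "vol4 p r s u = vol (a s - a u) (a r - a u) (a r - a s)"
  proof -
    have "emb (cdet p r * cdet s u) = ?k * (a s - a u)" using ij[OF pn(2,3)] by simp
    moreover have "emb (cdet p s * cdet r u) = ?k * (a r - a u)" using ij[OF pn(1,3)] by simp
    moreover have "emb (cdet p u * cdet r s) = ?k * (a r - a s)" using ij[OF pn(1,2)] by simp
    ultimately show ?thesis unfolding vol4_def by (simp only: vol_scale[OF k(1)])
  qed
  have W3: "vol4 q r s u = vol (a r * (a s - a u)) (a s * (a r - a u)) (a u * (a r - a s))"
  proof -
    have "emb (cdet q r * cdet s u) = - ?k * (a r * (a s - a u))" using ij[OF pn(2,3)] qi[OF pn(1)] by simp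
    moreover have "emb (cdet q s * cdet r u) = - ?k * (a s * (a r - a u))" using ij[OF pn(1,3)] qi[OF pn(2)] by simp
    moreover have "emb (cdet q u * cdet r s) = - ?k * (a u * (a r - a s))" using ij[OF pn(1,2)] qi[OF pn(3)] by simp
    ultimately show ?thesis unfolding vol4_def by (simp only: vol_scale[OF k(2)])
  qed
  have "a r \<noteq> 0" "a s \<noteq> 0" "a u \<noteq> 0" using pn qn by (simp_all add: a_def)
  moreover have "a r \<noteq> a s" "a r \<noteq> a u" "a s \<noteq> a u"
    using ij[OF pn(1,2)] ij[OF pn(1,3)] ij[OF pn(2,3)] rn by (metis emb_eq_0 diff_self mult_zero_right div_0)+
  ultimately have "vol (a r * (a s - a u)) (a s * (a r - a u)) (a u * (a r - a s)) - vol (a s - a u) (a r - a u) (a r - a s)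
    + vol (a s - a u) (- a u) (- a s) - vol (a r - a u) (- a u) (- a r) + vol (a r - a s) (- a s) (- a r) = 0"
    by (rule five_term_min) (rule mn)+
  then show ?thesis unfolding dvol_def W2 W3 W1[OF pn(2,3)] W1[OF pn(1,3)] W1[OF pn(1,2)] .
qed

text \<open>The expression is alternating. Two coincident points can be moved to the front, where it
  vanishes; for distinct points, \<open>r\<close>, \<open>s\<close>, \<open>u\<close> are permuted
  until the one with the smallest coordinate comes first.\<close>

lemma dvol_0: "dvol p q r s u = 0"
proof -
  consider "cdet p q = 0" | "cdet p r = 0" | "cdet p s = 0" | "cdet p u = 0" | "cdet q r = 0" | "cdet q s = 0"
    | "cdet q u = 0" | "cdet r s = 0" | "cdet r u = 0" | "cdet s u = 0"
    | "cdet p q \<noteq> 0" "cdet p r \<noteq> 0" "cdet p s \<noteq> 0" "cdet p u \<noteq> 0" "cdet q r \<noteq> 0" "cdet q s \<noteq> 0"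
      "cdet q u \<noteq> 0" "cdet r s \<noteq> 0" "cdet r u \<noteq> 0" "cdet s u \<noteq> 0" by blast
  then show ?thesis
  proof cases
    case 1 then show ?thesis by (rule dvol_par)
  next
    case 2 show ?thesis using dvol_par[OF 2, of q s u] dvol_anti(2)[of p q r s u] by simp
  next
    case 3 show ?thesis using dvol_par[OF 3, of q r u] dvol_anti(2)[of p q s r u] dvol_anti(3)[of p q r s u] by simp
  next
    case 4 show ?thesis using dvol_par[OF 4, of q r s] dvol_anti(2)[of p q u r s] dvol_anti(3)[of p q r u s] dvol_anti(4)[of p q r s u] by simp
  next
    case 5 show ?thesis using dvol_par[OF 5, of p s u] dvol_anti(2)[of q p r s u] dvol_anti(1)[of q p r s u] by simp
  next
    case 6 show ?thesis using dvol_par[OF 6, of p r u] dvol_anti(2)[of q p s r u] dvol_anti(3)[of q p r s u] dvol_anti(1)[of q p r s u] by simp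
  next
    case 7 show ?thesis using dvol_par[OF 7, of p r s] dvol_anti(2)[of q p u r s] dvol_anti(3)[of q p r u s] dvol_anti(4)[of q p r s u] dvol_anti(1)[of q p r s u] by simp
  next
    case 8 show ?thesis using dvol_par[OF 8, of p q u] dvol_anti(2)[of r p s q u] dvol_anti(1)[of r p s q u] dvol_anti(3)[of p r q s u] dvol_anti(3)[of r p q s u] dvol_anti(1)[of r p q s u] dvol_anti(2)[of p q r s u] by simp
  next
    case 9 show ?thesis using dvol_par[OF 9, of p q s] dvol_anti(2)[of r p u q s] dvol_anti(3)[of r p q u s] dvol_anti(4)[of r p q s u] dvol_anti(1)[of r p q s u] dvol_anti(2)[of p q r s u] by simp
  next
    case 10 show ?thesis using dvol_par[OF 10, of p q r] dvol_anti(2)[of s p u q r] dvol_anti(3)[of s p q u r] dvol_anti(4)[of s p q r u] dvol_anti(1)[of s p q r u] dvol_anti(2)[of p q s r u] dvol_anti(3)[of p q r s u] by simp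
  next
    case 11
    define a where "a = (\<lambda>i. - emb (cdet q i) / emb (cdet p i))"
    have sw: "cdet s r \<noteq> 0" "cdet u r \<noteq> 0" "cdet u s \<noteq> 0" using 11 cdet_swap by (metis neg_equal_0_iff_equal)+
    consider "norm (a r) \<le> norm (a s)" "norm (a r) \<le> norm (a u)" | "norm (a s) \<le> norm (a r)" "norm (a s) \<le> norm (a u)"
      | "norm (a u) \<le> norm (a r)" "norm (a u) \<le> norm (a s)" by linarith
    then show ?thesis
    proof cases
      case 1 then show ?thesis by (intro dvol_generic_min) (use 11 in \<open>auto simp: a_def\<close>)
    next
      case 2
      then have "dvol p q s r u = 0" by (intro dvol_generic_min) (use 11 sw in \<open>auto simp: a_def\<close>)
      then show ?thesis using dvol_anti(3)[of p q r s u] by simp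
    next
      case 3
      then have "dvol p q u r s = 0" by (intro dvol_generic_min) (use 11 sw in \<open>auto simp: a_def\<close>)
      then show ?thesis using dvol_anti(3)[of p q r u s] dvol_anti(4)[of p q r s u] by simp
    qed
  qed
qed

lemma cocycle_volc: "cocycle 3 volc"
  unfolding cocycle_def
proof (intro conjI allI impI)
  show "translation_inv volc" unfolding translation_inv_def
  proof (intro allI)
    fix g :: "grat mat" and xs
    show "volc (map ((+) g) xs) = volc xs"
    proof (cases xs rule: volc.cases)
      case (1 x y z w)
      let ?k = "emb ((m11 g * m22 g - m12 g * m21 g) * (m11 g * m22 g - m12 g * m21 g))"
      have k: "?k \<noteq> 0" using det_nz[of g] by (simp only: emb_eq_0 mult_eq_0_iff) simp
      have "emb (cdet (g + x) (g + y) * cdet (g + z) (g + w)) = ?k * emb (cdet x y * cdet z w)" for x y z w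
        unfolding cdet_plus emb_simps by (simp only: mult_ac)
      then have "vol4 (g + x) (g + y) (g + z) (g + w) = vol4 x y z w"
        unfolding vol4_def by (simp only: vol_scale[OF k])
      then show ?thesis using 1 by simp
    qed auto
  qed
  have "\<bar>volc xs\<bar> \<le> 3 * suminf (\<lambda>n. 1 / real n ^ 2)" for xs
    using vol_le[of 0 0 0] by (cases xs rule: volc.cases) (auto simp: vol4_def vol_le vol_0)
  then show "bddf volc" by (rule bddf_I)
  fix xs :: "grat mat list" assume "length xs = 3 + 2"
  then obtain p q r s u where xs: "xs = [p, q, r, s, u]" by (auto simp: numeral_eq_Suc length_Suc_conv)
  show "cobd volc xs = 0" using dvol_0[of p q r s u] unfolding xs dvol_def by simp
qed

text \<open>This is Catalan's constant 1 - 1/9 + 1/25 - ... . The terms below n = 3 add up to 1, and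
  comparison of 1/n^2 with 1/((n - 1) n) telescopes to a bound of 1/2 for the rest.\<close>

lemma Im_Li2_i_pos: "Im (Li2 \<i>) > 0"
proof -
  let ?f = "\<lambda>n. Im ((1 / of_nat n ^ 2) * \<i> ^ n)"
  have s: "summable (\<lambda>n. (1 / of_nat n ^ 2) * \<i> ^ n)" by (rule summable_Li2) simp
  then have sf: "summable ?f" by (rule summable_Im)
  have "Im (Li2 \<i>) = suminf ?f" unfolding Li2_def by (rule Im_suminf[OF s])
  also have "\<dots> = suminf (\<lambda>n. ?f (n + 3)) + (\<Sum>n<3. ?f n)" by (rule suminf_split_initial_segment[OF sf])
  also have "(\<Sum>n<3. ?f n) = 1" by (simp add: numeral_eq_Suc)
  finally have e: "Im (Li2 \<i>) = suminf (\<lambda>n. ?f (n + 3)) + 1" .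
  let ?g = "\<lambda>n. 1 / (real n + 2) - 1 / (real n + 3)"
  have g: "?g sums (1 / 2)"
  proof -
    have "(\<lambda>n. 1 / (real n + 2)) \<longlonglongrightarrow> 0"
    proof -
      have "(\<lambda>n. 1 / real (n + 2)) \<longlonglongrightarrow> 0" using LIMSEQ_ignore_initial_segment[OF lim_1_over_n, of 2] by simp
      then show ?thesis by (simp add: add.commute)
    qed
    from telescope_sums'[OF this] show ?thesis by (simp add: add.commute add.left_commute)
  qed
  have le: "norm (?f (n + 3)) \<le> ?g n" for n
  proof -
    have "norm (?f (n + 3)) \<le> norm ((1 / of_nat (n + 3) ^ 2) * \<i> ^ (n + 3))"
      unfolding real_norm_def by (rule abs_Im_le_cmod)
    also have "\<dots> = 1 / (real n + 3)\<^sup>2" by (simp add: norm_mult norm_divide norm_power add.commute) (metis norm_of_nat of_nat_add of_nat_numeral norm_power)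
    also have "\<dots> \<le> 1 / ((real n + 2) * (real n + 3))"
      by (intro divide_left_mono) (auto simp: power2_eq_square intro!: mult_right_mono)
    also have "\<dots> = ?g n" by (simp add: field_simps)
    finally show ?thesis .
  qed
  have "norm (suminf (\<lambda>n. ?f (n + 3))) \<le> suminf ?g"
    by (rule norm_suminf_le[OF le sums_summable[OF g]])
  then have "\<bar>suminf (\<lambda>n. ?f (n + 3))\<bar> \<le> 1 / 2" using sums_unique[OF g] by simp
  then show ?thesis using e by linarith
qed

text \<open>The points are infinity, 0, 1 and i. Exchanging the first two negates the volume, while
  every triple of distinct points lies in a single orbit, so the faces do not distinguish the two
  tuples.\<close>

lemma volc_not_coboundary: "\<not> coboundary 3 volc"
proof -
  obtain m :: "(grat mat \<Rightarrow> real) \<Rightarrow> real" where m: "borel_mean m" using ex_borel_mean by blast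
  interpret borel_mean m by (rule m)
  define j where "j = Abs_grat \<i>"
  have j: "emb j = \<i>" by (simp add: j_def Abs_grat_inverse)
  then have j0: "j \<noteq> 0" by auto
  define a where "a = (0 :: grat mat)"
  define b where "b = (Mt 0 (-1) 1 0 :: grat mat)"
  define c where "c = (Mt 1 0 1 1 :: grat mat)"
  define d where "d = (Mt j 0 1 1 :: grat mat)"
  have sel: "m11 a = 1" "m21 a = 0" "m11 b = 0" "m21 b = 1" "m11 c = 1" "m21 c = 1" "m11 d = j" "m21 d = 1"
    by (simp_all add: a_def b_def c_def d_def sel_zero_mat Mt_sel okdet_grat_def j0)
  have triple: "imean m [x, y, z] \<beta> = imean m [a, b, c] \<beta>"
    if n: "cdet x y \<noteq> 0" "cdet x z \<noteq> 0" "cdet y z \<noteq> 0" and \<beta>: "translation_inv \<beta>" "bddf \<beta>" for x y z \<beta>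
  proof -
    \<comment> \<open>Cramer's rule: \<open>s\<close> and \<open>t\<close> are the coefficients of z
      in terms of x and y. The matrix with columns s x and t y sends infinity, 0, 1 to x, y,
      z.\<close>
    define s where "s = cdet z y / cdet x y"
    define t where "t = cdet x z / cdet x y"
    have st: "s \<noteq> 0" "t \<noteq> 0" using n cdet_swap[of y z] by (auto simp: s_def t_def)
    have z: "s * m11 x + t * m11 y = m11 z" "s * m21 x + t * m21 y = m21 z"
    proof -
      have "cdet z y * m11 x + cdet x z * m11 y = m11 z * cdet x y" "cdet z y * m21 x + cdet x z * m21 y = m21 z * cdet x y"
        by (simp_all add: cdet_def algebra_simps)
      then show "s * m11 x + t * m11 y = m11 z" "s * m21 x + t * m21 y = m21 z"
        using n(1) by (simp_all add: s_def t_def add_divide_distrib[symmetric])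
    qed
    define g where "g = Mt (s * m11 x) (t * m11 y) (s * m21 x) (t * m21 y)"
    have "(s * m11 x) * (t * m21 y) - (t * m11 y) * (s * m21 x) = s * t * cdet x y" by (simp add: cdet_def algebra_simps)
    then have "okdet ((s * m11 x) * (t * m21 y) - (t * m11 y) * (s * m21 x))" using st n by (simp add: okdet_grat_def)
    then have "par (map ((+) g) [a, b, c]) [x, y, z]"
      by (simp add: par_def g_def cdet_def sel_plus_mat sel Mt_sel z)
    then show ?thesis by (rule imean_orbit[OF \<beta>])
  qed
  have j1: "j \<noteq> 1"
  proof
    assume "j = 1"
    then have "emb j = 1" by simp
    then show False using j by (simp add: complex_eq_iff)
  qed
  have nz: "cdet a b \<noteq> 0" "cdet b a \<noteq> 0" "cdet a c \<noteq> 0" "cdet b c \<noteq> 0" "cdet a d \<noteq> 0" "cdet b d \<noteq> 0" "cdet c d \<noteq> 0"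
    using j0 j1 by (simp_all add: cdet_def sel)
  \<comment> \<open>Two of the three angles are equal, that of 1 + i, and contribute half of
    \<open>Im (Li2 \<i>)\<close> each; the remaining one is a right angle, where \<open>ell\<close>
    vanishes.\<close>
  have "vol4 a b c d = vol (1 - \<i>) (- \<i>) (- 1)" by (simp add: vol4_def cdet_def sel j)
  also have "\<dots> = Im (Li2 \<i>)"
  proof -
    have f1: "(1 - \<i>) / (- \<i>) = 1 + \<i>" by (simp add: complex_eq_iff Re_divide Im_divide)
    have f2: "- 1 / (1 - \<i>) = of_real (- 1 / 2) * (1 + \<i>)" by (simp add: complex_eq_iff Re_divide Im_divide)
    have f3: "ell \<i> = 0"
    proof -
      have "Li2 (cnj (-1)) = cnj (Li2 (-1))" by (rule Li2_cnj) simp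
      then have "Im (Li2 (-1)) = 0" by (simp add: complex_eq_iff)
      moreover have "\<i> / cnj \<i> = -1" by (simp add: complex_eq_iff Re_divide Im_divide)
      ultimately show ?thesis by (simp add: ell_def)
    qed
    have "(1 + \<i>) / cnj (1 + \<i>) = \<i>" by (simp add: complex_eq_iff Re_divide Im_divide)
    then have f4: "ell (1 + \<i>) = Im (Li2 \<i>) / 2" unfolding ell_def by simp
    have f5: "ell (of_real (- 1 / 2) * (1 + \<i>)) = ell (1 + \<i>)" by (rule ell_scale) simp
    have f6: "- \<i> / - 1 = \<i>" by simp
    show ?thesis unfolding vol_def f1 f2 f5 f6 f3 f4 by simp
  qed
  finally have v: "vol4 a b c d > 0" using Im_Li2_i_pos by simp
  have "detects 3 (\<lambda>f. imean m [a, b, c, d] f - imean m [b, a, c, d] f) volc"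
  proof (rule detects_by_mean[of _ _ _ _ "[a, b, c]"])
    show "volc [a, b, c, d] \<noteq> volc [b, a, c, d]" using v vol4_anti(1)[of b a c d] by simp
    show "volc l = volc l'" if pl: "par l l'" for l l'
    proof (cases l rule: volc.cases)
      case (1 x y z w)
      then obtain x' y' z' w' where l': "l' = [x', y', z', w']" "cdet x x' = 0" "cdet y y' = 0" "cdet z z' = 0" "cdet w w' = 0"
        using pl by (auto simp: par_def list_all2_Cons1)
      then show ?thesis using 1 vol4_par by simp
    qed (use pl in \<open>auto simp: par_def list_all2_Cons1\<close>)
    fix \<beta> :: "grat mat list \<Rightarrow> real" and i :: nat assume \<beta>: "translation_inv \<beta>" "bddf \<beta>" "i \<le> 3"
    then have i: "i = 0 \<or> i = Suc 0 \<or> i = Suc (Suc 0) \<or> i = Suc (Suc (Suc 0))" by auto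
    note tr = triple[OF _ _ _ \<beta>(1,2)]
    have "imean m [b, c, d] \<beta> = imean m [a, b, c] \<beta>" "imean m [a, c, d] \<beta> = imean m [a, b, c] \<beta>"
      "imean m [a, b, d] \<beta> = imean m [a, b, c] \<beta>" "imean m [b, a, c] \<beta> = imean m [a, b, c] \<beta>"
      "imean m [b, a, d] \<beta> = imean m [a, b, c] \<beta>"
      by (rule tr; rule nz)+
    then show "imean m (del i [a, b, c, d]) \<beta> = imean m [a, b, c] \<beta>" "imean m (del i [b, a, c, d]) \<beta> = imean m [a, b, c] \<beta>"
      using i by (elim disjE; simp only: del_0 del_Suc)+
  qed auto
  then show ?thesis by (rule detects_not_coboundary)
qed

section \<open>Nontrivial classes of the lamp group in all degrees\<close>

type_synonym lampgp = "rat mat \<times> grat mat"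

text \<open>For injective \<open>h\<close>, \<open>push h\<close> embeds the direct sum into the
  lamps in the range of \<open>h\<close>, and \<open>pull h\<close> restricts to these lamps; it is
  a retraction for the embedding.\<close>

definition pull :: "(nat \<Rightarrow> nat) \<Rightarrow> 'g::group_add fs \<Rightarrow> 'g fs" where
  "pull h x = Abs_fs (\<lambda>j. lamp x (h j))"

definition push :: "(nat \<Rightarrow> nat) \<Rightarrow> 'g::group_add fs \<Rightarrow> 'g fs" where
  "push h x = Abs_fs (\<lambda>i. if i \<in> range h then lamp x (inv_into UNIV h i) else 0)"

lemma lamp_pull: assumes "inj h" shows "lamp (pull h x) j = lamp x (h j)"
proof -
  have "{j. lamp x (h j) \<noteq> 0} = h -` {i. lamp x i \<noteq> 0}" by auto
  then have "finite {j. lamp x (h j) \<noteq> 0}" using finite_vimageI[OF finite_lamp assms] by simp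
  then show ?thesis by (simp add: pull_def lamp_Abs_fs)
qed

lemma lamp_push: assumes "inj h"
  shows "lamp (push h x) i = (if i \<in> range h then lamp x (inv_into UNIV h i) else 0)"
proof -
  have "{i. (if i \<in> range h then lamp x (inv_into UNIV h i) else 0) \<noteq> 0} \<subseteq> h ` {i. lamp x i \<noteq> 0}"
    using assms by (auto simp: inv_f_f split: if_splits)
  then have "finite {i. (if i \<in> range h then lamp x (inv_into UNIV h i) else 0) \<noteq> 0}"
    by (rule finite_subset[OF _ finite_imageI[OF finite_lamp]])
  then show ?thesis by (simp add: push_def lamp_Abs_fs)
qed

lemma pull_push: "inj h \<Longrightarrow> pull h (push h x) = x"
  by (rule fs_eqI) (simp add: lamp_pull lamp_push inv_f_f)

lemma pull_push_0: "inj h \<Longrightarrow> inj h' \<Longrightarrow> range h \<inter> range h' = {} \<Longrightarrow> pull h (push h' x) = 0"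
  by (rule fs_eqI) (auto simp: lamp_pull lamp_push)

lemma additive_pull: "inj h \<Longrightarrow> additive (pull h)"
  by (auto simp: additive_def lamp_pull intro!: fs_eqI)

lemma additive_push: "inj h \<Longrightarrow> additive (push h)"
  by (auto simp: additive_def lamp_push intro!: fs_eqI)

lemma retract_class:
  assumes "additive r" "additive s" "\<And>a. r (s a) = a" "cocycle n c" "\<not> coboundary n c"
  shows "cocycle n (\<lambda>xs. c (map r xs))" "\<not> coboundary n (\<lambda>xs. c (map r xs))"
proof -
  show "cocycle n (\<lambda>xs. c (map r xs))" by (rule cocycle_pullback[OF assms(1,4)])
  have "map r (map s xs) = xs" for xs using assms(3) by (simp add: comp_def)
  then show "\<not> coboundary n (\<lambda>xs. c (map r xs))"
    using coboundary_pullback[OF assms(2), of n "\<lambda>xs. c (map r xs)"] assms(5) by auto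
qed

text \<open>For \<open>n\<close> at least 4, lamp 0 carries the orientation class, and the lamps
  from 1 on form a copy of the whole group with a class of degree \<open>n - 2\<close>. The two
  parts commute, so the product of the classes is nontrivial.\<close>

lemma nontrivial_class:
  "n \<ge> 2 \<Longrightarrow> \<exists>c :: lampgp fs list \<Rightarrow> real. cocycle n c \<and> \<not> coboundary n c"
proof (induction n rule: less_induct)
  case (less n)
  define r :: "lampgp fs \<Rightarrow> rat mat" where "r = (\<lambda>x. fst (lamp x 0))"
  define s :: "rat mat \<Rightarrow> lampgp fs" where "s = (\<lambda>a. single 0 (a, 0))"
  define r' :: "lampgp fs \<Rightarrow> grat mat" where "r' = (\<lambda>x. snd (lamp x 0))"
  define s' :: "grat mat \<Rightarrow> lampgp fs" where "s' = (\<lambda>a. single 0 (0, a))"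
  have add: "additive r" "additive s" "additive r'" "additive s'"
    by (auto simp: additive_def r_def s_def r'_def s'_def lamp_single intro!: fs_eqI)
  have rs: "r (s a) = a" "r' (s' b) = b" for a b by (simp_all add: r_def s_def r'_def s'_def lamp_single)
  obtain \<mu> where \<mu>: "detects 2 \<mu> orient" using ex_detects_orient by blast
  consider "n = 2" | "n = 3" | k where "n = 2 + k" "k \<ge> 2"
  proof -
    have "n = 2 \<or> n = 3 \<or> n = 2 + (n - 2) \<and> n - 2 \<ge> 2" using less.prems by arith
    then show ?thesis using that by blast
  qed
  then show ?case
  proof cases
    case 1
    then show ?thesis using retract_class[OF add(1,2) rs(1) cocycle_orient detects_not_coboundary[OF \<mu>]] by blast
  next
    case 2
    then show ?thesis using retract_class[OF add(3,4) rs(2) cocycle_volc volc_not_coboundary] by blast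
  next
    case (3 k)
    obtain c :: "lampgp fs list \<Rightarrow> real" where c: "cocycle k c" "\<not> coboundary k c"
      using less.IH[of k] 3 by auto
    have iS: "inj Suc" by simp
    have "\<not> coboundary (2 + k) (cup 2 (\<lambda>xs. orient (map r xs)) (\<lambda>xs. c (map (pull Suc) xs)))"
    proof (rule cup_not_coboundary[OF add(2) additive_push[OF iS] add(1) additive_pull[OF iS] _ _ _ cocycle_orient normalized_orient \<mu> c(2)])
      fix a :: "rat mat" and y :: "lampgp fs"
      have p0: "lamp (push Suc y) 0 = 0" by (auto simp: lamp_push)
      have c': "lamp (s a) j = 0 \<or> lamp (push Suc y) j = 0" for j
        using p0 by (cases j) (auto simp: s_def lamp_single)
      show "s a + push Suc y = push Suc y + s a"
      proof (rule fs_eqI)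
        fix j show "lamp (s a + push Suc y) j = lamp (push Suc y + s a) j" using c'[of j] by auto
      qed
      show "r (s a + push Suc y) = a" using p0 by (simp add: r_def s_def lamp_single)
      show "pull Suc (s a + push Suc y) = y"
        by (rule fs_eqI) (simp add: lamp_pull s_def lamp_single lamp_push inv_f_f)
    qed
    moreover have "cocycle (2 + k) (cup 2 (\<lambda>xs. orient (map r xs)) (\<lambda>xs. c (map (pull Suc) xs)))"
      by (intro cocycle_cup cocycle_pullback add additive_pull iS cocycle_orient c)
    ultimately show ?thesis using 3 by blast
  qed
qed

section \<open>A continuum of linearly independent classes\<close>

definition copy :: "nat \<Rightarrow> nat \<Rightarrow> nat" where "copy i j = prod_encode (i, j)"

lemma inj_copy: "inj (copy i)" by (auto simp: inj_on_def copy_def)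
lemma copy_disjoint: "i \<noteq> k \<Longrightarrow> range (copy i) \<inter> range (copy k) = {}" by (auto simp: copy_def)

text \<open>The retractions belong to pairwise disjoint sets of lamps. Copies in which all entries
  are trivial still contribute the value of \<open>c\<close> at the trivial tuple, so convergence
  has to come from the geometric weights.\<close>

definition mix :: "('g::group_add fs list \<Rightarrow> real) \<Rightarrow> real \<Rightarrow> 'g fs list \<Rightarrow> real" where
  "mix c t xs = suminf (\<lambda>i. t ^ i * c (map (pull (copy i)) xs))"

lemma summable_mix:
  assumes "bddf f" "0 < t" "t < 1" shows "summable (\<lambda>i. t ^ i * f i :: real)"
proof -
  obtain C where C: "C \<ge> 0" "\<And>l. \<bar>f l\<bar> \<le> C" using assms(1) by (rule bddfE) blast
  have "summable (\<lambda>i. t ^ i * C)" using assms by (intro summable_mult2 summable_geometric) auto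
  then show ?thesis
    by (rule summable_comparison_test') (use C assms in \<open>auto simp: abs_mult intro!: mult_left_mono\<close>)
qed

lemma cocycle_mix:
  assumes c: "cocycle n c" and t: "0 < t" "t < 1" shows "cocycle n (mix c t)"
  unfolding cocycle_def
proof (intro conjI allI impI)
  let ?c = "\<lambda>i xs. c (map (pull (copy i)) xs)"
  have cc: "cocycle n (?c i)" for i by (rule cocycle_pullback[OF additive_pull[OF inj_copy] c])
  have bc: "bddf c" using c by (simp add: cocycle_def)
  obtain C where C: "C \<ge> 0" "\<And>l. \<bar>c l\<bar> \<le> C" using bc by (rule bddfE) blast
  have sm: "summable (\<lambda>i. t ^ i * ?c i xs)" for xs
    by (rule summable_mix[OF bddf_comp[OF bc] t])
  show "translation_inv (mix c t)" using cc by (simp add: translation_inv_def mix_def cocycle_def)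
  have sg: "summable (\<lambda>i. t ^ i * C)" using t by (intro summable_mult2 summable_geometric) auto
  have "\<bar>mix c t xs\<bar> \<le> suminf (\<lambda>i. t ^ i * C)" for xs
    unfolding mix_def real_norm_def[symmetric]
    by (rule norm_suminf_le[OF _ sg]) (use C t in \<open>auto simp: abs_mult intro!: mult_left_mono\<close>)
  then show "bddf (mix c t)" by (rule bddf_I)
  fix xs :: "'a fs list" assume len: "length xs = n + 2"
  have "cobd (mix c t) xs = (\<Sum>j<length xs. (-1) ^ j * suminf (\<lambda>i. t ^ i * ?c i (del j xs)))"
    by (simp add: cobd_sum mix_def)
  also have "\<dots> = (\<Sum>j<length xs. suminf (\<lambda>i. (-1) ^ j * (t ^ i * ?c i (del j xs))))"
    by (simp add: suminf_mult[OF sm])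
  also have "\<dots> = suminf (\<lambda>i. \<Sum>j<length xs. (-1) ^ j * (t ^ i * ?c i (del j xs)))"
    by (rule suminf_sum[symmetric]) (rule summable_mult[OF sm])
  also have "\<dots> = suminf (\<lambda>i. t ^ i * cobd (?c i) xs)"
    by (simp add: cobd_sum sum_distrib_left mult_ac)
  also have "\<dots> = 0" using cc len by (simp add: cocycle_def)
  finally show "cobd (mix c t) xs = 0" .
qed

text \<open>On the k-th copy every other retraction sees the trivial tuple, which leaves an additive
  constant. In odd degree a cocycle vanishes on the trivial tuple, so the constant is 0 there; this
  is the form that \<open>const_cocycle_coboundary\<close> asks for.\<close>

lemma mix_push:
  assumes c: "cocycle n c" and t: "0 < t" "t < 1"
  obtains K where "\<And>xs. length xs = n + 1 \<Longrightarrow> mix c t (map (push (copy k)) xs) = t ^ k * c xs + K" "odd n \<Longrightarrow> K = 0"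
proof -
  define z where "z = map (\<lambda>_. 0 :: 'a fs) [0..<n + 1]"
  have bc: "bddf c" using c by (simp add: cocycle_def)
  define f where "f = (\<lambda>i. if i = k then 0 else c z)"
  have bf: "bddf f" by (rule bddf_I[of _ "\<bar>c z\<bar>"]) (simp add: f_def)
  have 1: "mix c t (map (push (copy k)) xs) = t ^ k * c xs + suminf (\<lambda>i. t ^ i * f i)" if len: "length xs = n + 1" for xs
  proof -
    have "map (pull (copy i)) (map (push (copy k)) xs) = (if i = k then xs else z)" for i
    proof (cases "i = k")
      case True then show ?thesis by (simp add: comp_def pull_push[OF inj_copy])
    next
      case False
      then show ?thesis using len
        by (simp add: comp_def pull_push_0[OF inj_copy inj_copy copy_disjoint] z_def map_replicate_const)
    qed
    then have "mix c t (map (push (copy k)) xs) = suminf (\<lambda>i. t ^ i * (if i = k then c xs else 0) + t ^ i * f i)"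
      unfolding mix_def by (intro arg_cong[of _ _ suminf] ext) (simp add: f_def)
    also have "\<dots> = suminf (\<lambda>i. t ^ i * (if i = k then c xs else 0)) + suminf (\<lambda>i. t ^ i * f i)"
    proof (rule suminf_add[symmetric])
      show "summable (\<lambda>i. t ^ i * (if i = k then c xs else 0))"
        by (rule summable_mix[OF bddf_I[of _ "\<bar>c xs\<bar>"] t]) simp
      show "summable (\<lambda>i. t ^ i * f i)" by (rule summable_mix[OF bf t])
    qed
    also have "suminf (\<lambda>i. t ^ i * (if i = k then c xs else 0)) = t ^ k * c xs"
      using suminf_finite[of "{k}" "\<lambda>i. t ^ i * (if i = k then c xs else 0)"] by simp
    finally show ?thesis .
  qed
  have 2: "suminf (\<lambda>i. t ^ i * f i) = 0" if "odd n"
  proof -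
    define zz where "zz = map (\<lambda>_. 0 :: 'a fs) [0..<n + 2]"
    have "cobd c zz = cobd (\<lambda>l. c (map (\<lambda>_. 0) l)) zz" unfolding zz_def cobd_map[symmetric] by (simp add: comp_def)
    also have "\<dots> = cobd (\<lambda>_. c z) zz"
      by (rule cobd_cong) (auto simp: zz_def z_def map_replicate_const)
    also have "\<dots> = c z" using that by (simp add: cobd_const zz_def)
    finally have "c z = 0" using c by (simp add: cocycle_def zz_def)
    then have "f = (\<lambda>_. 0)" by (auto simp: f_def)
    then show ?thesis by simp
  qed
  show ?thesis by (rule that[OF 1 2])
qed

text \<open>The relations extend from powers to all polynomials; the product of the linear factors
  at the other nodes isolates \<open>u t0\<close>.\<close>

lemma vandermonde:
  fixes u :: "real \<Rightarrow> real"
  assumes "finite T" "\<And>k::nat. (\<Sum>t\<in>T. u t * t ^ k) = 0" "t0 \<in> T"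
  shows "u t0 = 0"
proof -
  define p where "p = (\<Prod>t\<in>T - {t0}. [:- t, 1:])"
  have "(\<Sum>t\<in>T. u t * poly p t) = (\<Sum>t\<in>T. \<Sum>k\<le>degree p. coeff p k * (u t * t ^ k))"
    by (simp add: poly_altdef sum_distrib_left mult_ac)
  also have "\<dots> = (\<Sum>k\<le>degree p. coeff p k * (\<Sum>t\<in>T. u t * t ^ k))"
    by (subst sum.swap) (simp add: sum_distrib_left)
  also have "\<dots> = 0" using assms(2) by simp
  finally have "(\<Sum>t\<in>T. u t * poly p t) = 0" .
  moreover have "poly p t = 0" if "t \<in> T - {t0}" for t using that assms(1) by (auto simp: p_def poly_prod)
  then have "(\<Sum>t\<in>T. u t * poly p t) = u t0 * poly p t0"
    using sum.remove[OF assms(1,3), of "\<lambda>t. u t * poly p t"] by simp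
  moreover have "poly p t0 \<noteq> 0" using assms(1) by (auto simp: p_def poly_prod)
  ultimately show ?thesis by simp
qed

text \<open>Restricted to the k-th copy, the combination becomes the sum of the
  \<open>u t * t ^ k\<close> times \<open>c\<close>, up to a constant that is a coboundary. As
  \<open>c\<close> is not one, the sum is 0 for every \<open>k\<close>, and the Vandermonde argument
  applies.\<close>

lemma mix_independent:
  assumes c: "cocycle n c" "\<not> coboundary n c" and n: "n \<ge> 1" and T: "finite T" "T \<subseteq> {0<..<1}"
    and cb: "coboundary n (\<lambda>xs. \<Sum>t\<in>T. u t * mix c t xs)" and t0: "t0 \<in> T"
  shows "u t0 = (0::real)"
proof (rule vandermonde[OF T(1) _ t0])
  fix k
  have "\<exists>K. (\<forall>xs. length xs = n + 1 \<longrightarrow> mix c t (map (push (copy k)) xs) = t ^ k * c xs + K) \<and> (odd n \<longrightarrow> K = 0)" if "t \<in> T" for t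
  proof -
    have "0 < t" "t < 1" using that T by auto
    then show ?thesis using mix_push[OF c(1), of t k] by metis
  qed
  then obtain K where K: "\<And>t xs. t \<in> T \<Longrightarrow> length xs = n + 1 \<Longrightarrow> mix c t (map (push (copy k)) xs) = t ^ k * c xs + K t"
    "\<And>t. t \<in> T \<Longrightarrow> odd n \<Longrightarrow> K t = 0" by metis
  let ?a = "\<Sum>t\<in>T. u t * t ^ k" let ?K = "\<Sum>t\<in>T. u t * K t"
  have "coboundary n (\<lambda>xs. \<Sum>t\<in>T. u t * mix c t (map (push (copy k)) xs))"
    by (rule coboundary_pullback[OF additive_push[OF inj_copy] cb])
  moreover have "(\<Sum>t\<in>T. u t * mix c t (map (push (copy k)) xs)) = ?a * c xs + ?K" if "length xs = n + 1" for xs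
    using that by (simp add: K sum.distrib sum_distrib_right distrib_left mult.assoc)
  ultimately have 1: "coboundary n (\<lambda>xs. ?a * c xs + ?K)" by (simp cong: coboundary_cong)
  have "coboundary n (\<lambda>_. - ?K)" by (rule const_cocycle_coboundary[OF n]) (simp add: K)
  from coboundary_add[OF 1 this] have 2: "coboundary n (\<lambda>xs. ?a * c xs)" by simp
  show "?a = 0"
  proof (rule ccontr)
    assume "?a \<noteq> 0"
    then have "coboundary n c" using coboundary_cmult[OF 2, of "1 / ?a"] by simp
    then show False using c(2) by simp
  qed
qed

section \<open>Dimension count\<close>

definition indep_mod :: "('a list \<Rightarrow> real) set \<Rightarrow> ('a list \<Rightarrow> real) set \<Rightarrow> bool" where
  "indep_mod B S \<longleftrightarrow> (\<forall>T c. finite T \<and> T \<subseteq> S \<and> lincomb c T \<in> B \<longrightarrow> (\<forall>t\<in>T. c t = 0))"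

text \<open>A maximal independent set modulo \<open>B\<close> spans: when \<open>z\<close> is added,
  a dependency arises in which \<open>z\<close> has nonzero coefficient, and it is solved for
  \<open>z\<close>.\<close>

lemma extend_to_basis_mod:
  assumes B: "(\<lambda>_. 0) \<in> B" "\<And>b k. b \<in> B \<Longrightarrow> (\<lambda>x. k * b x) \<in> B"
    and S0: "S0 \<subseteq> Z" "indep_mod B S0"
  shows "\<exists>S. S0 \<subseteq> S \<and> S \<subseteq> Z \<and> indep_mod B S
    \<and> (\<forall>z\<in>Z. \<exists>T c b. finite T \<and> T \<subseteq> S \<and> b \<in> B \<and> z = (\<lambda>xs. lincomb c T xs + b xs))"
proof -
  define A where "A = {S. S0 \<subseteq> S \<and> S \<subseteq> Z \<and> indep_mod B S}"
  have "\<exists>M\<in>A. \<forall>U\<in>A. M \<subseteq> U \<longrightarrow> U = M"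
  proof (rule subset_Zorn_nonempty)
    show "A \<noteq> {}" using S0 by (auto simp: A_def)
    fix C assume C: "C \<noteq> {}" "subset.chain A C"
    have CA: "C \<subseteq> A" using C(2) by (auto simp: subset.chain_def)
    have "indep_mod B (\<Union>C)" unfolding indep_mod_def
    proof (intro allI impI)
      fix T c assume T: "finite T \<and> T \<subseteq> \<Union>C \<and> lincomb c T \<in> B"
      obtain U where "U \<in> C" "T \<subseteq> U"
        using finite_subset_Union_chain[of T C A] T C by blast
      then show "\<forall>t\<in>T. c t = 0" using CA T unfolding A_def indep_mod_def by blast
    qed
    then show "\<Union>C \<in> A" using CA C(1) unfolding A_def by blast
  qed
  then obtain S where S: "S \<in> A" "\<And>U. U \<in> A \<Longrightarrow> S \<subseteq> U \<Longrightarrow> U = S" by blast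
  have SA: "S0 \<subseteq> S" "S \<subseteq> Z" "indep_mod B S" using S(1) by (auto simp: A_def)
  have span: "\<exists>T c b. finite T \<and> T \<subseteq> S \<and> b \<in> B \<and> z = (\<lambda>xs. lincomb c T xs + b xs)" if z: "z \<in> Z" for z
  proof (cases "z \<in> S")
    case True
    then show ?thesis using B(1)
      by (intro exI[of _ "{z}"] exI[of _ "\<lambda>_. 1"] exI[of _ "\<lambda>_. 0"]) (auto simp: lincomb_def)
  next
    case False
    have "insert z S \<notin> A" using S(2)[of "insert z S"] False by blast
    then have "\<not> indep_mod B (insert z S)" using SA z by (auto simp: A_def)
    then obtain T c t where T: "finite T" "T \<subseteq> insert z S" "lincomb c T \<in> B" "t \<in> T" "c t \<noteq> 0"
      unfolding indep_mod_def by blast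
    have zT: "z \<in> T" "c z \<noteq> 0"
    proof -
      show zt: "z \<in> T"
      proof (rule ccontr)
        assume "z \<notin> T"
        then show False using T SA(3) unfolding indep_mod_def by blast
      qed
      show "c z \<noteq> 0"
      proof
        assume c0: "c z = 0"
        have "lincomb c (T - {z}) = lincomb c T"
          unfolding lincomb_def by (rule ext) (simp add: sum.remove[OF T(1) zt] c0)
        then have "\<forall>t\<in>T - {z}. c t = 0" using T SA(3) unfolding indep_mod_def by (metis finite_Diff subset_insert_iff)
        then show False using T c0 by blast
      qed
    qed
    let ?T = "T - {z}" let ?c = "\<lambda>t. - c t / c z" let ?b = "\<lambda>xs. (1 / c z) * lincomb c T xs"
    have "z xs = lincomb ?c ?T xs + ?b xs" for xs
    proof -
      have "lincomb c T xs = c z * z xs + lincomb c ?T xs" unfolding lincomb_def by (rule sum.remove[OF T(1) zT(1)])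
      moreover have "lincomb ?c ?T xs = - lincomb c ?T xs / c z"
        by (simp add: lincomb_def sum_negf sum_divide_distrib)
      ultimately show ?thesis using zT(2) by (simp add: field_simps)
    qed
    then have "z = (\<lambda>xs. lincomb ?c ?T xs + ?b xs)" by blast
    moreover have "?b \<in> B" by (rule B(2)[OF T(3)])
    moreover have "finite ?T" "?T \<subseteq> S" using T by auto
    ultimately show ?thesis by blast
  qed
  show ?thesis using SA span by blast
qed

text \<open>Each real is coded by a set of naturals, and a sequence of such sets by one set of coded
  pairs.\<close>

lemma nat_real_lepoll_real: "(UNIV :: (nat \<Rightarrow> real) set) \<lesssim> (UNIV :: real set)"
proof -
  obtain g :: "real \<Rightarrow> nat set" where g: "inj g"
    using nat_sets_eqpoll_reals by (meson eqpoll_imp_lepoll eqpoll_sym lepoll_def)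
  let ?h = "\<lambda>f. {prod_encode (i, j) | i j. j \<in> g (f i)}"
  have mem: "prod_encode (i, j) \<in> ?h f \<longleftrightarrow> j \<in> g (f i)" for i j f by (auto simp: prod_encode_eq)
  have "inj ?h"
  proof (rule injI, rule ext)
    fix f f' i assume "?h f = ?h f'"
    then have "g (f i) = g (f' i)" using mem by blast
    then show "f i = f' i" using g by (auto simp: inj_on_def)
  qed
  then have "(UNIV :: (nat \<Rightarrow> real) set) \<lesssim> (UNIV :: nat set set)" unfolding lepoll_def by blast
  then show ?thesis using nat_sets_eqpoll_reals by (metis lepoll_trans2)
qed

text \<open>A cochain is determined by its values on the countably many lists over the carrier. This
  gives the upper bound on the dimension.\<close>

lemma bcochain_lepoll:
  assumes "countable (carrier G)" shows "bcochain G n \<lesssim> (UNIV :: real set)"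
proof -
  let ?L = "lists (carrier G)"
  have cL: "countable ?L" using assms by (rule countable_lists)
  have neL: "?L \<noteq> {}" by auto
  let ?h = "\<lambda>f :: 'a list \<Rightarrow> real. \<lambda>k. f (from_nat_into ?L k)"
  have "inj_on ?h (bcochain G n)"
  proof (rule inj_onI, rule ext)
    fix f f' xs assume f: "f \<in> bcochain G n" "f' \<in> bcochain G n" "?h f = ?h f'"
    show "f xs = f' xs"
    proof (cases "xs \<in> ?L")
      case True
      then obtain k where "xs = from_nat_into ?L k" using cL by (metis from_nat_into_surj)
      then show ?thesis using fun_cong[OF f(3), of k] by simp
    next
      case False
      then have "\<not> set xs \<subseteq> carrier G" by auto
      then have "f xs = 0" "f' xs = 0" using f unfolding bcochain_def by blast+
      then show ?thesis by simp
    qed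
  qed
  then have "bcochain G n \<lesssim> (UNIV :: (nat \<Rightarrow> real) set)" unfolding lepoll_def by blast
  then show ?thesis using nat_real_lepoll_real by (rule lepoll_trans)
qed

lemma zero_bcoboundary: "(\<lambda>_. 0) \<in> bcoboundaries G (Suc m)"
proof -
  have "(\<lambda>_. 0) \<in> bcochain G m" by (auto simp: bcochain_def)
  moreover have "bcobound G m (\<lambda>_. 0) = (\<lambda>_. 0)" by (auto simp: bcobound_def)
  ultimately show ?thesis unfolding bcoboundaries_def by (metis image_eqI nat.simps(5))
qed

lemma bcoboundary_cmult:
  assumes "b \<in> bcoboundaries G (Suc m)" shows "(\<lambda>x. k * b x) \<in> bcoboundaries G (Suc m)"
proof -
  obtain f where f: "f \<in> bcochain G m" "b = bcobound G m f" using assms by (auto simp: bcoboundaries_def)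
  obtain C where C: "\<And>xs. \<bar>f xs\<bar> \<le> C" using f(1) by (auto simp: bcochain_def)
  have "(\<lambda>x. k * f x) \<in> bcochain G m"
    using f(1) C by (auto simp: bcochain_def abs_mult intro!: exI[of _ "\<bar>k\<bar> * C"] mult_left_mono)
  moreover have "(\<lambda>x. k * b x) = bcobound G m (\<lambda>x. k * f x)"
    unfolding f(2) by (auto simp: bcobound_def algebra_simps sum_distrib_left)
  ultimately show ?thesis by (auto simp: bcoboundaries_def)
qed

text \<open>The classes for 0 < t < 1 are independent and extend to a basis. Its size is bounded
  below by the interval and above by the cardinality of the space of cochains.\<close>

theorem bcoh_dim_lamps:
  assumes \<theta>: "tgroup_iso (\<theta> :: lampgp fs \<Rightarrow> 'a) G" and cG: "countable (carrier G)" and n: "n \<ge> 2"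
  shows "bcoh_dim_eqpoll G n (UNIV :: real set)"
proof -
  obtain m where m: "n = Suc m" using n by (cases n) auto
  obtain c :: "lampgp fs list \<Rightarrow> real" where c: "cocycle n c" "\<not> coboundary n c" using nontrivial_class[OF n] by blast
  define f where "f = (\<lambda>t. to_inhom \<theta> G n (mix c t))"
  have fZ: "f t \<in> bcocycles G n" if "t \<in> {0<..<1}" for t
    unfolding f_def by (rule to_inhom_bcocycle[OF \<theta> cocycle_mix[OF c(1)]]) (use that in auto)
  have key: "k t0 = 0" if T: "finite T" "T \<subseteq> {0<..<1}" "t0 \<in> T" and b: "(\<lambda>xs. \<Sum>t\<in>T. k t * f t xs) \<in> bcoboundaries G n" for T k t0
  proof -
    let ?F = "\<lambda>xs. \<Sum>t\<in>T. k t * f t xs"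
    have "bcoboundaries G n \<subseteq> bcochain G n"
    proof
      fix x assume "x \<in> bcoboundaries G n"
      then obtain y where y: "y \<in> bcochain G m" "x = bcobound G m y" by (auto simp: bcoboundaries_def m)
      obtain C where C: "\<And>xs. \<bar>y xs\<bar> \<le> C" using y(1) by (auto simp: bcochain_def)
      have "\<bar>x xs\<bar> \<le> C + m * C + C" for xs
      proof (cases "length xs = Suc m \<and> set xs \<subseteq> carrier G")
        case True
        have "\<bar>\<Sum>i=1..m. (-1)^i * y (take (i - 1) xs @ [xs ! (i - 1) \<otimes>\<^bsub>G\<^esub> xs ! i] @ drop (i + 1) xs)\<bar> \<le> (\<Sum>i=1..m. C)"
          by (rule order_trans[OF sum_abs], rule sum_mono) (simp add: abs_mult power_abs C)
        moreover have "\<bar>(-1) ^ Suc m * y (butlast xs)\<bar> \<le> C" by (simp add: abs_mult power_abs C)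
        ultimately show ?thesis using True C[of "tl xs"] unfolding y(2) bcobound_def by (simp add: abs_le_iff)
      next
        case False
        have "C \<ge> 0" using C[of "[]"] by linarith
        then show ?thesis using False by (auto simp: y(2) bcobound_def)
      qed
      moreover have "length xs = n \<and> set xs \<subseteq> carrier G" if "x xs \<noteq> 0" for xs
        using that unfolding y(2) bcobound_def m by (simp split: if_splits)
      ultimately show "x \<in> bcochain G n" unfolding bcochain_def by blast
    qed
    then have a1: "coboundary n (\<lambda>l. ?F (map \<theta> (increments l)))"
      using b bcoboundary_iff[OF \<theta>, of ?F m] m by auto
    have a2: "?F (map \<theta> (increments xs)) = (\<Sum>t\<in>T. k t * mix c t xs)" if "length xs = n + 1" for xs
    proof (rule sum.cong[OF refl])
      fix t assume "t \<in> T"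
      then have "translation_inv (mix c t)" using cocycle_mix[OF c(1), of t] T by (auto simp: cocycle_def)
      then show "k t * f t (map \<theta> (increments xs)) = k t * mix c t xs"
        unfolding f_def using to_inhom_increments[OF \<theta>] that by simp
    qed
    have a3: "coboundary n (\<lambda>xs. \<Sum>t\<in>T. k t * mix c t xs)" by (rule coboundary_cong[THEN iffD1, OF a2 a1])
    have "n \<ge> 1" using n by simp
    from mix_independent[OF c this T(1,2) a3 T(3)] show ?thesis .
  qed
  have inj: "inj_on f {0<..<1}"
  proof (rule inj_onI, rule ccontr)
    fix s t assume st: "s \<in> {0<..<1}" "t \<in> {0<..<1}" "f s = f t" "s \<noteq> t"
    \<comment> \<open>Equal images of distinct parameters would give the relation with coefficients
      1 and -1, so injectivity is a case of independence.\<close>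
    have "(\<lambda>xs. \<Sum>r\<in>{s, t}. (if r = s then 1 else -1) * f r xs) = (\<lambda>_. 0)" using st by auto
    then have "(\<lambda>xs. \<Sum>r\<in>{s, t}. (if r = s then 1 else -1) * f r xs) \<in> bcoboundaries G n"
      unfolding m by (simp only: zero_bcoboundary)
    from key[OF _ _ _ this, of s] show False using st by simp
  qed
  have ind: "indep_mod (bcoboundaries G n) (f ` {0<..<1})" unfolding indep_mod_def
  proof (intro allI impI ballI)
    fix T k x assume T: "finite T \<and> T \<subseteq> f ` {0<..<1} \<and> lincomb k T \<in> bcoboundaries G n" and x: "x \<in> T"
    obtain T0 where T0: "T0 \<subseteq> {0<..<1}" "T = f ` T0" "finite T0"
      using T finite_subset_image[of T f "{0<..<1}"] by auto
    have i0: "inj_on f T0" using inj T0(1) by (rule inj_on_subset)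
    have "lincomb k T = (\<lambda>xs. \<Sum>t\<in>T0. k (f t) * f t xs)"
      unfolding lincomb_def T0(2) using i0 by (simp add: sum.reindex)
    then have b: "(\<lambda>xs. \<Sum>t\<in>T0. k (f t) * f t xs) \<in> bcoboundaries G n" using T by simp
    obtain t where "t \<in> T0" "x = f t" using x T0(2) by auto
    then show "k x = 0" using key[OF T0(3,1) _ b] by simp
  qed
  have "\<exists>S. f ` {0<..<1} \<subseteq> S \<and> S \<subseteq> bcocycles G n \<and> indep_mod (bcoboundaries G n) S
    \<and> (\<forall>z\<in>bcocycles G n. \<exists>T c b. finite T \<and> T \<subseteq> S \<and> b \<in> bcoboundaries G n \<and> z = (\<lambda>xs. lincomb c T xs + b xs))"
  proof (rule extend_to_basis_mod)
    show "(\<lambda>_. 0) \<in> bcoboundaries G n" unfolding m by (rule zero_bcoboundary)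
    show "(\<lambda>x. k * b x) \<in> bcoboundaries G n" if "b \<in> bcoboundaries G n" for b k
      using that unfolding m by (rule bcoboundary_cmult)
    show "f ` {0<..<1} \<subseteq> bcocycles G n" using fZ by auto
    show "indep_mod (bcoboundaries G n) (f ` {0<..<1})" by (rule ind)
  qed
  then obtain S where S: "f ` {0<..<1} \<subseteq> S" "S \<subseteq> bcocycles G n" "indep_mod (bcoboundaries G n) S"
    "\<forall>z\<in>bcocycles G n. \<exists>T c b. finite T \<and> T \<subseteq> S \<and> b \<in> bcoboundaries G n \<and> z = (\<lambda>xs. lincomb c T xs + b xs)"
    by blast
  have "S \<approx> (UNIV :: real set)"
  proof (rule lepoll_antisym)
    have "S \<subseteq> bcochain G n" using S(2) by (auto simp: bcocycles_def)
    then show "S \<lesssim> (UNIV :: real set)" using bcochain_lepoll[OF cG] by (meson lepoll_trans subset_imp_lepoll)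
    have "(UNIV :: real set) \<approx> {0<..<1::real}" using open_interval_eqpoll_reals[of 0 1] eqpoll_sym by auto
    moreover have "{0<..<1::real} \<lesssim> f ` {0<..<1}" using inj by (metis inj_on_image_eqpoll_self eqpoll_imp_lepoll eqpoll_sym)
    moreover have "f ` {0<..<1} \<lesssim> S" using S(1) by (rule subset_imp_lepoll)
    ultimately show "(UNIV :: real set) \<lesssim> S" by (meson eqpoll_imp_lepoll lepoll_trans)
  qed
  then show ?thesis unfolding bcoh_dim_eqpoll_def
    using S(2,4) S(3)[unfolded indep_mod_def] by (intro exI[of _ S]) blast
qed

section \<open>The group and its normal subgroup\<close>

lemma countable_fs: assumes "countable (UNIV :: 'g::group_add set)" shows "countable (UNIV :: 'g fs set)"
proof -
  let ?h = "\<lambda>l :: 'g list. Abs_fs (\<lambda>j. if j < length l then l ! j else 0)"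
  have "x \<in> ?h ` lists UNIV" for x
  proof -
    obtain N where N: "{j. lamp x j \<noteq> 0} \<subseteq> {..<N}" using finite_nat_bounded[OF finite_lamp] by blast
    have "x = ?h (map (lamp x) [0..<N])"
    proof (rule fs_eqI)
      fix j
      have "finite {j. (if j < length (map (lamp x) [0..<N]) then map (lamp x) [0..<N] ! j else 0) \<noteq> 0}"
        by (rule finite_subset[of _ "{..<N}"]) auto
      then show "lamp x j = lamp (?h (map (lamp x) [0..<N])) j" using N by (auto simp: lamp_Abs_fs)
    qed
    then show ?thesis by blast
  qed
  then have "UNIV = ?h ` lists UNIV" by blast
  then show ?thesis using countable_image[OF countable_lists[OF assms], of ?h] by simp
qed

lemma countable_fsym: "countable (UNIV :: fsym set)"
proof -
  let ?h = "\<lambda>l :: nat list. \<lambda>j. if j < length l then l ! j else j"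
  have "papp x \<in> range ?h" for x
  proof -
    obtain N where N: "{j. papp x j \<noteq> j} \<subseteq> {..<N}" using finite_nat_bounded[OF finite_papp] by blast
    have "papp x = ?h (map (papp x) [0..<N])" using N by (auto simp: fun_eq_iff)
    then show ?thesis by blast
  qed
  then have "range papp \<subseteq> range ?h" by blast
  then have "countable (range papp)" by (rule countable_subset) simp
  then show ?thesis by (rule countable_image_inj_on) (simp add: inj_on_def papp_inject)
qed

lemma countable_wr: assumes "countable (UNIV :: 'g::group_add set)" shows "countable (UNIV :: 'g wr set)"
proof -
  have "countable (UNIV \<times> UNIV :: ('g fs \<times> fsym) set)" by (intro countable_SIGMA countable_fs countable_fsym assms)
  then have "countable (range (unwr :: 'g wr \<Rightarrow> _))" by (rule countable_subset[rotated]) auto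
  then show ?thesis by (rule countable_image_inj_on) (simp add: inj_on_def unwr_inject)
qed

text \<open>The wreath product lives on a type of its own, while the statement asks for a group of
  sets of reals; an injection carries the structure over to its range.\<close>

definition transport :: "('g::group_add \<Rightarrow> 'a) \<Rightarrow> 'a monoid" where
  "transport e = \<lparr>carrier = range e, monoid.mult = \<lambda>x y. e (inv_into UNIV e x + inv_into UNIV e y), one = e 0\<rparr>"

lemma transport_simps:
  "carrier (transport e) = range e" "\<one>\<^bsub>transport e\<^esub> = e 0"
  "inj e \<Longrightarrow> e x \<otimes>\<^bsub>transport e\<^esub> e y = e (x + y)"
  by (simp_all add: transport_def inv_f_f)

lemma group_transport: assumes "inj e" shows "group (transport e)"
proof (rule groupI)
  fix x assume "x \<in> carrier (transport e)"
  then obtain a where "x = e a" by (auto simp: transport_simps)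
  then show "\<exists>y\<in>carrier (transport e). y \<otimes>\<^bsub>transport e\<^esub> x = \<one>\<^bsub>transport e\<^esub>"
    by (intro bexI[of _ "e (- a)"]) (auto simp: transport_simps assms)
qed (auto simp: transport_simps assms add.assoc)

lemma tgroup_iso_transport: "inj e \<Longrightarrow> tgroup_iso e (transport e)"
  by (auto simp: tgroup_iso_def transport_simps bij_betw_def)

lemma wperm_plus [simp]: "wperm (a + b) = wperm a + wperm b" by (simp add: plus_wr_def)
lemma wperm_uminus [simp]: "wperm (- a) = - wperm a" by (simp add: uminus_wr_def)
lemma wperm_diff [simp]: "wperm (a - b) = wperm a - wperm b"
  using wperm_plus[of a "- b"] by (simp del: wperm_plus)
lemma wperm_0 [simp]: "wperm 0 = 0" by (simp add: zero_wr_def)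

theorem theorem4p5:
  shows "\<exists>(\<Gamma> :: real set monoid) H.
           boundedly_acyclic \<Gamma> \<and> H \<lhd> \<Gamma> \<and> boundedly_acyclic (\<Gamma> Mod H)
           \<and> (\<forall>n\<ge>2. bcoh_dim_eqpoll (\<Gamma>\<lparr>carrier := H\<rparr>) n (UNIV :: real set))"
proof -
  have cl: "countable (UNIV :: lampgp set)"
    using countable_SIGMA[OF countable_mat[where 'k = rat] countable_mat[where 'k = grat]] by simp
  define \<nu> where "\<nu> = from_nat_into (UNIV :: lampgp set)"
  have \<nu>: "surj \<nu>" unfolding \<nu>_def using range_from_nat_into[of "UNIV :: lampgp set"] cl by simp
  obtain f :: "lampgp wr \<Rightarrow> nat" where f: "inj f" using countable_wr[OF cl] by (auto simp: countable_def)
  \<comment> \<open>The wreath product is countable; each element is represented by the singleton of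
    its numerical code.\<close>
  define e :: "lampgp wr \<Rightarrow> real set" where "e = (\<lambda>x. {real (f x)})"
  have e: "inj e" using f by (auto simp: e_def inj_on_def)
  define \<Gamma> where "\<Gamma> = transport e"
  define H where "H = e ` {w. wperm w = 0}"
  interpret G: group \<Gamma> unfolding \<Gamma>_def by (rule group_transport[OF e])
  have mult: "e x \<otimes>\<^bsub>\<Gamma>\<^esub> e y = e (x + y)" for x y by (simp add: \<Gamma>_def transport_simps e)
  have car: "carrier \<Gamma> = range e" by (simp add: \<Gamma>_def transport_simps)
  have one: "\<one>\<^bsub>\<Gamma>\<^esub> = e 0" by (simp add: \<Gamma>_def transport_simps)
  have inv: "inv\<^bsub>\<Gamma>\<^esub> e x = e (- x)" for x by (rule G.inv_equality) (auto simp: mult one car)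
  have ba: "boundedly_acyclic \<Gamma>"
    unfolding \<Gamma>_def by (rule boundedly_acyclicI[OF tgroup_iso_transport[OF e] group_transport[OF e]]) (rule coboundary_wr[OF \<nu>])
  have sub: "subgroup H \<Gamma>"
  proof (rule G.subgroupI)
    show "H \<subseteq> carrier \<Gamma>" by (auto simp: H_def car)
    show "H \<noteq> {}" using imageI[of 0 "{w. wperm w = 0}" e] by (auto simp: H_def simp del: image_eqI)
  qed (auto simp: H_def inv mult)
  have nrm: "H \<lhd> \<Gamma>"
    unfolding G.normal_inv_iff using sub by (auto simp: H_def car inv mult)
  have coset: "H #>\<^bsub>\<Gamma>\<^esub> e w = e ` {v. wperm v = wperm w}" for w
  proof -
    have "e v \<in> H #>\<^bsub>\<Gamma>\<^esub> e w" if "wperm v = wperm w" for v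
    proof -
      have "e (v + - w) \<in> H" using that by (auto simp: H_def simp del: add_uminus_conv_diff)
      moreover have "e (v + - w) \<otimes>\<^bsub>\<Gamma>\<^esub> e w = e v" by (simp add: mult)
      ultimately show ?thesis unfolding r_coset_def by force
    qed
    moreover have "H #>\<^bsub>\<Gamma>\<^esub> e w \<subseteq> e ` {v. wperm v = wperm w}" by (auto simp: r_coset_def H_def mult)
    ultimately show ?thesis by auto
  qed
  \<comment> \<open>Permutations with trivial lamps are coset representatives: by
    \<open>coset\<close>, a coset is determined by the permutation part of its elements.\<close>
  define q where "q = (\<lambda>s :: fsym. H #>\<^bsub>\<Gamma>\<^esub> e (Wr 0 s))"
  have q: "tgroup_iso q (\<Gamma> Mod H)"
    unfolding tgroup_iso_def
  proof (intro conjI allI)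
    show "bij_betw q UNIV (carrier (\<Gamma> Mod H))"
    proof (rule bij_betw_imageI)
      show "inj q"
      proof (rule injI)
        fix s t assume "q s = q t"
        moreover have "e (Wr 0 s) \<in> q s" unfolding q_def coset by (rule imageI) simp
        ultimately have "e (Wr 0 s) \<in> e ` {v. wperm v = t}" unfolding q_def coset by simp
        then obtain v where v: "e (Wr 0 s) = e v" "wperm v = t" by blast
        from injD[OF e v(1)] v(2) show "s = t" by auto
      qed
      show "range q = carrier (\<Gamma> Mod H)"
      proof -
        have "H #>\<^bsub>\<Gamma>\<^esub> e w = q (wperm w)" for w by (simp add: q_def coset)
        then show ?thesis by (auto simp: FactGroup_def RCOSETS_def car q_def image_iff)
      qed
    qed
    fix s t
    have "e (Wr 0 s) \<in> carrier \<Gamma>" "e (Wr 0 t) \<in> carrier \<Gamma>" by (auto simp: car)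
    from normal.rcos_sum[OF nrm this]
    show "q (s + t) = q s \<otimes>\<^bsub>\<Gamma> Mod H\<^esub> q t" by (simp add: q_def FactGroup_def mult Wr_plus)
  qed
  have baq: "boundedly_acyclic (\<Gamma> Mod H)"
    by (rule boundedly_acyclicI[OF q normal.factorgroup_is_group[OF nrm]]) (rule coboundary_fsym)
  have h: "tgroup_iso (\<lambda>x. e (Wr x 0)) (\<Gamma>\<lparr>carrier := H\<rparr>)"
    unfolding tgroup_iso_def
  proof (intro conjI allI)
    have "e w \<in> range (\<lambda>x. e (Wr x 0))" if "wperm w = 0" for w
      using that wr_simps(3)[of w] by (metis rangeI)
    then show "bij_betw (\<lambda>x. e (Wr x 0)) UNIV (carrier (\<Gamma>\<lparr>carrier := H\<rparr>))"
      by (auto simp: bij_betw_def inj_on_def H_def inj_eq[OF e])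
  qed (simp add: mult Wr_plus)
  have cH: "countable (carrier (\<Gamma>\<lparr>carrier := H\<rparr>))"
    using countable_wr[OF cl] by (auto simp: H_def intro: countable_subset[OF subset_UNIV])
  have "\<forall>n\<ge>2. bcoh_dim_eqpoll (\<Gamma>\<lparr>carrier := H\<rparr>) n (UNIV :: real set)"
    using bcoh_dim_lamps[OF h cH] by blast
  then show ?thesis using ba nrm baq by blast
qed

end
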